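(* Let $0<\alpha\le 1$, $0<\kappa<1$ and $w\in A_1$. Then there is a constant $C>0$ such that for every sequence $\vec f=(f_1,f_2,\ldots)$ of locally integrable functions on $\mathbb R^n$ ($C$ being independent of $\vec f$), $$\bigg\|\bigg(\sum_{j=1}^\infty\big|\mathcal S_\alpha(f_j)\big|^2\bigg)^{1/2}\bigg\|_{WL^{1,\kappa}(w)}\leq C\,\bigg\|\bigg(\sum_{j=1}^\infty\big|f_j\big|^2\bigg)^{1/2}\bigg\|_{L^{1,\kappa}(w)}.$$
   Context: Intrinsic square function. For $0<\alpha\le1$, let $\mathcal C_\alpha$ be the family of functions $\varphi$ on $\mathbb R^n$ such that $\varphi$ is supported in $\{x\in\mathbb R^n:|x|\le1\}$, $\int_{\mathbb R^n}\varphi(x)\,dx=0$, and $|\varphi(x)-\varphi(x')|\le|x-x'|^\alpha$ for all $x,x'\in\mathbb R^n$. Write $\varphi_t(x)=t^{-n}\varphi(x/t)$ for $t>0$. For $f\in L^1_{loc}(\mathbb R^n)$ and $(y,t)\in\mathbb R^{n+1}_+=\mathbb R^n\times(0,\infty)$ set $$A_\alpha(f)(y,t)=\sup_{\varphi\in\mathcal C_\alpha}|f*\varphi_t(y)|=\sup_{\varphi\in\mathcal C_\alpha}\left|\int_{\mathbb R^n}\varphi_t(y-z)f(z)\,dz\right|,$$ and $$\mathcal S_\alpha(f)(x)=\left(\iint_{\Gamma(x)}\big(A_\alpha(f)(y,t)\big)^2\frac{dy\,dt}{t^{n+1}}\right)^{1/2},\qquad \Gamma(x)=\{(y,t)\in\mathbb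 R^{n+1}_+:|x-y|<t\}.$$ Weights. A weight $w$ is a nonnegative, locally integrable function on $\mathbb R^n$; $w(E)=\int_E w(x)\,dx$ for measurable $E$, and $|E|$ is Lebesgue measure. $w\in A_1$ means there is a constant $C>0$ such that for every ball $B\subseteq\mathbb R^n$, $$\frac1{|B|}\int_B w(x)\,dx\le C\cdot\operatorname*{ess\,inf}_{x\in B}w(x).$$ Weighted Morrey spaces. For $0<\kappa<1$ and a weight $w$, $L^{1,\kappa}(w)$ is the space of $f\in L^1_{loc}(w)$ with $\|f\|_{L^{1,\kappa}(w)}<\infty$, where $$\|f\|_{L^{1,\kappa}(w)}=\sup_B\frac1{w(B)^\kappa}\int_B|f(x)|\,w(x)\,dx,$$ and $WL^{1,\kappa}(w)$ is the space of measurable functions $f$ with $$\|f\|_{WL^{1,\kappa}(w)}=\sup_B\sup_{\lambda>0}\frac1{w(B)^\kappa}\,\lambda\cdot w\big(\{x\in B:|f(x)|>\lambda\}\big)<\infty,$$ the suprema over $B$ being over all balls in $\mathbb R^n$. Norms are understood as values in $[0,\infty]$. *)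

theory Defs
  imports "HOL-Analysis.Analysis"
begin

(* Only exponents p > 0 are used, so top is sent to top and 0 to 0. *)
definition ennreal_powr :: "ennreal \<Rightarrow> real \<Rightarrow> ennreal" where
  "ennreal_powr x p = (if x = top then top else ennreal (enn2real x powr p))"

definition essinf :: "'a measure \<Rightarrow> ('a \<Rightarrow> ennreal) \<Rightarrow> ennreal" where
  "essinf M f = Sup {c. AE x in M. c \<le> f x}"

definition locally_integrable ::
    "('a::euclidean_space \<Rightarrow> 'b::{banach,second_countable_topology}) \<Rightarrow> bool" where
  "locally_integrable f \<longleftrightarrow> (\<forall>K. compact K \<longrightarrow> f absolutely_integrable_on K)"

definition C_class :: "real \<Rightarrow> (real ^ 'n \<Rightarrow> real) set" where
  "C_class \<alpha> = {\<phi>. {x. \<phi> x \<noteq> 0} \<subseteq> cball 0 1 \<and>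
      (LINT x|lebesgue. \<phi> x) = 0 \<and>
      (\<forall>x x'. \<bar>\<phi> x - \<phi> x'\<bar> \<le> norm (x - x') powr \<alpha>)}"

definition dilate :: "(real ^ 'n \<Rightarrow> real) \<Rightarrow> real \<Rightarrow> real ^ 'n \<Rightarrow> real" where
  "dilate \<phi> t x = (1 / t ^ CARD('n)) * \<phi> ((1 / t) *\<^sub>R x)"

(* The test functions are real-valued; f may be complex-valued, which includes
   the real-valued case.  Values lie in [0,top], so suprema and integrals
   need no finiteness side conditions. *)
definition A_fun :: "real \<Rightarrow> (real ^ 'n \<Rightarrow> complex) \<Rightarrow> real ^ 'n \<Rightarrow> real \<Rightarrow> ennreal" where
  "A_fun \<alpha> f y t =
     (SUP \<phi>\<in>C_class \<alpha>. ennreal (cmod (LINT z|lebesgue. dilate \<phi> t (y - z) *\<^sub>R f z)))"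

definition Gamma_cone :: "real ^ 'n \<Rightarrow> ((real ^ 'n) \<times> real) set" where
  "Gamma_cone x = {(y, t). t > 0 \<and> norm (x - y) < t}"

definition S_fun :: "real \<Rightarrow> (real ^ 'n \<Rightarrow> complex) \<Rightarrow> real ^ 'n \<Rightarrow> ennreal" where
  "S_fun \<alpha> f x = ennreal_powr
     (\<integral>\<^sup>+p\<in>Gamma_cone x. (A_fun \<alpha> f (fst p) (snd p))\<^sup>2 * ennreal (1 / snd p ^ (CARD('n) + 1)) \<partial>lebesgue)
     (1/2)"

definition weight :: "(real ^ 'n \<Rightarrow> real) \<Rightarrow> bool" where
  "weight w \<longleftrightarrow> (\<forall>x. 0 \<le> w x) \<and> locally_integrable w"

definition wmeas :: "(real ^ 'n \<Rightarrow> real) \<Rightarrow> (real ^ 'n) set \<Rightarrow> ennreal" where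
  "wmeas w E = (\<integral>\<^sup>+x\<in>E. ennreal (w x) \<partial>lebesgue)"

definition A1_weight :: "(real ^ 'n \<Rightarrow> real) \<Rightarrow> bool" where
  "A1_weight w \<longleftrightarrow> weight w \<and>
     (\<exists>C>0. \<forall>a r. r > 0 \<longrightarrow>
        1 / emeasure lebesgue (ball a r) * (\<integral>\<^sup>+x\<in>ball a r. ennreal (w x) \<partial>lebesgue)
          \<le> ennreal C * essinf (restrict_space lebesgue (ball a r)) (\<lambda>x. ennreal (w x)))"

(* Both norms depend on f only through |f|; they are defined for the [0,top]-valued
   function g = |f|, because the square functions and l^2-sums they are applied
   to may be infinite.  If w vanishes almost everywhere then 1 / 0 * 0 = 0 in ennreal. *)
definition morrey_norm :: "real \<Rightarrow> (real ^ 'n \<Rightarrow> real) \<Rightarrow> (real ^ 'n \<Rightarrow> ennreal) \<Rightarrow> ennreal" where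
  "morrey_norm \<kappa> w g = (SUP (a, r)\<in>UNIV \<times> {0<..}.
     1 / ennreal_powr (wmeas w (ball a r)) \<kappa> *
       (\<integral>\<^sup>+x\<in>ball a r. g x * ennreal (w x) \<partial>lebesgue))"

definition weak_morrey_norm ::
    "real \<Rightarrow> (real ^ 'n \<Rightarrow> real) \<Rightarrow> (real ^ 'n \<Rightarrow> ennreal) \<Rightarrow> ennreal" where
  "weak_morrey_norm \<kappa> w g = (SUP (a, r)\<in>UNIV \<times> {0<..}. SUP s\<in>{0<..}.
     1 / ennreal_powr (wmeas w (ball a r)) \<kappa> *
       (ennreal s * wmeas w {x \<in> ball a r. g x > ennreal s}))"

end

theory Submission
  imports Defs
begin

text \<open>
  Cut the half space into Whitney boxes of size \<open>2\<^sup>k\<close>. A test function at a point of a box is, up to a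
  constant, a test function at the corner of the box, so the square function is dominated by a
  countable sum of coefficients \<open>gcoef\<close> times indicators of balls. Cancellation of the finer kernel
  against the Hoelder continuity of the coarser one makes the kernels almost orthogonal, which bounds
  the coefficients on \<open>L\<^sup>2\<close>. The kernels have compact support and an \<open>A\<^sub>1\<close> weight is on a ball
  essentially bounded below by its mean, so a layer-cake decomposition of the weight passes from
  \<open>L\<^sup>2\<close> to \<open>L\<^sup>2(w)\<close>. Calderon-Zygmund decomposition of the \<open>l\<^sup>2\<close>-norm then gives the weighted
  vector-valued weak type (1,1) bound. In the Morrey norm this handles the part of the functions
  supported in the doubled ball; the remaining part is summed scale by scale, using
  \<open>w(B) \<le> \<theta> w(2B)\<close> with \<open>\<theta> < 1\<close>.
\<close>

section \<open>Countable sums in the extended nonnegative reals\<close>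

text \<open>The obstacle is that \<open>A_fun\<close> is, at every point, a supremum over
  uncountably many test functions: neither linear nor visibly measurable. The coefficients
  \<open>gcoef\<close> remove both difficulties. They are countably many numbers, so the majorant of
  the square function is measurable, and sets defined by \<open>S_fun\<close> are only compared, by
  inclusion, with sets defined by the majorant. And for a given function each coefficient is within
  a factor 2 of its pairing with one kernel, so it is enough that the orthogonality estimates are
  uniform over all choices of kernels. Locality is what admits the weight: a coefficient sees the
  function on one ball only, and on that ball \<open>w\<close> is almost everywhere at least a fixed
  fraction of its mean. The sequence of functions is handled in two ways: quadratic bounds are
  summed over the components, and first-power bounds pass to the \<open>l^2\<close> norm by
  Minkowski's inequality.\<close>

abbreviation csum :: "('a \<Rightarrow> ennreal) \<Rightarrow> ennreal" where
  "csum f \<equiv> \<integral>\<^sup>+i. f i \<partial>count_space UNIV"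

lemma csum_swap:
  fixes f :: "'a::countable \<Rightarrow> 'b \<Rightarrow> ennreal"
  shows "csum (\<lambda>i. csum (\<lambda>j. f i j)) = csum (\<lambda>j. csum (\<lambda>i. f i j))"
  by (rule nn_integral_count_space_nn_integral[symmetric]) auto

lemma nn_integral_csum:
  fixes f :: "'i::countable \<Rightarrow> 'a \<Rightarrow> ennreal"
  assumes "\<And>i. f i \<in> borel_measurable M"
  shows "(\<integral>\<^sup>+x. csum (\<lambda>i. f i x) \<partial>M) = csum (\<lambda>i. \<integral>\<^sup>+x. f i x \<partial>M)"
  by (rule nn_integral_count_space_nn_integral) (use assms in auto)

lemma borel_measurable_csum [measurable (raw)]:
  fixes f :: "'i::countable \<Rightarrow> 'a \<Rightarrow> ennreal"
  assumes [measurable]: "\<And>i. f i \<in> borel_measurable M"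
  shows "(\<lambda>x. csum (\<lambda>i. f i x)) \<in> borel_measurable M"
proof -
  interpret sigma_finite_measure "count_space (UNIV::'i set)"
    by (rule sigma_finite_measure_count_space_countable) auto
  have "(\<lambda>(i, x). f i x) \<in> borel_measurable (count_space UNIV \<Otimes>\<^sub>M M)"
    by measurable
  then have "case_prod (\<lambda>x i. f i x) \<in> borel_measurable (M \<Otimes>\<^sub>M count_space UNIV)"
    by (subst measurable_pair_swap_iff) (simp add: case_prod_unfold)
  then show ?thesis by (rule borel_measurable_nn_integral)
qed

text \<open>The indices whose code under \<open>to_nat\<close> is below \<open>n\<close> form an
  increasing sequence of finite sets exhausting the type, so monotone convergence reduces the claim
  to finite sums. This is how the finite Bessel inequality is carried over to all boxes.\<close>

lemma csum_le_if_sums_le: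
  fixes f :: "'i::countable \<Rightarrow> ennreal"
  assumes "\<And>J. finite J \<Longrightarrow> sum f J \<le> B"
  shows "csum f \<le> B"
proof -
  define J where "J n = {i::'i. to_nat i < n}" for n
  have fin: "finite (J n)" for n
    unfolding J_def by (rule finite_imageD[where f=to_nat])
      (auto intro: finite_subset[of _ "{..<n}"] inj_onI)
  have sup: "(SUP n. f i * indicator (J n) i) = f i" for i
  proof (rule antisym)
    have "f i = f i * indicator (J (Suc (to_nat i))) i" by (simp add: J_def)
    then show "f i \<le> (SUP n. f i * indicator (J n) i)" by (metis SUP_upper UNIV_I)
  qed (auto intro!: SUP_least split: split_indicator)
  have "csum f = csum (\<lambda>i. SUP n. f i * indicator (J n) i)" using sup by simp
  also have "\<dots> = (SUP n. csum (\<lambda>i. f i * indicator (J n) i))"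
    by (rule nn_integral_monotone_convergence_SUP)
       (auto simp: incseq_def le_fun_def J_def split: split_indicator)
  also have "\<dots> \<le> B"
  proof (rule SUP_least)
    fix n
    have "csum (\<lambda>i. f i * indicator (J n) i) = sum (\<lambda>i. f i * indicator (J n) i) (J n)"
      by (rule nn_integral_count_space') (use fin in auto)
    also have "\<dots> = sum f (J n)" by (rule sum.cong) auto
    finally show "csum (\<lambda>i. f i * indicator (J n) i) \<le> B" using assms fin by simp
  qed
  finally show ?thesis .
qed

lemma sum_le_csum: "finite J \<Longrightarrow> sum f J \<le> csum f"
proof -
  assume J: "finite J"
  have "sum f J = csum (\<lambda>i. f i * indicator J i)"
    using J by (subst nn_integral_count_space'[of J]) (auto intro!: sum.cong)
  also have "\<dots> \<le> csum f" by (rule nn_integral_mono) (auto split: split_indicator)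
  finally show ?thesis .
qed

lemma le_csum: "f i \<le> csum f"
  by (rule nn_integral_ge_point) simp

text \<open>The \<open>l^1\<close> norm dominates the \<open>l^2\<close> norm. For the bad part and
  the tail this replaces a square function by a plain sum, to which first-power estimates
  apply.\<close>

lemma csum_power2_le: "csum (\<lambda>i. (f i)\<^sup>2) \<le> (csum f)\<^sup>2"
proof -
  have "csum (\<lambda>i. (f i)\<^sup>2) \<le> csum (\<lambda>i. csum f * f i)"
    by (rule nn_integral_mono) (simp add: power2_eq_square mult_right_mono le_csum)
  also have "\<dots> = (csum f)\<^sup>2" by (simp add: nn_integral_cmult power2_eq_square)
  finally show ?thesis .
qed

lemma csum_prod: "csum f = csum (\<lambda>k. csum (\<lambda>m. f (k, m)))"
  by (rule nn_integral_fst_count_space[symmetric])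

lemma csum_geometric_int:
  fixes q :: real and k :: int
  assumes "0 < q" "q < 1"
  shows "csum (\<lambda>d::int. ennreal (q ^ nat \<bar>d - k\<bar>)) \<le> ennreal (2 / (1 - q))"
proof -
  have g: "(\<Sum>n. ennreal (q ^ n)) = ennreal (1 / (1 - q))"
  proof (rule suminf_ennreal_eq)
    show "(\<lambda>n. q ^ n) sums (1 / (1 - q))" using assms by (intro geometric_sums) auto
  qed (use assms in auto)
  let ?f = "\<lambda>d::int. ennreal (q ^ nat \<bar>d - k\<bar>)"
  have 1: "bij_betw (\<lambda>n::nat. k + int n) UNIV {k..}"
    by (rule bij_betwI[where g="\<lambda>d. nat (d - k)"]) auto
  have 2: "bij_betw (\<lambda>n::nat. k - int n) UNIV {..k}"
    by (rule bij_betwI[where g="\<lambda>d. nat (k - d)"]) auto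
  \<comment> \<open>Both half lines contain \<open>k\<close>; counting it twice makes each of them a
    full geometric series, whence the factor 2.\<close>
  have "csum ?f \<le> csum (\<lambda>d. ?f d * indicator {k..} d + ?f d * indicator {..k} d)"
    by (rule nn_integral_mono) (auto split: split_indicator)
  also have "\<dots> = (\<integral>\<^sup>+d. ?f d \<partial>count_space {k..}) + (\<integral>\<^sup>+d. ?f d \<partial>count_space {..k})"
    by (subst nn_integral_add) (auto simp: nn_integral_count_space_indicator)
  also have "\<dots> = (\<Sum>n. ennreal (q ^ n)) + (\<Sum>n. ennreal (q ^ n))"
    by (subst nn_integral_bij_count_space[OF 1, symmetric], subst nn_integral_bij_count_space[OF 2, symmetric])
       (simp add: nn_integral_count_space_nat)
  also have "\<dots> = ennreal (2 / (1 - q))"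
    using assms by (simp add: g ennreal_plus[symmetric] del: ennreal_plus)
  finally show ?thesis .
qed

section \<open>Squares and roots in the extended nonnegative reals, norms of integrals, Minkowski's
  inequality\<close>

lemma ennreal_powr_half_power2 [simp]: "(ennreal_powr x (1/2))\<^sup>2 = x"
proof (cases x)
  case (real r)
  then show ?thesis by (simp add: ennreal_powr_def ennreal_power powr_half_sqrt)
qed (simp add: ennreal_powr_def ennreal_top_eq_mult_iff power2_eq_square)

lemma ennreal_power2_mono_iff: "(x::ennreal)\<^sup>2 \<le> y\<^sup>2 \<longleftrightarrow> x \<le> y"
proof
  assume le: "x\<^sup>2 \<le> y\<^sup>2"
  show "x \<le> y"
  proof (cases x; cases y)
    fix a b assume "x = ennreal a" "0 \<le> a" "y = ennreal b" "0 \<le> b"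
    then show ?thesis using le by (simp add: ennreal_power power2_le_iff_abs_le)
  next
    fix b assume "x = top" "y = ennreal b" "0 \<le> b"
    then show ?thesis using le by (simp add: ennreal_power ennreal_top_mult power2_eq_square ennreal_mult[symmetric] top_unique)
  qed auto
qed (simp add: power_mono)

lemma ennreal_power2_sum_le: "((a::ennreal) + b)\<^sup>2 \<le> 2 * a\<^sup>2 + 2 * b\<^sup>2"
proof (cases a; cases b)
  fix x y assume a: "a = ennreal x" "0 \<le> x" "b = ennreal y" "0 \<le> y"
  have "(x + y)\<^sup>2 \<le> 2 * x\<^sup>2 + 2 * y\<^sup>2" using zero_le_power2[of "x - y"]
    by (simp add: power2_eq_square algebra_simps)
  moreover have "(a + b)\<^sup>2 = ennreal ((x+y)\<^sup>2)" "2 * a\<^sup>2 + 2 * b\<^sup>2 = ennreal (2 * x\<^sup>2 + 2 * y\<^sup>2)"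
    using a by (simp_all add: ennreal_mult flip: ennreal_power)
  ultimately show ?thesis by (metis ennreal_leI)
qed (auto simp: power2_eq_square ennreal_top_mult ennreal_mult_top)

text \<open>Holds for every \<open>f\<close>: a function that is not integrable has integral 0 by
  convention.\<close>

lemma ennreal_norm_integral_le:
  "ennreal (norm (integral\<^sup>L M f)) \<le> (\<integral>\<^sup>+x. ennreal (norm (f x)) \<partial>M)"
proof (cases "integrable M f")
  case True then show ?thesis by (rule integral_norm_bound_ennreal)
qed (simp add: not_integrable_integral_eq)

text \<open>Countable additivity followed by the triangle inequality for series. It serves to test
  the bad part of a function against a kernel one cube at a time.\<close>

lemma ennreal_norm_integral_le_csum:
  fixes f :: "'a \<Rightarrow> 'b::{banach,second_countable_topology}" and A :: "'i::countable \<Rightarrow> 'a set"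
  assumes f: "integrable M f" and A: "\<And>i. A i \<in> sets M" and d: "disjoint_family A"
    and off: "\<And>x. x \<in> space M \<Longrightarrow> x \<notin> (\<Union>i. A i) \<Longrightarrow> f x = 0"
  shows "ennreal (norm (integral\<^sup>L M f)) \<le> csum (\<lambda>i. ennreal (norm (LINT x:A i|M. f x)))"
proof -
  \<comment> \<open>The family is moved to \<open>nat\<close> along \<open>to_nat\<close>, with the
    empty set at numbers that are not codes; these contribute 0 and keep the sets disjoint.\<close>
  define A' where "A' n = (if n \<in> range (to_nat::'i\<Rightarrow>nat) then A (from_nat n) else {})" for n
  have A': "A' n \<in> sets M" for n using A by (simp add: A'_def)
  have dA': "A' m \<inter> A' n = {}" if "m \<noteq> n" for m n
  proof (cases "m \<in> range (to_nat::'i\<Rightarrow>nat) \<and> n \<in> range (to_nat::'i\<Rightarrow>nat)")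
    case True
    then obtain i j :: 'i where "m = to_nat i" "n = to_nat j" by auto
    then show ?thesis using that d by (auto simp: A'_def disjoint_family_on_def)
  qed (auto simp: A'_def)
  have un: "(\<Union>n. A' n) = (\<Union>i. A i)"
  proof
    show "(\<Union>i. A i) \<subseteq> (\<Union>n. A' n)"
    proof
      fix x assume "x \<in> (\<Union>i. A i)"
      then obtain i where "x \<in> A i" by blast
      then have "x \<in> A' (to_nat i)" by (simp add: A'_def)
      then show "x \<in> (\<Union>n. A' n)" by blast
    qed
  qed (auto simp: A'_def split: if_splits)
  have si: "set_integrable M (\<Union>n. A' n) f"
    using f A' unfolding set_integrable_def by (intro integrable_mult_indicator) auto
  have "integral\<^sup>L M f = (LINT x:(\<Union>n. A' n)|M. f x)"
    unfolding set_lebesgue_integral_def by (rule Bochner_Integration.integral_cong)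
      (use off un in \<open>auto split: split_indicator\<close>)
  also have "\<dots> = (\<Sum>n. LINT x:A' n|M. f x)"
    by (rule lebesgue_integral_countable_add) (use A' dA' si in auto)
  finally have eq: "integral\<^sup>L M f = (\<Sum>n. LINT x:A' n|M. f x)" .
  have "ennreal (norm (\<Sum>n. LINT x:A' n|M. f x)) \<le> (\<Sum>n. ennreal (norm (LINT x:A' n|M. f x)))"
  proof (cases "summable (\<lambda>n. norm (LINT x:A' n|M. f x))")
    case True
    then have "norm (\<Sum>n. LINT x:A' n|M. f x) \<le> (\<Sum>n. norm (LINT x:A' n|M. f x))"
      by (rule summable_norm)
    then show ?thesis using True by (subst suminf_ennreal2) (auto intro: ennreal_leI)
  next
    case False
    have "(\<Sum>n. ennreal (norm (LINT x:A' n|M. f x))) = top"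
    proof (rule ccontr)
      assume "(\<Sum>n. ennreal (norm (LINT x:A' n|M. f x))) \<noteq> top"
      then have "summable (\<lambda>n. norm (LINT x:A' n|M. f x))"
        by (rule summable_suminf_not_top[rotated]) simp
      with False show False by contradiction
    qed
    then show ?thesis by (simp only: top_greatest)
  qed
  also have "\<dots> = csum (\<lambda>n. ennreal (norm (LINT x:A' n|M. f x)))"
    by (simp add: nn_integral_count_space_nat)
  also have "\<dots> = csum (\<lambda>n. ennreal (norm (LINT x:A' n|M. f x)) * indicator (range (to_nat::'i\<Rightarrow>nat)) n)"
    by (rule nn_integral_cong) (auto simp: A'_def set_lebesgue_integral_def split: split_indicator)
  also have "\<dots> = (\<integral>\<^sup>+n. ennreal (norm (LINT x:A' n|M. f x)) \<partial>count_space (range (to_nat::'i\<Rightarrow>nat)))"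
    by (simp add: nn_integral_count_space_indicator)
  also have "\<dots> = csum (\<lambda>i::'i. ennreal (norm (LINT x:A' (to_nat i)|M. f x)))"
    by (rule nn_integral_bij_count_space[symmetric]) (auto simp: bij_betw_def)
  finally show ?thesis using eq by (simp add: A'_def)
qed

text \<open>Minkowski's integral inequality for \<open>l^2\<close>-valued functions:
  \<open>F\<close> is the pointwise \<open>l^2\<close> norm of the sequence and \<open>h\<close> a
  density. The proof is by duality, testing the vector of integrals against itself: with
  \<open>A\<close> the sum of the squares, Cauchy-Schwarz under the integral gives
  \<open>A <= sqrt A * Y\<close>.\<close>

lemma minkowski_csum:
  fixes f :: "nat \<Rightarrow> 'a \<Rightarrow> complex" and h F :: "'a \<Rightarrow> ennreal"
  assumes [measurable]: "\<And>j. f j \<in> borel_measurable M" "h \<in> borel_measurable M" "F \<in> borel_measurable M"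
    and F: "\<And>x. (\<Sum>j. (ennreal (cmod (f j x)))\<^sup>2) = (F x)\<^sup>2"
  shows "(\<Sum>j. (\<integral>\<^sup>+x. h x * ennreal (cmod (f j x)) \<partial>M)\<^sup>2) \<le> (\<integral>\<^sup>+x. h x * F x \<partial>M)\<^sup>2"
proof -
  define a where "a j = (\<integral>\<^sup>+x. h x * ennreal (cmod (f j x)) \<partial>M)" for j
  define Y where "Y = (\<integral>\<^sup>+x. h x * F x \<partial>M)"
  have part: "(\<Sum>j\<in>J. (ennreal (cmod (f j x)))\<^sup>2) \<le> (F x)\<^sup>2" if "finite J" for x J
    unfolding F[symmetric] using that by (intro sum_le_suminf) auto
  have aY: "a j \<le> Y" for j
    unfolding a_def Y_def
  proof (intro nn_integral_mono mult_left_mono)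
    fix x show "ennreal (cmod (f j x)) \<le> F x" using part[of "{j}" x] by (simp add: ennreal_power2_mono_iff)
  qed auto
  have fin: "(\<Sum>j<N. (a j)\<^sup>2) \<le> Y\<^sup>2" for N
  \<comment> \<open>The argument ends by cancelling \<open>sqrt A\<close>, which must be finite;
    each integral is bounded by \<open>Y\<close>, and only finitely many are taken at a
    time.\<close>
  proof (cases "Y = top")
    case False
    then have fin: "a j < top" for j using aY[of j] by (auto simp: top_unique less_top)
    define r where "r j = enn2real (a j)" for j
    have r: "a j = ennreal (r j)" "0 \<le> r j" for j
      using fin[of j] by (simp_all add: r_def)
    define A where "A = (\<Sum>j<N. (r j)\<^sup>2)"
    have A0: "0 \<le> A" unfolding A_def by (simp add: sum_nonneg)
    have A: "(\<Sum>j<N. (a j)\<^sup>2) = ennreal A"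
      unfolding A_def by (subst sum_ennreal[symmetric]) (auto simp: r ennreal_power)
    have cs: "(\<Sum>j<N. ennreal (r j) * ennreal (cmod (f j x))) \<le> ennreal (sqrt A) * F x" for x
    proof -
      have "(\<Sum>j<N. r j * cmod (f j x))\<^sup>2 \<le> A * (\<Sum>j<N. (cmod (f j x))\<^sup>2)"
        unfolding A_def by (rule Cauchy_Schwarz_ineq_sum)
      then have "(\<Sum>j<N. r j * cmod (f j x)) \<le> sqrt A * sqrt (\<Sum>j<N. (cmod (f j x))\<^sup>2)"
        using real_le_rsqrt by (fastforce simp: real_sqrt_mult)
      then have "ennreal (\<Sum>j<N. r j * cmod (f j x)) \<le> ennreal (sqrt A) * ennreal (sqrt (\<Sum>j<N. (cmod (f j x))\<^sup>2))"
        by (simp add: ennreal_mult[symmetric] A0 sum_nonneg ennreal_leI)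
      also have "ennreal (sqrt (\<Sum>j<N. (cmod (f j x))\<^sup>2)) \<le> F x"
        using part[of "{..<N}" x]
        by (subst ennreal_power2_mono_iff[symmetric]) (simp add: ennreal_power sum_nonneg sum_ennreal)
      finally show ?thesis
        using r by (simp add: sum_ennreal[symmetric] ennreal_mult mult_left_mono)
    qed
    have "ennreal A = (\<Sum>j<N. a j * a j)" using A by (simp add: power2_eq_square)
    also have "\<dots> = (\<Sum>j<N. \<integral>\<^sup>+x. h x * (ennreal (r j) * ennreal (cmod (f j x))) \<partial>M)"
    proof (rule sum.cong)
      fix j
      have "a j * a j = ennreal (r j) * (\<integral>\<^sup>+x. h x * ennreal (cmod (f j x)) \<partial>M)"
        by (metis a_def r(1))
      also have "\<dots> = (\<integral>\<^sup>+x. h x * (ennreal (r j) * ennreal (cmod (f j x))) \<partial>M)"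
        by (subst nn_integral_cmult[symmetric]) (auto simp: ac_simps)
      finally show "a j * a j = \<dots>" .
    qed simp
    also have "\<dots> = (\<integral>\<^sup>+x. h x * (\<Sum>j<N. ennreal (r j) * ennreal (cmod (f j x))) \<partial>M)"
      by (subst nn_integral_sum[symmetric]) (auto simp: sum_distrib_left)
    also have "\<dots> \<le> (\<integral>\<^sup>+x. ennreal (sqrt A) * (h x * F x) \<partial>M)"
      by (rule nn_integral_mono) (use cs in \<open>auto simp: mult.left_commute[of "ennreal (sqrt A)"] intro!: mult_left_mono\<close>)
    also have "\<dots> = ennreal (sqrt A) * Y" unfolding Y_def by (rule nn_integral_cmult) auto
    finally have *: "ennreal A \<le> ennreal (sqrt A) * Y" .
    obtain y where y: "Y = ennreal y" "0 \<le> y" using False by (cases Y) auto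
    have "sqrt A * sqrt A \<le> sqrt A * y" using * A0 y by (simp add: ennreal_mult[symmetric])
    then have "sqrt A \<le> y"
      using A0 y(2) mult_left_le_imp_le[of "sqrt A" "sqrt A" y] by (cases "A = 0") auto
    then have "A \<le> y\<^sup>2" by (rule sqrt_le_D)
    then show ?thesis using A y by (simp add: ennreal_power)
  qed (simp add: power2_eq_square)
  have "(\<Sum>j. (a j)\<^sup>2) \<le> Y\<^sup>2"
    using fin by (intro suminf_le_const) auto
  then show ?thesis by (simp add: a_def Y_def)
qed

section \<open>Discretization of the square function\<close>

definition dyad :: "int \<Rightarrow> real" where
  "dyad k = 2 powi k"

text \<open>The centre of \<open>gball i\<close>, and at the same time the lower corner of the
  dyadic cube with the same index: each ball is centred at a vertex of its cube.\<close>

definition gcentre :: "int \<times> (int ^ 'n) \<Rightarrow> real ^ 'n" where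
  "gcentre i = (\<chi> j. dyad (fst i) * of_int (snd i $ j))"

text \<open>The factor \<open>n + 2\<close> is such that \<open>gball (k, cell k y)\<close> contains \<open>cball y t\<close> whenever
  \<open>dyad k \<le> t < 2 * dyad k\<close>.\<close>

definition gradius :: "int \<times> (int ^ 'n) \<Rightarrow> real" where
  "gradius i = (real CARD('n) + 2) * dyad (fst i)"

definition gball :: "int \<times> (int ^ 'n) \<Rightarrow> (real ^ 'n) set" where
  "gball i = ball (gcentre i) (gradius i)"

definition cell :: "int \<Rightarrow> real ^ 'n \<Rightarrow> int ^ 'n" where
  "cell k x = (\<chi> j. \<lfloor>x $ j / dyad k\<rfloor>)"

text \<open>Abstracts from the functions \<open>dilate \<phi> t (y - z)\<close> of \<open>z\<close>
  with \<phi> in \<open>C_class \<alpha>\<close>: support at scale \<open>t\<close> around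
  \<open>y\<close>, mean zero, and the Hoelder constant that the scaling produces. No profile \<phi>
  is mentioned any more, so kernels with different centres and scales can be compared
  directly.\<close>

definition kernels :: "real \<Rightarrow> real ^ 'n \<Rightarrow> real \<Rightarrow> (real ^ 'n \<Rightarrow> real) set" where
  "kernels \<alpha> y t = {v. (\<forall>z. z \<notin> ball y t \<longrightarrow> v z = 0) \<and> (LINT z|lebesgue. v z) = 0 \<and>
     (\<forall>z z'. \<bar>v z - v z'\<bar> \<le> 1 / t ^ CARD('n) * (norm (z - z') / t) powr \<alpha>)}"

text \<open>One number for a whole Whitney box: up to a constant it majorises
  \<open>A_fun \<alpha> f y t\<close> at all points of the box.\<close>

definition gcoef :: "real \<Rightarrow> (real ^ 'n \<Rightarrow> complex) \<Rightarrow> int \<times> (int ^ 'n) \<Rightarrow> ennreal" where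
  "gcoef \<alpha> f i = (SUP v\<in>kernels \<alpha> (gcentre i) (gradius i). ennreal (cmod (LINT z|lebesgue. v z *\<^sub>R f z)))"

section \<open>Geometry of the dyadic grid\<close>

lemma dyad_pos [simp]: "0 < dyad k" "0 \<le> dyad k" "dyad k \<noteq> 0"
  by (simp_all add: dyad_def)

lemma dyad_add: "dyad (k + l) = dyad k * dyad l"
  by (simp add: dyad_def power_int_add)

lemma dyad_nat: "dyad (int d) = 2 ^ d"
  by (simp add: dyad_def)

lemma dyad_diff: "k \<le> l \<Longrightarrow> dyad l = dyad k * 2 ^ nat (l - k)"
  using dyad_add[of k "int (nat (l - k))"] by (simp only: dyad_nat) simp

lemma dyad_mono: "k \<le> l \<Longrightarrow> dyad k \<le> dyad l"
  by (simp add: dyad_def power_int_increasing)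

lemma dyad_less_iff [simp]: "dyad k < dyad l \<longleftrightarrow> k < l"
  using dyad_mono[of l k] by (force simp: dyad_def not_less intro: power_int_strict_increasing)

lemma dyad_exists: "0 < t \<Longrightarrow> \<exists>k. dyad k \<le> t \<and> t < 2 * dyad k"
proof -
  assume t: "0 < t"
  have eq: "dyad k = 2 powr of_int k" for k by (simp add: dyad_def powr_real_of_int')
  define k where "k = \<lfloor>log 2 t\<rfloor>"
  have "2 powr of_int k \<le> 2 powr log 2 t" by (rule powr_mono) (auto simp: k_def)
  moreover have "2 powr log 2 t < 2 powr (1 + of_int k)"
    by (rule powr_less_mono) (auto simp: k_def, linarith)
  moreover have "2 powr log 2 t = t" using t by simp
  moreover have "2 powr (1 + of_int k) = 2 * dyad k" by (subst powr_add) (simp add: eq)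
  ultimately have "dyad k \<le> t \<and> t < 2 * dyad k" by (simp add: eq)
  then show ?thesis by blast
qed

lemma gradius_pos [simp]: "0 < gradius i" "0 \<le> gradius i" "gradius i \<noteq> 0"
proof -
  show "0 < gradius i" by (simp add: gradius_def add_nonneg_pos)
  then show "0 \<le> gradius i" "gradius i \<noteq> 0" by auto
qed

text \<open>Each coordinate of \<open>y\<close> differs from that of the corner by at most the side
  length, and the Euclidean norm is at most the sum of the absolute values of the coordinates. The
  dimension enters \<open>gradius\<close> through this factor.\<close>

lemma dist_gcentre_cell:
  fixes y :: "real ^ 'n"
  shows "norm (y - gcentre (k, cell k y)) \<le> real CARD('n) * dyad k"
proof -
  have "\<bar>(y - gcentre (k, cell k y)) $ j\<bar> \<le> dyad k" for j
  proof -
    define u where "u = y $ j / dyad k"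
    have y: "y $ j = dyad k * u" by (simp add: u_def)
    have "\<bar>u - of_int \<lfloor>u\<rfloor>\<bar> \<le> 1" by linarith
    then have "dyad k * \<bar>u - of_int \<lfloor>u\<rfloor>\<bar> \<le> dyad k * 1" by (intro mult_left_mono) auto
    moreover have "(y - gcentre (k, cell k y)) $ j = dyad k * (u - of_int \<lfloor>u\<rfloor>)"
      by (simp add: gcentre_def cell_def y right_diff_distrib)
    ultimately show ?thesis by (simp add: abs_mult)
  qed
  then have "(\<Sum>j\<in>UNIV. \<bar>(y - gcentre (k, cell k y)) $ j\<bar>) \<le> (\<Sum>j\<in>(UNIV::'n set). dyad k)"
    by (intro sum_mono)
  then show ?thesis using norm_le_l1_cart[of "y - gcentre (k, cell k y)"] by simp
qed

lemma emeasure_lebesgue_ball: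
  fixes a :: "real ^ 'n"
  assumes "0 \<le> r"
  shows "emeasure lebesgue (ball a r) = ennreal (unit_ball_vol (real CARD('n)) * r ^ CARD('n))"
  using assms by (subst emeasure_completion) (auto simp: emeasure_ball)

lemma ball_sets_lebesgue [measurable, simp]: "ball a r \<in> sets lebesgue"
  by auto

lemma gball_sets_lebesgue [measurable, simp]: "gball i \<in> sets lebesgue"
  by (simp add: gball_def)

lemma gcentre_separated:
  fixes m m' :: "int ^ 'n"
  assumes "m \<noteq> m'"
  shows "dyad k \<le> norm (gcentre (k, m) - gcentre (k, m'))"
proof -
  obtain j where "m $ j \<noteq> m' $ j" using assms by (auto simp: vec_eq_iff)
  then have "1 \<le> \<bar>m $ j - m' $ j\<bar>" by linarith
  then have "1 \<le> \<bar>real_of_int (m $ j) - of_int (m' $ j)\<bar>" by linarith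
  then have "dyad k * 1 \<le> dyad k * \<bar>real_of_int (m $ j) - of_int (m' $ j)\<bar>"
    by (intro mult_left_mono) auto
  also have "\<dots> = \<bar>(gcentre (k, m) - gcentre (k, m')) $ j\<bar>"
    by (simp add: gcentre_def abs_mult right_diff_distrib[symmetric] del: right_diff_distrib)
  also have "\<dots> \<le> norm (gcentre (k, m) - gcentre (k, m'))" by (rule component_le_norm_cart)
  finally show ?thesis by simp
qed

lemma csum_indicator_le_1:
  assumes "\<And>m m'. m \<in> A \<Longrightarrow> m' \<in> A \<Longrightarrow> m = m'"
  shows "csum (\<lambda>m. indicator A m) \<le> 1"
proof (cases "A = {}")
  case False
  then obtain m where "A = {m}" using assms by blast
  then show ?thesis by (subst nn_integral_count_space'[of "{m}"]) auto
qed simp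

text \<open>A packing argument: balls of radius half the grid spacing around distinct grid points
  are disjoint, and those centred in \<open>ball a R\<close> lie in the ball whose radius is larger
  by half the spacing. The count is bounded by the ratio of the two volumes.\<close>

lemma csum_grid_le:
  fixes a :: "real ^ 'n"
  assumes R: "0 \<le> R"
  shows "csum (\<lambda>m. indicator (ball a R) (gcentre (k, m))) \<le> ennreal ((2 * R / dyad k + 1) ^ CARD('n))"
proof -
  let ?V = "unit_ball_vol (real CARD('n))" and ?s = "dyad k"
  let ?b = "\<lambda>m::int^'n. ball (gcentre (k, m)) (?s / 2)"
  define v where "v = ?V * (?s/2) ^ CARD('n)"
  have v: "0 < v" by (simp add: v_def)
  have "ennreal v * csum (\<lambda>m. indicator (ball a R) (gcentre (k, m)))
      = csum (\<lambda>m. \<integral>\<^sup>+x. indicator (ball a R) (gcentre (k, m)) * indicator (?b m) x \<partial>lebesgue)"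
    by (subst nn_integral_cmult[symmetric], simp)
       (simp add: nn_integral_cmult_indicator v_def emeasure_ball mult.commute)
  also have "\<dots> = (\<integral>\<^sup>+x. csum (\<lambda>m. indicator (ball a R) (gcentre (k, m)) * indicator (?b m) x) \<partial>lebesgue)"
    by (rule nn_integral_csum[symmetric]) measurable
  also have "\<dots> \<le> (\<integral>\<^sup>+x. indicator (ball a (R + ?s/2)) x \<partial>lebesgue)"
  proof (rule nn_integral_mono)
    fix x
    define A where "A = {m. gcentre (k, m) \<in> ball a R \<and> x \<in> ?b m}"
    have eq: "indicator (ball a R) (gcentre (k, m)) * indicator (?b m) x = (indicator A m :: ennreal)" for m
      by (auto simp: A_def split: split_indicator)
    show "csum (\<lambda>m. indicator (ball a R) (gcentre (k, m)) * indicator (?b m) x) \<le> indicator (ball a (R + ?s/2)) x"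
    proof (cases "A = {}")
      case False
      then obtain m where m: "m \<in> A" by blast
      then have "dist a x \<le> dist a (gcentre (k, m)) + dist (gcentre (k, m)) x" by (intro dist_triangle)
      also have "\<dots> < R + ?s / 2" using m by (simp add: A_def)
      finally have "x \<in> ball a (R + ?s/2)" by simp
      moreover have "csum (\<lambda>m. indicator A m) \<le> 1"
      proof (rule csum_indicator_le_1, rule ccontr)
        fix m m' assume "m \<in> A" "m' \<in> A" "m \<noteq> m'"
        have "dist (gcentre (k, m)) (gcentre (k, m')) \<le> dist (gcentre (k, m)) x + dist (gcentre (k, m')) x"
          by (rule dist_triangle2)
        also have "\<dots> < ?s" using \<open>m \<in> A\<close> \<open>m' \<in> A\<close> by (simp add: A_def)
        finally show False using gcentre_separated[OF \<open>m \<noteq> m'\<close>, of k] by (simp add: dist_norm)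
      qed
      ultimately show ?thesis unfolding eq by simp
    qed (simp add: eq)
  qed
  also have "\<dots> = ennreal (?V * (R + ?s/2) ^ CARD('n))"
    using R by (simp add: emeasure_ball)
  also have "?V * (R + ?s/2) ^ CARD('n) = v * (2 * R / ?s + 1) ^ CARD('n)"
  proof -
    have "R + ?s/2 = (?s/2) * (2 * R / ?s + 1)" by (simp add: field_simps)
    then show ?thesis unfolding v_def by (simp only: power_mult_distrib mult.assoc)
  qed
  finally have *: "ennreal v * csum (\<lambda>m. indicator (ball a R) (gcentre (k, m)))
      \<le> ennreal v * ennreal ((2 * R / ?s + 1) ^ CARD('n))"
    using v R by (simp add: ennreal_mult)
  show ?thesis
    using * v by (subst (asm) ennreal_mult_le_mult_iff) auto
qed

section \<open>Regularity, size and cancellation of the kernels\<close>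

lemma kernel_continuous:
  assumes v: "v \<in> kernels \<alpha> y t" and "0 < \<alpha>" "0 < t"
  shows "continuous_on UNIV v"
proof -
  have "(v \<longlongrightarrow> v z) (at z)" for z :: "real^'a"
  proof -
    have "((\<lambda>z'. norm (z' - z)) \<longlongrightarrow> 0) (at z)"
      by (rule tendsto_eq_intros refl | simp)+
    then have "((\<lambda>z'. norm (z' - z) / t) \<longlongrightarrow> 0) (at z)"
      by (rule tendsto_divide_zero)
    then have "((\<lambda>z'. 1 / t ^ CARD('a) * (norm (z' - z) / t) powr \<alpha>) \<longlongrightarrow> 0) (at z)"
      using assms by (intro tendsto_mult_right_zero tendsto_zero_powrI[of _ _ _ \<alpha>]) auto
    then have "((\<lambda>z'. v z' - v z) \<longlongrightarrow> 0) (at z)"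
      by (rule Lim_null_comparison[rotated]) (use v in \<open>auto simp: kernels_def\<close>)
    then show ?thesis by (simp add: LIM_zero_iff)
  qed
  then show ?thesis by (simp add: continuous_on_def)
qed

lemma kernel_borel:
  assumes "v \<in> kernels \<alpha> y t" and "0 < \<alpha>" "0 < t"
  shows "v \<in> borel_measurable lebesgue" "v \<in> borel_measurable borel"
  using kernel_continuous[OF assms]
  by (auto intro: borel_measurable_continuous_onI continuous_imp_measurable_on_sets_lebesgue
      measurable_completion simp: borel_measurable_continuous_onI)

text \<open>A kernel vanishes on the sphere of radius \<open>t\<close> around \<open>y\<close>, so
  its value at a point of the ball is an oscillation over a distance of at most
  \<open>2 * t\<close>; and \<open>2 powr \<alpha>\<close> is at most 2.\<close>

lemma kernel_bound:
  fixes y :: "real ^ 'n"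
  assumes v: "v \<in> kernels \<alpha> y t" and a: "0 < \<alpha>" "\<alpha> \<le> 1" and t: "0 < t"
  shows "\<bar>v z\<bar> \<le> 2 / t ^ CARD('n)"
proof (cases "z \<in> ball y t")
  case True
  fix j :: 'n
  define z' where "z' = y + t *\<^sub>R axis j 1"
  have n: "norm (z' - y) = t" using t by (simp add: z'_def norm_axis_1)
  then have "v z' = 0" using v by (auto simp: kernels_def dist_norm norm_minus_commute)
  have "norm (z - z') \<le> 2 * t"
    using norm_triangle_ineq4[of "z - y" "z' - y"] True n by (simp add: dist_norm norm_minus_commute)
  then have "(norm (z - z') / t) powr \<alpha> \<le> 2 powr \<alpha>"
    using a t by (intro powr_mono2) (auto simp: field_simps)
  also have "\<dots> \<le> 2" using a powr_mono[of \<alpha> 1 "2::real"] by simp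
  finally have "1 / t ^ CARD('n) * (norm (z - z') / t) powr \<alpha> \<le> 1 / t ^ CARD('n) * 2"
    using t by (intro mult_left_mono) auto
  moreover have "\<bar>v z - v z'\<bar> \<le> 1 / t ^ CARD('n) * (norm (z - z') / t) powr \<alpha>"
    using v by (auto simp: kernels_def)
  ultimately show ?thesis using \<open>v z' = 0\<close> by simp
qed (use v t in \<open>auto simp: kernels_def\<close>)

lemma kernels_nonempty: "0 < t \<Longrightarrow> (\<lambda>_. 0) \<in> kernels \<alpha> y t"
  by (auto simp: kernels_def)

lemma integrable_bounded_scaleR:
  fixes b :: "'a \<Rightarrow> 'b::{banach,second_countable_topology}" and v :: "'a \<Rightarrow> real"
  assumes b: "integrable M b" and [measurable]: "v \<in> borel_measurable M" and "\<And>z. \<bar>v z\<bar> \<le> K"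
  shows "integrable M (\<lambda>z. v z *\<^sub>R b z)"
proof (rule Bochner_Integration.integrable_bound[where f="\<lambda>z. K *\<^sub>R b z"])
  show "(\<lambda>z. v z *\<^sub>R b z) \<in> borel_measurable M" using b by simp
  show "AE z in M. norm (v z *\<^sub>R b z) \<le> norm (K *\<^sub>R b z)"
  proof (rule AE_I2)
    fix z show "norm (v z *\<^sub>R b z) \<le> norm (K *\<^sub>R b z)"
      using assms(3)[of z] by (simp add: mult_right_mono)
  qed
qed (use b in simp)

text \<open>Since \<open>b\<close> has mean zero, the constant \<open>v z0\<close> may be subtracted
  from \<open>v\<close>, and on the support of \<open>b\<close> the Hoelder condition bounds the
  difference. It is applied with \<open>b\<close> a finer kernel for almost orthogonality, and with
  \<open>b\<close> the bad part on one cube.\<close>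

lemma kernel_osc:
  fixes b :: "real ^ 'n \<Rightarrow> 'b::{banach,second_countable_topology}"
  assumes v: "v \<in> kernels \<alpha> y t" and a: "0 < \<alpha>" "\<alpha> \<le> 1" and t: "0 < t"
    and b: "integrable lebesgue b" and b0: "(LINT z|lebesgue. b z) = 0"
    and supp: "\<And>z. b z \<noteq> 0 \<Longrightarrow> norm (z - z0) \<le> l"
  shows "ennreal (norm (LINT z|lebesgue. v z *\<^sub>R b z))
    \<le> ennreal (1 / t ^ CARD('n) * (l / t) powr \<alpha>) * (\<integral>\<^sup>+z. ennreal (norm (b z)) \<partial>lebesgue)"
proof -
  let ?K = "1 / t ^ CARD('n) * (l / t) powr \<alpha>"
  have i: "integrable lebesgue (\<lambda>z. v z *\<^sub>R b z)"
    by (rule integrable_bounded_scaleR[OF b kernel_borel(1)[OF v a(1) t] kernel_bound[OF v a t]])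
  have "(LINT z|lebesgue. v z *\<^sub>R b z) = (LINT z|lebesgue. v z *\<^sub>R b z - v z0 *\<^sub>R b z)"
    using i b b0 by simp
  also have "\<dots> = (LINT z|lebesgue. (v z - v z0) *\<^sub>R b z)"
    by (simp add: scaleR_diff_left)
  finally have "ennreal (norm (LINT z|lebesgue. v z *\<^sub>R b z))
      \<le> (\<integral>\<^sup>+z. ennreal (norm ((v z - v z0) *\<^sub>R b z)) \<partial>lebesgue)"
    by (metis ennreal_norm_integral_le)
  also have "\<dots> \<le> (\<integral>\<^sup>+z. ennreal ?K * ennreal (norm (b z)) \<partial>lebesgue)"
  proof (rule nn_integral_mono)
    fix z
    show "ennreal (norm ((v z - v z0) *\<^sub>R b z)) \<le> ennreal ?K * ennreal (norm (b z))"
    proof (cases "b z = 0")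
      case False
      have "\<bar>v z - v z0\<bar> \<le> 1 / t ^ CARD('n) * (norm (z - z0) / t) powr \<alpha>"
        using v by (auto simp: kernels_def)
      also have "\<dots> \<le> ?K"
        using supp[OF False] a t by (intro mult_left_mono powr_mono2 divide_right_mono) auto
      finally have "\<bar>v z - v z0\<bar> * norm (b z) \<le> ?K * norm (b z)" by (rule mult_right_mono) simp
      then show ?thesis using t by (simp add: ennreal_mult[symmetric] ennreal_leI)
    qed simp
  qed
  also have "\<dots> = ennreal ?K * (\<integral>\<^sup>+z. ennreal (norm (b z)) \<partial>lebesgue)"
    by (rule nn_integral_cmult) (use b in simp)
  finally show ?thesis .
qed

lemma locally_integrable_set_integrable_ball:
  assumes "locally_integrable f"
  shows "set_integrable lebesgue (ball a r) f"
proof -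
  have "set_integrable lebesgue (cball a r) f"
    using assms by (auto simp: locally_integrable_def)
  then show ?thesis by (rule set_integrable_subset) auto
qed

lemma locally_integrable_borel:
  assumes "locally_integrable f"
  shows "f \<in> borel_measurable lebesgue"
proof (rule measurable_piecewise_restrict[where C="range (\<lambda>n::nat. ball 0 (real n))"])
  show "space lebesgue \<subseteq> \<Union> (range (\<lambda>n::nat. ball (0::'a) (real n)))"
    by (auto simp: reals_Archimedean2)
  fix A assume "A \<in> range (\<lambda>n::nat. ball (0::'a) (real n))"
  then obtain n :: nat where A: "A = ball 0 (real n)" by auto
  have "set_integrable lebesgue A f" unfolding A by (rule locally_integrable_set_integrable_ball[OF assms])
  then have "(\<lambda>x. indicator A x *\<^sub>R f x) \<in> borel_measurable lebesgue"
    unfolding set_integrable_def by simp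
  then show "f \<in> borel_measurable (restrict_space lebesgue A)"
    by (subst borel_measurable_restrict_space_iff) (auto simp: A)
  show "A \<inter> space lebesgue \<in> sets lebesgue" by (simp add: A)
qed auto

lemma kernel_integrable:
  assumes v: "v \<in> kernels \<alpha> y t" and a: "0 < \<alpha>" "\<alpha> \<le> 1" and t: "0 < t" and f: "locally_integrable f"
  shows "integrable lebesgue (\<lambda>z. v z *\<^sub>R f z)"
proof -
  have "integrable lebesgue (\<lambda>z. v z *\<^sub>R (indicator (ball y t) z *\<^sub>R f z))"
    using locally_integrable_set_integrable_ball[OF f, of y t] unfolding set_integrable_def
    by (rule integrable_bounded_scaleR[OF _ kernel_borel(1)[OF v a(1) t] kernel_bound[OF v a t]])
  also have "(\<lambda>z. v z *\<^sub>R (indicator (ball y t) z *\<^sub>R f z)) = (\<lambda>z. v z *\<^sub>R f z)"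
    using v by (fastforce simp: kernels_def split: split_indicator)
  finally show ?thesis .
qed

lemma kernel_integral_le:
  fixes f :: "real ^ 'n \<Rightarrow> complex"
  assumes v: "v \<in> kernels \<alpha> y t" and a: "0 < \<alpha>" "\<alpha> \<le> 1" and t: "0 < t"
    and [measurable]: "f \<in> borel_measurable lebesgue"
  shows "ennreal (cmod (LINT z|lebesgue. v z *\<^sub>R f z))
    \<le> ennreal (2 / t ^ CARD('n)) * (\<integral>\<^sup>+z\<in>ball y t. ennreal (cmod (f z)) \<partial>lebesgue)"
proof -
  have "ennreal (cmod (LINT z|lebesgue. v z *\<^sub>R f z)) \<le> (\<integral>\<^sup>+z. ennreal (cmod (v z *\<^sub>R f z)) \<partial>lebesgue)"
    by (rule ennreal_norm_integral_le)
  also have "\<dots> \<le> (\<integral>\<^sup>+z. ennreal (2 / t ^ CARD('n)) * (ennreal (cmod (f z)) * indicator (ball y t) z) \<partial>lebesgue)"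
  proof (rule nn_integral_mono)
    fix z
    show "ennreal (cmod (v z *\<^sub>R f z)) \<le> ennreal (2 / t ^ CARD('n)) * (ennreal (cmod (f z)) * indicator (ball y t) z)"
    proof (cases "z \<in> ball y t")
      case True
      have "\<bar>v z\<bar> * cmod (f z) \<le> 2 / t ^ CARD('n) * cmod (f z)"
        by (intro mult_right_mono kernel_bound[OF v a t]) simp
      then show ?thesis using True t by (simp add: ennreal_mult[symmetric] ennreal_leI)
    next
      case False
      then have "v z = 0" using v by (auto simp: kernels_def)
      then show ?thesis by simp
    qed
  qed
  also have "\<dots> = ennreal (2 / t ^ CARD('n)) * (\<integral>\<^sup>+z\<in>ball y t. ennreal (cmod (f z)) \<partial>lebesgue)"
    by (rule nn_integral_cmult) simp
  finally show ?thesis .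
qed

section \<open>Domination of the square function by the coefficients\<close>

lemma integral_reflect_scale:
  fixes \<phi> :: "real ^ 'n \<Rightarrow> real"
  assumes [measurable]: "\<phi> \<in> borel_measurable borel" and t: "0 < t"
  shows "(LINT z|lebesgue. \<phi> ((1/t) *\<^sub>R (y - z))) = t ^ CARD('n) * (LINT x|lebesgue. \<phi> x)"
proof -
  have "(LINT x|lebesgue. \<phi> x) = (LINT x|lborel. \<phi> x)" by (simp add: integral_completion)
  also have "\<dots> = (LINT x|density (distr lborel borel (\<lambda>x. (1/t) *\<^sub>R y + (-1/t) *\<^sub>R x)) (\<lambda>_. ennreal (\<bar>-1/t\<bar> ^ CARD('n))). \<phi> x)"
    using lborel_affine[of "-1/t" "(1/t) *\<^sub>R y"] t by (simp add: ennreal_power)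
  also have "\<dots> = \<bar>-1/t\<bar> ^ CARD('n) * (LINT x|lborel. \<phi> ((1/t) *\<^sub>R y + (-1/t) *\<^sub>R x))"
    by (subst integral_density) (auto simp: integral_distr)
  also have "(\<lambda>x. \<phi> ((1/t) *\<^sub>R y + (-1/t) *\<^sub>R x)) = (\<lambda>x. \<phi> ((1/t) *\<^sub>R (y - x)))"
    by (simp add: scaleR_diff_right)
  finally show ?thesis using t by (simp add: integral_completion field_simps)
qed

lemma C_class_borel:
  assumes "\<phi> \<in> C_class \<alpha>" "0 < \<alpha>"
  shows "\<phi> \<in> borel_measurable borel"
proof -
  have "(\<phi> \<longlongrightarrow> \<phi> z) (at z)" for z
  proof -
    have "((\<lambda>z'. norm (z' - z)) \<longlongrightarrow> 0) (at z)"
      by (rule tendsto_eq_intros refl | simp)+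
    then have "((\<lambda>z'. norm (z' - z) powr \<alpha>) \<longlongrightarrow> 0) (at z)"
      using assms by (intro tendsto_zero_powrI[of _ _ _ \<alpha>]) auto
    then have "((\<lambda>z'. \<phi> z' - \<phi> z) \<longlongrightarrow> 0) (at z)"
      by (rule Lim_null_comparison[rotated]) (use assms in \<open>auto simp: C_class_def\<close>)
    then show ?thesis by (simp add: LIM_zero_iff)
  qed
  then have "continuous_on UNIV \<phi>" by (simp add: continuous_on_def)
  then show ?thesis by (rule borel_measurable_continuous_onI)
qed

lemma A_fun_le_gcoef:
  fixes f :: "real ^ 'n \<Rightarrow> complex" and y :: "real ^ 'n"
  assumes a: "0 < \<alpha>" "\<alpha> \<le> 1" and t: "dyad k \<le> t" "t < 2 * dyad k"
  shows "A_fun \<alpha> f y t \<le> ennreal ((real CARD('n) + 2) ^ (CARD('n) + 1)) * gcoef \<alpha> f (k, cell k y)"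
  unfolding A_fun_def
proof (rule SUP_least)
  fix \<phi> :: "real ^ 'n \<Rightarrow> real" assume \<phi>: "\<phi> \<in> C_class \<alpha>"
  let ?N = "real CARD('n) + 2"
  \<comment> \<open>\<open>?N ^ n\<close> pays for replacing \<open>t ^ n\<close> by
    \<open>gradius i ^ n\<close>, as \<open>gradius i\<close> is at most \<open>?N * t\<close>; one
    more factor \<open>?N\<close> pays for the same replacement in the Hoelder term, because
    \<open>?N powr \<alpha>\<close> is at most \<open>?N\<close>.\<close>
  define c where "c = ?N ^ (CARD('n) + 1)"
  define i where "i = (k, cell k y)"
  define v where "v z = dilate \<phi> t (y - z) / c" for z
  have t0: "0 < t" using t(1) dyad_pos(1)[of k] by linarith
  have c0: "0 < c" by (simp add: c_def add_nonneg_pos)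
  have rt: "gradius i \<le> ?N * t" using t by (simp add: gradius_def i_def mult_left_mono)
  have "v \<in> kernels \<alpha> (gcentre i) (gradius i)"
    unfolding kernels_def
  proof (intro CollectI conjI allI impI)
    fix z assume z: "z \<notin> ball (gcentre i) (gradius i)"
    have "norm (z - gcentre i) \<le> norm (y - z) + norm (y - gcentre i)"
      using norm_triangle_ineq4[of "y - gcentre i" "y - z"] by simp
    moreover have "norm (y - gcentre i) \<le> real CARD('n) * dyad k"
      unfolding i_def by (rule dist_gcentre_cell)
    moreover have "gradius i \<le> norm (z - gcentre i)" using z by (simp add: dist_norm norm_minus_commute)
    ultimately have "2 * dyad k \<le> norm (y - z)" by (simp add: gradius_def i_def algebra_simps)
    \<comment> \<open>The strict bound \<open>t < 2 * dyad k\<close> puts the argument of \<phi>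
      strictly outside the closed unit ball, where \<phi> vanishes.\<close>
    then have "t < norm (y - z)" using t by linarith
    then have "1 < norm ((1/t) *\<^sub>R (y - z))" using t0 by (simp only: norm_scaleR) simp
    then have "\<phi> ((1/t) *\<^sub>R (y - z)) = 0" using \<phi> by (force simp: C_class_def)
    then show "v z = 0" by (simp add: v_def dilate_def)
  next
    show "(LINT z|lebesgue. v z) = 0"
      using integral_reflect_scale[OF C_class_borel[OF \<phi> a(1)] t0, of y] \<phi>
      by (simp add: v_def dilate_def C_class_def)
  next
    fix z z'
    have "\<bar>v z - v z'\<bar> = 1 / c * (1 / t ^ CARD('n)) * \<bar>\<phi> ((1/t) *\<^sub>R (y - z)) - \<phi> ((1/t) *\<^sub>R (y - z'))\<bar>"
      using c0 t0 by (simp add: v_def dilate_def diff_divide_distrib[symmetric] abs_mult)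
    also have "\<dots> \<le> 1 / c * (1 / t ^ CARD('n)) * norm ((1/t) *\<^sub>R (y - z) - (1/t) *\<^sub>R (y - z')) powr \<alpha>"
      using \<phi> c0 t0 by (intro mult_left_mono) (auto simp: C_class_def)
    also have "norm ((1/t) *\<^sub>R (y - z) - (1/t) *\<^sub>R (y - z')) = norm (z - z') / t"
      using t0 by (simp add: scaleR_diff_right[symmetric] norm_minus_commute)
    also have "1 / c * (1 / t ^ CARD('n)) * (norm (z - z') / t) powr \<alpha>
        \<le> 1 / c * (?N ^ CARD('n) / gradius i ^ CARD('n)) * (?N * (norm (z - z') / gradius i) powr \<alpha>)"
    proof (intro mult_mono mult_left_mono)
      have g: "gradius i ^ CARD('n) \<le> ?N ^ CARD('n) * t ^ CARD('n)"
        using power_mono[OF rt, of "CARD('n)"] by (simp add: power_mult_distrib)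
      have "1 / t ^ CARD('n) = ?N ^ CARD('n) / (?N ^ CARD('n) * t ^ CARD('n))"
        using t0 by simp
      also have "\<dots> \<le> ?N ^ CARD('n) / gradius i ^ CARD('n)"
        by (intro divide_left_mono g mult_pos_pos zero_less_power) (use t0 in \<open>auto simp: add_nonneg_pos\<close>)
      finally show "1 / t ^ CARD('n) \<le> ?N ^ CARD('n) / gradius i ^ CARD('n)" .
      have "norm (z - z') / t \<le> ?N * (norm (z - z') / gradius i)"
      proof -
        have "norm (z - z') * gradius i \<le> norm (z - z') * (?N * t)"
          by (intro mult_left_mono rt) simp
        then show ?thesis using t0 by (simp add: field_simps)
      qed
      then have "(norm (z - z') / t) powr \<alpha> \<le> (?N * (norm (z - z') / gradius i)) powr \<alpha>"
        using a t0 by (intro powr_mono2) auto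
      also have "\<dots> = ?N powr \<alpha> * (norm (z - z') / gradius i) powr \<alpha>"
        by (rule powr_mult) 
      also have "\<dots> \<le> ?N powr 1 * (norm (z - z') / gradius i) powr \<alpha>"
        using a by (intro mult_right_mono powr_mono) auto
      finally show "(norm (z - z') / t) powr \<alpha> \<le> ?N * (norm (z - z') / gradius i) powr \<alpha>"
        by (simp add: powr_one)
    qed (use c0 t0 in auto)
    also have "\<dots> = 1 / gradius i ^ CARD('n) * (norm (z - z') / gradius i) powr \<alpha>"
      using c0 by (simp add: c_def)
    finally show "\<bar>v z - v z'\<bar> \<le> 1 / gradius i ^ CARD('n) * (norm (z - z') / gradius i) powr \<alpha>" .
  qed
  then have le: "ennreal (cmod (LINT z|lebesgue. v z *\<^sub>R f z)) \<le> gcoef \<alpha> f i"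
    unfolding gcoef_def by (rule SUP_upper)
  have "(LINT z|lebesgue. dilate \<phi> t (y - z) *\<^sub>R f z) = (LINT z|lebesgue. c *\<^sub>R (v z *\<^sub>R f z))"
    using c0 by (simp add: v_def)
  also have "\<dots> = c *\<^sub>R (LINT z|lebesgue. v z *\<^sub>R f z)" by (rule integral_scaleR_right)
  finally have "ennreal (cmod (LINT z|lebesgue. dilate \<phi> t (y - z) *\<^sub>R f z))
      = ennreal c * ennreal (cmod (LINT z|lebesgue. v z *\<^sub>R f z))"
    using c0 by (simp add: ennreal_mult)
  also have "\<dots> \<le> ennreal c * gcoef \<alpha> f i" by (rule mult_left_mono[OF le]) simp
  finally show "ennreal (cmod (LINT z|lebesgue. dilate \<phi> t (y - z) *\<^sub>R f z))
      \<le> ennreal (?N ^ (CARD('n) + 1)) * gcoef \<alpha> f (k, cell k y)"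
    by (simp add: c_def i_def)
qed

text \<open>Each point of the cone over \<open>x\<close> is charged to the box in which it lies, and
  the ball of that box contains \<open>x\<close>. The integrand is first compared pointwise with a
  measurable majorant, and only this majorant is summed and integrated term by term.\<close>

lemma S_fun_power2_le:
  "\<exists>C>0. \<forall>(f :: real ^ 'n \<Rightarrow> complex) \<alpha> x. 0 < \<alpha> \<longrightarrow> \<alpha> \<le> 1 \<longrightarrow>
    (S_fun \<alpha> f x)\<^sup>2 \<le> ennreal C * csum (\<lambda>i. (gcoef \<alpha> f i)\<^sup>2 * indicator (gball i) x)"
proof -
  let ?n = "CARD('n)" let ?N = "real CARD('n) + 2"
  define c where "c = ?N ^ (?n + 1)"
  define c2 where "c2 = unit_ball_vol (real (?n + 1)) * ?N ^ (?n + 1)"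
  have c0: "0 < c" "0 < c2" by (simp_all add: c_def c2_def add_nonneg_pos)
  have "(S_fun \<alpha> f x)\<^sup>2 \<le> ennreal (c\<^sup>2 * c2) * csum (\<lambda>i. (gcoef \<alpha> f i)\<^sup>2 * indicator (gball i) x)"
    if a: "0 < \<alpha>" "\<alpha> \<le> 1" for f :: "real ^ 'n \<Rightarrow> complex" and \<alpha> x
  proof -
    \<comment> \<open>An enclosure of the Whitney box: a ball in the product space has an explicit
      volume, and divided by \<open>dyad (fst i) ^ (n + 1)\<close> this is the constant
      \<open>c2\<close>, the same for all boxes.\<close>
    define R :: "int \<times> (int ^ 'n) \<Rightarrow> ((real ^ 'n) \<times> real) set" where
      "R i = ball (gcentre i, dyad (fst i)) (?N * dyad (fst i))" for i
    define T where "T i p = ennreal (c\<^sup>2) * ((gcoef \<alpha> f i)\<^sup>2 * indicator (gball i) x) *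
        ennreal (1 / dyad (fst i) ^ (?n + 1)) * indicator (R i) p" for i p
    have "(S_fun \<alpha> f x)\<^sup>2 = (\<integral>\<^sup>+p\<in>Gamma_cone x. (A_fun \<alpha> f (fst p) (snd p))\<^sup>2 * ennreal (1 / snd p ^ (?n + 1)) \<partial>lebesgue)"
      by (simp only: S_fun_def ennreal_powr_half_power2)
    also have "\<dots> \<le> (\<integral>\<^sup>+p. csum (\<lambda>i. T i p) \<partial>lebesgue)"
    proof (rule nn_integral_mono)
      fix p :: "(real ^ 'n) \<times> real"
      obtain y t where p: "p = (y, t)" by (cases p)
      show "(A_fun \<alpha> f (fst p) (snd p))\<^sup>2 * ennreal (1 / snd p ^ (?n + 1)) * indicator (Gamma_cone x) p
          \<le> csum (\<lambda>i. T i p)"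
      proof (cases "p \<in> Gamma_cone x")
        case True
        then have t: "0 < t" "norm (x - y) < t" by (auto simp: p Gamma_cone_def)
        obtain k where k: "dyad k \<le> t" "t < 2 * dyad k" using dyad_exists[OF t(1)] by blast
        define i where "i = (k, cell k y)"
        have dy: "norm (y - gcentre i) \<le> real ?n * dyad k" unfolding i_def by (rule dist_gcentre_cell)
        have "norm (x - gcentre i) \<le> norm (x - y) + norm (y - gcentre i)"
          using norm_triangle_ineq[of "x - y" "y - gcentre i"] by simp
        then have x: "x \<in> gball i"
          using t k dy by (simp add: gball_def dist_norm norm_minus_commute gradius_def i_def algebra_simps)
        have "dist (gcentre i, dyad k) p \<le> dist (gcentre i) y + dist (dyad k) t"
          unfolding p using norm_Pair_le[of "gcentre i - y" "dyad k - t"] by (simp add: dist_norm)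
        also have "\<dots> < ?N * dyad k"
          using k dy by (simp add: dist_norm norm_minus_commute algebra_simps)
        finally have pR: "p \<in> R i" by (simp add: R_def i_def)
        have "(A_fun \<alpha> f y t)\<^sup>2 \<le> (ennreal c * gcoef \<alpha> f i)\<^sup>2"
          unfolding c_def i_def by (intro power_mono A_fun_le_gcoef a k) simp
        also have "\<dots> = ennreal (c\<^sup>2) * (gcoef \<alpha> f i)\<^sup>2"
          using c0 by (simp add: power_mult_distrib ennreal_power)
        finally have 1: "(A_fun \<alpha> f y t)\<^sup>2 \<le> ennreal (c\<^sup>2) * (gcoef \<alpha> f i)\<^sup>2" .
        have "dyad k ^ (?n + 1) \<le> t ^ (?n + 1)" using k by (intro power_mono) auto
        then have 2: "ennreal (1 / t ^ (?n + 1)) \<le> ennreal (1 / dyad (fst i) ^ (?n + 1))"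
          by (intro ennreal_leI divide_left_mono) (auto simp: i_def t)
        have "(A_fun \<alpha> f (fst p) (snd p))\<^sup>2 * ennreal (1 / snd p ^ (?n + 1)) * indicator (Gamma_cone x) p
            \<le> T i p"
          unfolding T_def using True x pR mult_mono[OF 1 2] by (simp add: p)
        also have "\<dots> \<le> csum (\<lambda>i. T i p)" by (rule le_csum)
        finally show ?thesis .
      qed simp
    qed
    also have "\<dots> = csum (\<lambda>i. \<integral>\<^sup>+p. T i p \<partial>lebesgue)"
      by (rule nn_integral_csum) (auto simp: T_def R_def)
    also have "\<dots> = csum (\<lambda>i. ennreal (c\<^sup>2 * c2) * ((gcoef \<alpha> f i)\<^sup>2 * indicator (gball i) x))"
    proof (rule nn_integral_cong)
      fix i :: "int \<times> (int ^ 'n)"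
      have "emeasure lebesgue (R i) = ennreal (unit_ball_vol (real (?n + 1)) * (?N * dyad (fst i)) ^ (?n + 1))"
        unfolding R_def by (subst emeasure_completion) (auto simp: emeasure_ball add.commute)
      then have "(\<integral>\<^sup>+p. T i p \<partial>lebesgue) = ennreal (c\<^sup>2) * ((gcoef \<alpha> f i)\<^sup>2 * indicator (gball i) x) *
          ennreal (1 / dyad (fst i) ^ (?n + 1)) * ennreal (c2 * dyad (fst i) ^ (?n + 1))"
        unfolding T_def by (subst nn_integral_cmult_indicator) (auto simp: R_def c2_def power_mult_distrib mult_ac)
      also have "\<dots> = ennreal (c\<^sup>2) * (ennreal (1 / dyad (fst i) ^ (?n + 1)) * ennreal (c2 * dyad (fst i) ^ (?n + 1)))
          * ((gcoef \<alpha> f i)\<^sup>2 * indicator (gball i) x)"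
        by (simp only: ac_simps)
      also have "ennreal (1 / dyad (fst i) ^ (?n + 1)) * ennreal (c2 * dyad (fst i) ^ (?n + 1)) = ennreal c2"
        using c0 by (subst ennreal_mult[symmetric]) auto
      finally show "(\<integral>\<^sup>+p. T i p \<partial>lebesgue) = ennreal (c\<^sup>2 * c2) * ((gcoef \<alpha> f i)\<^sup>2 * indicator (gball i) x)"
        using c0 by (simp add: ennreal_mult)
    qed
    also have "\<dots> = ennreal (c\<^sup>2 * c2) * csum (\<lambda>i. (gcoef \<alpha> f i)\<^sup>2 * indicator (gball i) x)"
      by (rule nn_integral_cmult) simp
    finally show ?thesis .
  qed
  then show ?thesis using c0 by (intro exI[of _ "c\<^sup>2 * c2"]) auto
qed

section \<open>Almost orthogonality\<close>

lemma locally_integrable_const: "locally_integrable (\<lambda>_::'a::euclidean_space. c :: real)"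
  unfolding locally_integrable_def by (auto intro: absolutely_integrable_on_const lmeasurable_compact)

lemma kernel_integrable_self:
  assumes "v \<in> kernels \<alpha> y t" "0 < \<alpha>" "\<alpha> \<le> 1" "0 < t"
  shows "integrable lebesgue v"
  using kernel_integrable[OF assms locally_integrable_const[of 1]] by simp

lemma kernel_L1_le:
  fixes y :: "real ^ 'n"
  assumes v: "v \<in> kernels \<alpha> y t" and a: "0 < \<alpha>" "\<alpha> \<le> 1" and t: "0 < t"
  shows "(\<integral>\<^sup>+z. ennreal \<bar>v z\<bar> \<partial>lebesgue) \<le> ennreal (2 * unit_ball_vol (real CARD('n)))"
proof -
  have "(\<integral>\<^sup>+z. ennreal \<bar>v z\<bar> \<partial>lebesgue) \<le> (\<integral>\<^sup>+z. ennreal (2 / t ^ CARD('n)) * indicator (ball y t) z \<partial>lebesgue)"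
  proof (rule nn_integral_mono)
    fix z
    show "ennreal \<bar>v z\<bar> \<le> ennreal (2 / t ^ CARD('n)) * indicator (ball y t) z"
    proof (cases "z \<in> ball y t")
      case True then show ?thesis using kernel_bound[OF v a t, of z] by (simp add: ennreal_leI)
    next
      case False then have "v z = 0" using v by (auto simp: kernels_def)
      then show ?thesis by simp
    qed
  qed
  also have "\<dots> = ennreal (2 / t ^ CARD('n)) * ennreal (unit_ball_vol (real CARD('n)) * t ^ CARD('n))"
    using t by (simp add: nn_integral_cmult_indicator emeasure_ball)
  also have "\<dots> = ennreal (2 * unit_ball_vol (real CARD('n)))"
    using t by (subst ennreal_mult[symmetric]) auto
  finally show ?thesis .
qed

text \<open>The finer kernel \<open>v\<close> has mean zero and the coarser kernel \<open>u\<close>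
  is Hoelder continuous at scale \<open>t'\<close>, so the inner product gains the factor
  \<open>(t / t') powr \<alpha>\<close>. The indicator records that kernels with disjoint supporting
  balls have inner product 0.\<close>

lemma kernel_inner_le:
  fixes y y' :: "real ^ 'n"
  assumes v: "v \<in> kernels \<alpha> y t" and u: "u \<in> kernels \<alpha> y' t'" and a: "0 < \<alpha>" "\<alpha> \<le> 1" and t: "0 < t" "t \<le> t'"
  shows "\<bar>LINT z|lebesgue. v z * u z\<bar> \<le> 2 * unit_ball_vol (real CARD('n)) / t' ^ CARD('n) * (t / t') powr \<alpha>
      * indicator (ball y (t + t')) y'"
proof (cases "y' \<in> ball y (t + t')")
  case True
  have t': "0 < t'" using t by linarith
  have z: "(LINT z|lebesgue. v z) = 0" using v by (simp add: kernels_def)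
  have supp: "norm (z - y) \<le> t" if "v z \<noteq> 0" for z
  proof -
    have "z \<in> ball y t" using that v by (auto simp: kernels_def)
    then show ?thesis by (simp add: dist_norm norm_minus_commute)
  qed
  have "ennreal \<bar>LINT z|lebesgue. v z * u z\<bar> = ennreal (norm (LINT z|lebesgue. u z *\<^sub>R v z))"
    by (simp add: mult.commute)
  also have "\<dots> \<le> ennreal (1 / t' ^ CARD('n) * (t / t') powr \<alpha>) * (\<integral>\<^sup>+z. ennreal (norm (v z)) \<partial>lebesgue)"
    by (rule kernel_osc[OF u a t' kernel_integrable_self[OF v a t(1)] z supp])
  also have "\<dots> \<le> ennreal (1 / t' ^ CARD('n) * (t / t') powr \<alpha>) * ennreal (2 * unit_ball_vol (real CARD('n)))"
    using kernel_L1_le[OF v a t(1)] by (intro mult_left_mono) auto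
  also have "\<dots> = ennreal (1 / t' ^ CARD('n) * (t / t') powr \<alpha> * (2 * unit_ball_vol (real CARD('n))))"
    using t' by (subst ennreal_mult) auto
  finally have "\<bar>LINT z|lebesgue. v z * u z\<bar> \<le> 1 / t' ^ CARD('n) * (t / t') powr \<alpha> * (2 * unit_ball_vol (real CARD('n)))"
    using t' by (subst (asm) ennreal_le_iff) auto
  then show ?thesis using True by (simp add: ac_simps)
next
  case False
  have "(\<lambda>z. v z * u z) = (\<lambda>_. 0)"
  proof (rule ext, rule ccontr)
    fix z
    assume "v z * u z \<noteq> 0"
    then have "dist y z < t" "dist y' z < t'" using v u by (auto simp: kernels_def)
    then have "dist y y' < t + t'" using dist_triangle2[of y y' z] by linarith
    with False show False by simp
  qed
  then show ?thesis using False by simp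
qed

lemma half_powr_power: "((1/2) ^ d) powr \<alpha> = ((1/2::real) powr \<alpha>) ^ d"
proof (induction d)
  case (Suc d)
  have "((1/2::real) ^ Suc d) powr \<alpha> = (1/2) powr \<alpha> * ((1/2) ^ d) powr \<alpha>"
    unfolding power_Suc by (rule powr_mult)
  then show ?case using Suc.IH by simp
qed simp

lemma half_powr_bounds: "0 < \<alpha> \<Longrightarrow> 0 < (1/2::real) powr \<alpha>" "0 < \<alpha> \<Longrightarrow> (1/2::real) powr \<alpha> < 1"
  using powr_less_mono2[of \<alpha> "1/2" 1] by auto

lemma gradius_ratio:
  fixes i i' :: "int \<times> (int ^ 'n)"
  assumes "fst i \<le> fst i'"
  shows "gradius i' = gradius i * 2 ^ nat (fst i' - fst i)"
    and "(gradius i / gradius i') powr \<alpha> = ((1/2) powr \<alpha>) ^ nat \<bar>fst i' - fst i\<bar>"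
proof -
  show 1: "gradius i' = gradius i * 2 ^ nat (fst i' - fst i)"
    using dyad_diff[OF assms] by (simp add: gradius_def)
  have "gradius i / gradius i' = (1/2) ^ nat \<bar>fst i' - fst i\<bar>"
    using assms by (subst 1) (simp add: power_divide)
  then show "(gradius i / gradius i') powr \<alpha> = ((1/2) powr \<alpha>) ^ nat \<bar>fst i' - fst i\<bar>"
    by (simp only: half_powr_power)
qed

text \<open>Here \<open>i'\<close> is the finer index. The number of its grid points near
  \<open>gball i\<close> grows like the n-th power of the ratio of scales, and exactly this power is
  regained from the ratio of the volumes.\<close>

lemma gradius_pow_ratio:
  fixes i i' :: "int \<times> (int ^ 'n)"
  assumes "fst i' \<le> fst i"
  shows "(gradius i' / gradius i) ^ CARD('n) * (4 * gradius i / dyad (fst i') + 1) ^ CARD('n)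
    \<le> (4 * (real CARD('n) + 2) + 1) ^ CARD('n)"
proof -
  define N where "N = real CARD('n) + 2"
  define d where "d = nat (fst i - fst i')"
  have N: "0 < N" by (simp add: N_def add_nonneg_pos)
  have s: "dyad (fst i) = dyad (fst i') * 2 ^ d" unfolding d_def by (rule dyad_diff[OF assms])
  have "gradius i' / gradius i = 1 / 2 ^ d"
    using N by (simp add: gradius_def s N_def[symmetric])
  moreover have "4 * gradius i / dyad (fst i') + 1 = 4 * N * 2 ^ d + 1"
    by (simp add: gradius_def s N_def[symmetric])
  moreover have "4 * N * 2 ^ d + 1 \<le> (4 * N + 1) * 2 ^ d" by (simp add: algebra_simps)
  ultimately have "gradius i' / gradius i * (4 * gradius i / dyad (fst i') + 1) \<le> 4 * N + 1"
    by (simp add: field_simps)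
  then have "(gradius i' / gradius i * (4 * gradius i / dyad (fst i') + 1)) ^ CARD('n) \<le> (4 * N + 1) ^ CARD('n)"
    by (intro power_mono) (auto simp: less_imp_le)
  then show ?thesis by (simp only: power_mult_distrib N_def)
qed

text \<open>Row sums for a Schur test, with weights proportional to the volumes of the balls. The
  bound is the same for every choice of the kernels \<open>u i\<close>, which will be picked to suit
  a given function.\<close>

lemma gram_row_sum_le:
  fixes i :: "int \<times> (int ^ 'n)" and u :: "int \<times> (int ^ 'n) \<Rightarrow> real ^ 'n \<Rightarrow> real"
  assumes a: "0 < \<alpha>" "\<alpha> \<le> 1"
    and J: "finite J" "i \<in> J" and u: "\<And>i. i \<in> J \<Longrightarrow> u i \<in> kernels \<alpha> (gcentre i) (gradius i)"
  shows "(\<Sum>j\<in>J. gradius j ^ CARD('n) * \<bar>LINT z|lebesgue. u i z * u j z\<bar>)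
    \<le> 2 * unit_ball_vol (real CARD('n)) * (4 * (real CARD('n) + 2) + 1) ^ CARD('n) * (2 / (1 - (1/2) powr \<alpha>))"
proof -
  let ?n = "CARD('n)"
  define V where "V = 2 * unit_ball_vol (real ?n)"
  define q where "q = (1/2::real) powr \<alpha>"
  define P where "P = (4 * (real CARD('n) + 2) + 1) ^ CARD('n)"
  have V: "0 < V" by (simp add: V_def)
  have P: "0 \<le> P" by (simp add: P_def)
  have q: "0 < q" "q < 1" using half_powr_bounds[OF a(1)] by (auto simp: q_def)
  \<comment> \<open>Covers both directions. For \<open>j\<close> coarser, the weight cancels the
    normalisation of the coarser kernel and the minimum is 1; for \<open>j\<close> finer, the
    minimum is the ratio of radii, whose n-th power offsets the number of fine grid points. In both
    cases \<open>q\<close> carries the decay in the difference of scales.\<close>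
  define g where "g j = V * (min 1 (gradius j / gradius i)) ^ ?n * q ^ nat \<bar>fst j - fst i\<bar>
      * indicator (ball (gcentre i) (gradius i + gradius j)) (gcentre j)" for j
  have le: "gradius j ^ ?n * \<bar>LINT z|lebesgue. u i z * u j z\<bar> \<le> g j" if j: "j \<in> J" for j
  proof (cases "fst i \<le> fst j")
    case True
    have r: "gradius i \<le> gradius j" using True dyad_mono by (auto simp: gradius_def intro!: mult_left_mono)
    have "\<bar>LINT z|lebesgue. u i z * u j z\<bar> \<le> V / gradius j ^ ?n * (gradius i / gradius j) powr \<alpha>
        * indicator (ball (gcentre i) (gradius i + gradius j)) (gcentre j)"
      unfolding V_def by (rule kernel_inner_le[OF u[OF J(2)] u[OF j] a _ r]) simp
    then have "gradius j ^ ?n * \<bar>LINT z|lebesgue. u i z * u j z\<bar> \<le> gradius j ^ ?n * (V / gradius j ^ ?n * (gradius i / gradius j) powr \<alpha>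
        * indicator (ball (gcentre i) (gradius i + gradius j)) (gcentre j))"
      by (rule mult_left_mono) simp
    also have "\<dots> = g j"
      using r unfolding g_def gradius_ratio(2)[OF True] by (simp add: q_def min_def)
    finally show ?thesis .
  next
    case False
    then have le: "fst j \<le> fst i" by simp
    have r: "gradius j \<le> gradius i" using le dyad_mono by (auto simp: gradius_def intro!: mult_left_mono)
    have "\<bar>LINT z|lebesgue. u j z * u i z\<bar> \<le> V / gradius i ^ ?n * (gradius j / gradius i) powr \<alpha>
        * indicator (ball (gcentre j) (gradius j + gradius i)) (gcentre i)"
      unfolding V_def by (rule kernel_inner_le[OF u[OF j] u[OF J(2)] a _ r]) simp
    then have "gradius j ^ ?n * \<bar>LINT z|lebesgue. u j z * u i z\<bar> \<le> gradius j ^ ?n * (V / gradius i ^ ?n * (gradius j / gradius i) powr \<alpha>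
        * indicator (ball (gcentre j) (gradius j + gradius i)) (gcentre i))"
      by (rule mult_left_mono) simp
    also have "\<dots> = g j"
      using r unfolding g_def gradius_ratio(2)[OF le]
      by (simp add: q_def min_def power_divide dist_commute abs_minus_commute add.commute split: split_indicator)
    finally show ?thesis by (simp add: mult.commute)
  qed
  have row: "csum (\<lambda>m. ennreal (g (k, m))) \<le> ennreal (V * P) * ennreal (q ^ nat \<bar>k - fst i\<bar>)" for k
  proof -
    define r where "r = (real ?n + 2) * dyad k"
    have r: "gradius (k, m) = r" for m :: "int^'n" by (simp add: gradius_def r_def)
    have r0: "0 < r" using r gradius_pos(1) by metis
    define R where "R = gradius i + r"
    have R0: "0 \<le> R" using r0 by (simp add: R_def add_nonneg_nonneg)
    have "csum (\<lambda>m. ennreal (g (k, m))) = csum (\<lambda>m. ennreal (V * (min 1 (r / gradius i)) ^ ?n * q ^ nat \<bar>k - fst i\<bar>)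
        * indicator (ball (gcentre i) R) (gcentre (k, m)))"
      unfolding g_def r R_def by (rule nn_integral_cong) (auto split: split_indicator)
    also have "\<dots> = ennreal (V * (min 1 (r / gradius i)) ^ ?n * q ^ nat \<bar>k - fst i\<bar>) *
        csum (\<lambda>m. indicator (ball (gcentre i) R) (gcentre (k, m)))"
      by (rule nn_integral_cmult) simp
    also have "\<dots> \<le> ennreal (V * (min 1 (r / gradius i)) ^ ?n * q ^ nat \<bar>k - fst i\<bar>) *
        ennreal ((2 * R / dyad k + 1) ^ ?n)"
      using r0 by (intro mult_left_mono csum_grid_le) (auto simp: R_def add_nonneg_nonneg)
    also have "\<dots> = ennreal (V * q ^ nat \<bar>k - fst i\<bar> * ((min 1 (r / gradius i)) ^ ?n * (2 * R / dyad k + 1) ^ ?n))"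
      using V q r0 R0 by (subst ennreal_mult[symmetric]) (auto simp: mult_ac)
    also have "\<dots> \<le> ennreal (V * q ^ nat \<bar>k - fst i\<bar> * P)"
    proof (intro ennreal_leI mult_left_mono)
      show "(min 1 (r / gradius i)) ^ ?n * (2 * R / dyad k + 1) ^ ?n \<le> P"
      proof (cases "fst i \<le> k")
        case True
        then have "gradius i \<le> r" using dyad_mono by (auto simp: gradius_def r_def intro!: mult_left_mono)
        then have m: "min 1 (r / gradius i) = 1" by simp
        have "R \<le> 2 * r" using \<open>gradius i \<le> r\<close> by (simp add: R_def)
        then have "2 * R / dyad k \<le> 4 * r / dyad k" by (intro divide_right_mono) auto
        also have "4 * r / dyad k = 4 * (real ?n + 2)" by (simp add: r_def)
        finally have "(2 * R / dyad k + 1) ^ ?n \<le> P"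
          unfolding P_def using r0 by (intro power_mono) (auto simp: R_def add_nonneg_nonneg)
        then show ?thesis by (simp add: m)
      next
        case False
        then have le: "fst (k, snd i) \<le> fst i" by simp
        have "r \<le> gradius i" using False dyad_mono[of k "fst i"] by (auto simp: gradius_def r_def intro!: mult_left_mono)
        then have m: "min 1 (r / gradius i) = r / gradius i" by simp
        have "R \<le> 2 * gradius i" using \<open>r \<le> gradius i\<close> by (simp add: R_def)
        then have "2 * R / dyad k + 1 \<le> 4 * gradius i / dyad k + 1"
          by (intro add_right_mono divide_right_mono) auto
        then have "(2 * R / dyad k + 1) ^ ?n \<le> (4 * gradius i / dyad k + 1) ^ ?n"
          using r0 by (intro power_mono) (auto simp: R_def add_nonneg_nonneg)
        then have "(r / gradius i) ^ ?n * (2 * R / dyad k + 1) ^ ?n \<le> (r / gradius i) ^ ?n * (4 * gradius i / dyad k + 1) ^ ?n"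
          using r0 by (intro mult_left_mono) auto
        also have "\<dots> \<le> P" using gradius_pow_ratio[OF le] by (simp add: r P_def)
        finally show ?thesis by (simp add: m)
      qed
    qed (use V q in auto)
    also have "\<dots> = ennreal (V * P) * ennreal (q ^ nat \<bar>k - fst i\<bar>)"
      using V P q by (subst ennreal_mult[symmetric]) (auto simp: ac_simps)
    finally show ?thesis .
  qed
  have "ennreal (\<Sum>j\<in>J. gradius j ^ ?n * \<bar>LINT z|lebesgue. u i z * u j z\<bar>) \<le> ennreal (\<Sum>j\<in>J. g j)"
    by (intro ennreal_leI sum_mono le)
  also have "\<dots> = (\<Sum>j\<in>J. ennreal (g j))"
    using V q by (subst sum_ennreal) (auto simp: g_def intro!: mult_nonneg_nonneg)
  also have "\<dots> \<le> csum (\<lambda>j. ennreal (g j))" by (rule sum_le_csum[OF J(1)])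
  also have "\<dots> = csum (\<lambda>k. csum (\<lambda>m. ennreal (g (k, m))))" by (rule csum_prod)
  also have "\<dots> \<le> csum (\<lambda>k. ennreal (V * P) * ennreal (q ^ nat \<bar>k - fst i\<bar>))"
    by (rule nn_integral_mono) (rule row)
  also have "\<dots> = ennreal (V * P) * csum (\<lambda>k. ennreal (q ^ nat \<bar>k - fst i\<bar>))"
    by (rule nn_integral_cmult) simp
  also have "\<dots> \<le> ennreal (V * P) * ennreal (2 / (1 - q))"
    by (intro mult_left_mono csum_geometric_int q) simp
  also have "\<dots> = ennreal (V * P * (2 / (1 - q)))"
    using V P q by (subst ennreal_mult[symmetric]) auto
  finally show ?thesis
    using V P q by (subst (asm) ennreal_le_iff) (auto simp: V_def P_def q_def)
qed

text \<open>Expand \<open>0 \<le> \<integral>(f - g / B)\<^sup>2\<close> for \<open>g = \<Sum>\<^sub>i \<mu> i * \<langle>u i, f\<rangle> * u i\<close>.\<close>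

lemma bessel_finite:
  fixes u :: "'i \<Rightarrow> 'a \<Rightarrow> real" and f :: "'a \<Rightarrow> real"
  assumes J: "finite J" and mu: "\<And>i. i \<in> J \<Longrightarrow> 0 \<le> \<mu> i" and B: "0 < B"
    and f2: "integrable M (\<lambda>x. (f x)\<^sup>2)"
    and uf: "\<And>i. i \<in> J \<Longrightarrow> integrable M (\<lambda>x. u i x * f x)"
    and uu: "\<And>i j. i \<in> J \<Longrightarrow> j \<in> J \<Longrightarrow> integrable M (\<lambda>x. u i x * u j x)"
    and row: "\<And>i. i \<in> J \<Longrightarrow> (\<Sum>j\<in>J. \<mu> j * \<bar>LINT x|M. u i x * u j x\<bar>) \<le> B"
  shows "(\<Sum>i\<in>J. \<mu> i * (LINT x|M. u i x * f x)\<^sup>2) \<le> B * (LINT x|M. (f x)\<^sup>2)"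
proof -
  define a where "a i = (LINT x|M. u i x * f x)" for i
  define G where "G i j = (LINT x|M. u i x * u j x)" for i j
  define X where "X = (\<Sum>i\<in>J. \<mu> i * (a i)\<^sup>2)"
  \<comment> \<open>Minimises \<open>c^2 * B * X - 2 * c * X\<close>, the bound reached below for
    the two terms that are added to the square norm of \<open>f\<close>.\<close>
  define c where "c = 1 / B"
  have sym: "G i j = G j i" for i j by (simp add: G_def mult.commute)
  have expand: "(f x - c * (\<Sum>i\<in>J. \<mu> i * a i * u i x))\<^sup>2
      = (f x)\<^sup>2 - (\<Sum>i\<in>J. 2 * c * \<mu> i * a i * (u i x * f x))
        + (\<Sum>i\<in>J. \<Sum>j\<in>J. c\<^sup>2 * \<mu> i * \<mu> j * a i * a j * (u i x * u j x))" for x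
  proof -
    have "(c * (\<Sum>i\<in>J. \<mu> i * a i * u i x))\<^sup>2 = c\<^sup>2 * ((\<Sum>i\<in>J. \<mu> i * a i * u i x) * (\<Sum>j\<in>J. \<mu> j * a j * u j x))"
      by (simp add: power2_eq_square)
    also have "\<dots> = (\<Sum>i\<in>J. \<Sum>j\<in>J. c\<^sup>2 * \<mu> i * \<mu> j * a i * a j * (u i x * u j x))"
      by (simp add: sum_product sum_distrib_left ac_simps)
    finally have 1: "(c * (\<Sum>i\<in>J. \<mu> i * a i * u i x))\<^sup>2 = \<dots>" .
    have 2: "2 * f x * (c * (\<Sum>i\<in>J. \<mu> i * a i * u i x)) = (\<Sum>i\<in>J. 2 * c * \<mu> i * a i * (u i x * f x))"
      by (simp add: sum_distrib_left ac_simps)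
    show ?thesis unfolding power2_diff 1 2 by simp
  qed
  have "0 \<le> (LINT x|M. (f x - c * (\<Sum>i\<in>J. \<mu> i * a i * u i x))\<^sup>2)" by simp
  also have "\<dots> = (LINT x|M. (f x)\<^sup>2) - (\<Sum>i\<in>J. 2 * c * \<mu> i * a i * a i)
      + (\<Sum>i\<in>J. \<Sum>j\<in>J. c\<^sup>2 * \<mu> i * \<mu> j * a i * a j * G i j)"
    unfolding expand using f2 uf uu by (simp add: a_def G_def integral_sum' integrable_sum)
  also have "(\<Sum>i\<in>J. 2 * c * \<mu> i * a i * a i) = 2 * c * X"
    by (simp add: X_def sum_distrib_left power2_eq_square ac_simps)
  also have "(\<Sum>i\<in>J. \<Sum>j\<in>J. c\<^sup>2 * \<mu> i * \<mu> j * a i * a j * G i j) \<le> c\<^sup>2 * (B * X)"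
  proof -
    \<comment> \<open>Schur test: the product \<open>a i * a j\<close> is split into squares by the
      arithmetic-geometric mean inequality, and the symmetry of \<open>G\<close> turns both halves
      into row sums.\<close>
    have "(\<Sum>i\<in>J. \<Sum>j\<in>J. c\<^sup>2 * \<mu> i * \<mu> j * a i * a j * G i j)
        \<le> (\<Sum>i\<in>J. \<Sum>j\<in>J. c\<^sup>2 / 2 * (\<mu> i * (a i)\<^sup>2 * (\<mu> j * \<bar>G i j\<bar>)) + c\<^sup>2 / 2 * (\<mu> j * (a j)\<^sup>2 * (\<mu> i * \<bar>G j i\<bar>)))"
    proof (intro sum_mono)
      fix i j assume ij: "i \<in> J" "j \<in> J"
      have "a i * a j * G i j \<le> \<bar>a i * a j\<bar> * \<bar>G i j\<bar>" by (metis abs_ge_self abs_mult)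
      also have "\<bar>a i * a j\<bar> \<le> ((a i)\<^sup>2 + (a j)\<^sup>2) / 2"
        using sum_squares_bound[of "\<bar>a i\<bar>" "\<bar>a j\<bar>"] by (simp add: abs_mult)
      finally have "a i * a j * G i j \<le> ((a i)\<^sup>2 + (a j)\<^sup>2) / 2 * \<bar>G i j\<bar>" by (simp add: mult_right_mono)
      then have "c\<^sup>2 * \<mu> i * \<mu> j * (a i * a j * G i j) \<le> c\<^sup>2 * \<mu> i * \<mu> j * (((a i)\<^sup>2 + (a j)\<^sup>2) / 2 * \<bar>G i j\<bar>)"
        using mu ij by (intro mult_left_mono) auto
      then show "c\<^sup>2 * \<mu> i * \<mu> j * a i * a j * G i j \<le> c\<^sup>2 / 2 * (\<mu> i * (a i)\<^sup>2 * (\<mu> j * \<bar>G i j\<bar>)) + c\<^sup>2 / 2 * (\<mu> j * (a j)\<^sup>2 * (\<mu> i * \<bar>G j i\<bar>))"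
        unfolding sym[of j i] by (simp add: field_simps)
    qed
    also have "\<dots> = (\<Sum>i\<in>J. \<Sum>j\<in>J. c\<^sup>2 / 2 * (\<mu> i * (a i)\<^sup>2 * (\<mu> j * \<bar>G i j\<bar>))) + (\<Sum>j\<in>J. \<Sum>i\<in>J. c\<^sup>2 / 2 * (\<mu> j * (a j)\<^sup>2 * (\<mu> i * \<bar>G j i\<bar>)))"
      unfolding sum.distrib by (rule arg_cong2[where f="(+)", OF refl sum.swap])
    also have "\<dots> = c\<^sup>2 * (\<Sum>i\<in>J. \<mu> i * (a i)\<^sup>2 * (\<Sum>j\<in>J. \<mu> j * \<bar>G i j\<bar>))"
    proof -
      have "(\<Sum>i\<in>J. \<Sum>j\<in>J. c\<^sup>2 / 2 * (\<mu> i * (a i)\<^sup>2 * (\<mu> j * \<bar>G i j\<bar>)))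
          = c\<^sup>2 / 2 * (\<Sum>i\<in>J. \<mu> i * (a i)\<^sup>2 * (\<Sum>j\<in>J. \<mu> j * \<bar>G i j\<bar>))"
        by (simp only: sum_distrib_left)
      then show ?thesis by simp
    qed
    also have "\<dots> \<le> c\<^sup>2 * (\<Sum>i\<in>J. \<mu> i * (a i)\<^sup>2 * B)"
      using mu row by (intro mult_left_mono sum_mono) (auto simp: G_def)
    also have "\<dots> = c\<^sup>2 * (B * X)" by (simp add: X_def sum_distrib_left ac_simps)
    finally show ?thesis .
  qed
  finally have "0 \<le> (LINT x|M. (f x)\<^sup>2) - 2 * c * X + c\<^sup>2 * (B * X)" by simp
  moreover have "c\<^sup>2 * (B * X) = X / B" "2 * c * X = 2 * (X / B)"
    using B by (simp_all add: c_def power2_eq_square)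
  ultimately have "X / B \<le> (LINT x|M. (f x)\<^sup>2)" by linarith
  then have "X \<le> B * (LINT x|M. (f x)\<^sup>2)" using B by (simp add: field_simps)
  then show ?thesis by (simp add: X_def a_def)
qed

section \<open>Square integrable functions\<close>

lemma gcoef_le:
  fixes f :: "real ^ 'n \<Rightarrow> complex"
  assumes a: "0 < \<alpha>" "\<alpha> \<le> 1" and f: "f \<in> borel_measurable lebesgue"
  shows "gcoef \<alpha> f i \<le> ennreal (2 / gradius i ^ CARD('n)) * (\<integral>\<^sup>+z\<in>gball i. ennreal (cmod (f z)) \<partial>lebesgue)"
  unfolding gcoef_def gball_def by (rule SUP_least, rule kernel_integral_le[OF _ a _ f]) auto

lemma locally_integrable_nn_integral_ball:
  assumes "locally_integrable f"
  shows "(\<integral>\<^sup>+z\<in>ball a r. ennreal (norm (f z)) \<partial>lebesgue) < top"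
proof -
  have "integrable lebesgue (\<lambda>z. indicator (ball a r) z *\<^sub>R f z)"
    using locally_integrable_set_integrable_ball[OF assms] by (simp add: set_integrable_def)
  then have "(\<integral>\<^sup>+z. ennreal (norm (indicator (ball a r) z *\<^sub>R f z)) \<partial>lebesgue) < top"
    by (simp add: integrable_iff_bounded)
  also have "(\<integral>\<^sup>+z. ennreal (norm (indicator (ball a r) z *\<^sub>R f z)) \<partial>lebesgue) =
      (\<integral>\<^sup>+z\<in>ball a r. ennreal (norm (f z)) \<partial>lebesgue)"
    by (rule nn_integral_cong) (auto split: split_indicator)
  finally show ?thesis .
qed

lemma gcoef_finite:
  fixes f :: "real ^ 'n \<Rightarrow> complex"
  assumes a: "0 < \<alpha>" "\<alpha> \<le> 1" and f: "locally_integrable f"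
  shows "gcoef \<alpha> f i < top"
proof -
  have "gcoef \<alpha> f i \<le> ennreal (2 / gradius i ^ CARD('n)) * (\<integral>\<^sup>+z\<in>gball i. ennreal (cmod (f z)) \<partial>lebesgue)"
    by (rule gcoef_le[OF a locally_integrable_borel[OF f]])
  also have "\<dots> < top"
    using locally_integrable_nn_integral_ball[OF f] by (simp add: gball_def ennreal_mult_less_top)
  finally show ?thesis .
qed

text \<open>Coefficients are local. This allows \<open>f\<close> to be cut off by a condition on the
  weight without changing the coefficients of those balls on which the condition holds almost
  everywhere.\<close>

lemma gcoef_cong:
  fixes f g :: "real ^ 'n \<Rightarrow> complex"
  assumes a: "0 < \<alpha>" and [measurable]: "f \<in> borel_measurable lebesgue" "g \<in> borel_measurable lebesgue"
    and eq: "AE z in lebesgue. z \<in> gball i \<longrightarrow> f z = g z"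
  shows "gcoef \<alpha> f i = gcoef \<alpha> g i"
  unfolding gcoef_def
proof (rule SUP_cong[OF refl])
  fix v assume v: "v \<in> kernels \<alpha> (gcentre i) (gradius i)"
  note [measurable] = kernel_borel(1)[OF v a gradius_pos(1)]
  have "(LINT z|lebesgue. v z *\<^sub>R f z) = (LINT z|lebesgue. v z *\<^sub>R g z)"
  proof (rule integral_cong_AE)
    show "AE z in lebesgue. v z *\<^sub>R f z = v z *\<^sub>R g z"
      using eq by eventually_elim (use v in \<open>auto simp: kernels_def gball_def\<close>)
  qed simp_all
  then show "ennreal (cmod (LINT z|lebesgue. v z *\<^sub>R f z)) = ennreal (cmod (LINT z|lebesgue. v z *\<^sub>R g z))" by simp
qed

lemma gcoef_add_le:
  fixes f g :: "real ^ 'n \<Rightarrow> complex"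
  assumes a: "0 < \<alpha>" "\<alpha> \<le> 1" and f: "locally_integrable f" and g: "locally_integrable g"
  shows "gcoef \<alpha> (\<lambda>z. f z + g z) i \<le> gcoef \<alpha> f i + gcoef \<alpha> g i"
  unfolding gcoef_def[of \<alpha> "\<lambda>z. f z + g z"]
proof (rule SUP_least)
  fix v assume v: "v \<in> kernels \<alpha> (gcentre i) (gradius i)"
  have "(LINT z|lebesgue. v z *\<^sub>R (f z + g z)) = (LINT z|lebesgue. v z *\<^sub>R f z) + (LINT z|lebesgue. v z *\<^sub>R g z)"
    using kernel_integrable[OF v a gradius_pos(1) f] kernel_integrable[OF v a gradius_pos(1) g]
    by (simp add: scaleR_add_right)
  then have "ennreal (cmod (LINT z|lebesgue. v z *\<^sub>R (f z + g z)))
      \<le> ennreal (cmod (LINT z|lebesgue. v z *\<^sub>R f z)) + ennreal (cmod (LINT z|lebesgue. v z *\<^sub>R g z))"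
    by (simp add: norm_triangle_ineq ennreal_leI flip: ennreal_plus)
  also have "\<dots> \<le> gcoef \<alpha> f i + gcoef \<alpha> g i"
    unfolding gcoef_def using v by (intro add_mono SUP_upper)
  finally show "ennreal (cmod (LINT z|lebesgue. v z *\<^sub>R (f z + g z))) \<le> gcoef \<alpha> f i + gcoef \<alpha> g i" .
qed

lemma emeasure_gball:
  fixes i :: "int \<times> (int ^ 'n)"
  shows "emeasure lebesgue (gball i) = ennreal (unit_ball_vol (real CARD('n)) * gradius i ^ CARD('n))"
  unfolding gball_def by (rule emeasure_lebesgue_ball) simp

text \<open>A positive finite supremum exceeds its half; local integrability makes it finite, and
  for a zero coefficient the zero kernel serves. One linear functional then stands in for the
  supremum.\<close>

lemma gcoef_near_optimal:
  fixes f :: "real ^ 'n \<Rightarrow> complex"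
  assumes a: "0 < \<alpha>" "\<alpha> \<le> 1" and f: "locally_integrable f"
  obtains v where "v \<in> kernels \<alpha> (gcentre i) (gradius i)"
    and "gcoef \<alpha> f i \<le> 2 * ennreal (cmod (LINT z|lebesgue. v z *\<^sub>R f z))"
proof (cases "gcoef \<alpha> f i = 0")
  case True
  then show ?thesis using that[OF kernels_nonempty[OF gradius_pos(1)]] by simp
next
  case False
  obtain r where r: "gcoef \<alpha> f i = ennreal r" "0 \<le> r"
    using gcoef_finite[OF a f, of i] by (cases "gcoef \<alpha> f i") auto
  then have "ennreal (r / 2) < gcoef \<alpha> f i" using False by (simp add: ennreal_lessI)
  then obtain v where v: "v \<in> kernels \<alpha> (gcentre i) (gradius i)" "ennreal (r / 2) < ennreal (cmod (LINT z|lebesgue. v z *\<^sub>R f z))"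
    unfolding gcoef_def less_SUP_iff by blast
  then have "r \<le> 2 * cmod (LINT z|lebesgue. v z *\<^sub>R f z)" using r(2) by (simp add: ennreal_less_iff)
  then have "gcoef \<alpha> f i \<le> ennreal (2 * cmod (LINT z|lebesgue. v z *\<^sub>R f z))"
    by (simp only: r ennreal_leI)
  then have "gcoef \<alpha> f i \<le> 2 * ennreal (cmod (LINT z|lebesgue. v z *\<^sub>R f z))"
    by (simp add: ennreal_mult)
  with v(1) show ?thesis by (rule that)
qed

text \<open>Near-optimal kernels for the given \<open>f\<close> turn the coefficients into inner
  products, and the bound on the Gram matrix is uniform in their choice. The factor 4 is the square
  of the loss in \<open>gcoef_near_optimal\<close>.\<close>

theorem gcoef_L2_bound:
  assumes a: "0 < \<alpha>" "\<alpha> \<le> 1"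
  shows "\<exists>C>0. \<forall>f :: real ^ 'n \<Rightarrow> complex. locally_integrable f \<longrightarrow>
    csum (\<lambda>i. emeasure lebesgue (gball i) * (gcoef \<alpha> f i)\<^sup>2)
      \<le> ennreal C * (\<integral>\<^sup>+z. (ennreal (cmod (f z)))\<^sup>2 \<partial>lebesgue)"
proof -
  let ?n = "CARD('n)"
  define V where "V = unit_ball_vol (real ?n)"
  define B where "B = V * (2 * V * (4 * (real CARD('n) + 2) + 1) ^ CARD('n) * (2 / (1 - (1/2) powr \<alpha>)))"
  have V: "0 < V" by (simp add: V_def)
  have B: "0 < B" using V half_powr_bounds[OF a(1)] by (auto simp: B_def intro!: mult_pos_pos add_pos_pos)
  have "csum (\<lambda>i. emeasure lebesgue (gball i) * (gcoef \<alpha> f i)\<^sup>2)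
      \<le> ennreal (4 * B) * (\<integral>\<^sup>+z. (ennreal (cmod (f z)))\<^sup>2 \<partial>lebesgue)"
    if f: "locally_integrable f" for f :: "real ^ 'n \<Rightarrow> complex"
  proof (cases "(\<integral>\<^sup>+z. (ennreal (cmod (f z)))\<^sup>2 \<partial>lebesgue) = top")
    case True
    then show ?thesis using B by (simp add: ennreal_mult_top)
  next
    case False
    note [measurable] = locally_integrable_borel[OF f]
    have int: "integrable lebesgue (\<lambda>z. (cmod (f z))\<^sup>2)"
      using False by (intro integrableI_bounded) (auto simp: ennreal_power less_top)
    have intR: "integrable lebesgue (\<lambda>z. (Re (f z))\<^sup>2)" "integrable lebesgue (\<lambda>z. (Im (f z))\<^sup>2)"
      by (rule Bochner_Integration.integrable_bound[OF int]; simp add: cmod_power2)+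
    show ?thesis
    proof (rule csum_le_if_sums_le)
      fix J :: "(int \<times> (int ^ 'n)) set" assume J: "finite J"
      have "\<exists>v. v \<in> kernels \<alpha> (gcentre i) (gradius i) \<and> gcoef \<alpha> f i \<le> 2 * ennreal (cmod (LINT z|lebesgue. v z *\<^sub>R f z))" for i
        using gcoef_near_optimal[OF a f] by metis
      then obtain u where u: "\<And>i. u i \<in> kernels \<alpha> (gcentre i) (gradius i)"
        and opt: "\<And>i. gcoef \<alpha> f i \<le> 2 * ennreal (cmod (LINT z|lebesgue. u i z *\<^sub>R f z))"
        by metis
      have row: "(\<Sum>j\<in>J. V * gradius j ^ ?n * \<bar>LINT z|lebesgue. u i z * u j z\<bar>) \<le> B" if "i \<in> J" for i
      proof -
        have "(\<Sum>j\<in>J. V * gradius j ^ ?n * \<bar>LINT z|lebesgue. u i z * u j z\<bar>)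
            = V * (\<Sum>j\<in>J. gradius j ^ ?n * \<bar>LINT z|lebesgue. u i z * u j z\<bar>)"
          by (simp only: sum_distrib_left mult.assoc)
        also have "\<dots> \<le> B"
          unfolding B_def V_def by (intro mult_left_mono gram_row_sum_le a J that u) auto
        finally show ?thesis .
      qed
      have ui: "integrable lebesgue (\<lambda>z. u i z *\<^sub>R f z)" for i
        by (rule kernel_integrable[OF u a _ f]) simp
      have uu: "integrable lebesgue (\<lambda>z. u i z * u j z)" for i j
        using integrable_bounded_scaleR[OF kernel_integrable_self[OF u a] kernel_borel(1)[OF u a(1)] kernel_bound[OF u a], of j i]
        by simp
      \<comment> \<open>The kernels are real, so Bessel's inequality for one and the same family is
        applied to the real and the imaginary part of \<open>f\<close>, and the results are
        added.\<close>
      have bes: "(\<Sum>i\<in>J. V * gradius i ^ ?n * (LINT z|lebesgue. u i z * h z)\<^sup>2) \<le> B * (LINT z|lebesgue. (h z)\<^sup>2)"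
        if "integrable lebesgue (\<lambda>z. (h z)\<^sup>2)" "\<And>i. integrable lebesgue (\<lambda>z. u i z * h z)" for h
        by (rule bessel_finite[OF J _ B that uu row]) (use V in auto)
      have re: "Re (LINT z|lebesgue. u i z *\<^sub>R f z) = (LINT z|lebesgue. u i z * Re (f z))"
        and im: "Im (LINT z|lebesgue. u i z *\<^sub>R f z) = (LINT z|lebesgue. u i z * Im (f z))" for i
        using ui[of i] by (simp_all flip: integral_Re integral_Im)
      have iR: "integrable lebesgue (\<lambda>z. u i z * Re (f z))" and iI: "integrable lebesgue (\<lambda>z. u i z * Im (f z))" for i
        using integrable_Re[OF ui[of i]] integrable_Im[OF ui[of i]] by simp_all
      have "(\<Sum>i\<in>J. V * gradius i ^ ?n * (cmod (LINT z|lebesgue. u i z *\<^sub>R f z))\<^sup>2)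
          = (\<Sum>i\<in>J. V * gradius i ^ ?n * (LINT z|lebesgue. u i z * Re (f z))\<^sup>2)
          + (\<Sum>i\<in>J. V * gradius i ^ ?n * (LINT z|lebesgue. u i z * Im (f z))\<^sup>2)"
        by (simp add: cmod_power2 re im distrib_left sum.distrib)
      also have "\<dots> \<le> B * (LINT z|lebesgue. (Re (f z))\<^sup>2) + B * (LINT z|lebesgue. (Im (f z))\<^sup>2)"
        by (intro add_mono bes intR iR iI)
      also have "\<dots> = B * (LINT z|lebesgue. (cmod (f z))\<^sup>2)"
        using intR by (simp add: cmod_power2 distrib_left)
      finally have fin: "(\<Sum>i\<in>J. V * gradius i ^ ?n * (cmod (LINT z|lebesgue. u i z *\<^sub>R f z))\<^sup>2) \<le> B * (LINT z|lebesgue. (cmod (f z))\<^sup>2)" .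
      have "(\<Sum>i\<in>J. emeasure lebesgue (gball i) * (gcoef \<alpha> f i)\<^sup>2)
          \<le> (\<Sum>i\<in>J. ennreal (4 * (V * gradius i ^ ?n * (cmod (LINT z|lebesgue. u i z *\<^sub>R f z))\<^sup>2)))"
      proof (rule sum_mono)
        fix i
        have "emeasure lebesgue (gball i) * (gcoef \<alpha> f i)\<^sup>2 \<le> ennreal (V * gradius i ^ ?n) * (2 * ennreal (cmod (LINT z|lebesgue. u i z *\<^sub>R f z)))\<^sup>2"
          unfolding V_def emeasure_gball by (intro mult_left_mono power_mono opt) auto
        also have "2 * ennreal (cmod (LINT z|lebesgue. u i z *\<^sub>R f z)) = ennreal (2 * cmod (LINT z|lebesgue. u i z *\<^sub>R f z))"
          by (simp add: ennreal_mult)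
        also have "ennreal (V * gradius i ^ ?n) * (ennreal (2 * cmod (LINT z|lebesgue. u i z *\<^sub>R f z)))\<^sup>2
            = ennreal (4 * (V * gradius i ^ ?n * (cmod (LINT z|lebesgue. u i z *\<^sub>R f z))\<^sup>2))"
          using V by (subst ennreal_power, simp, subst ennreal_mult[symmetric]) (auto simp: power_mult_distrib mult_ac)
        finally show "emeasure lebesgue (gball i) * (gcoef \<alpha> f i)\<^sup>2 \<le> \<dots>" .
      qed
      also have "\<dots> = ennreal (4 * (\<Sum>i\<in>J. V * gradius i ^ ?n * (cmod (LINT z|lebesgue. u i z *\<^sub>R f z))\<^sup>2))"
        using V by (subst sum_ennreal) (auto simp: sum_distrib_left)
      also have "\<dots> \<le> ennreal (4 * (B * (LINT z|lebesgue. (cmod (f z))\<^sup>2)))"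
        using fin by (intro ennreal_leI) simp
      also have "\<dots> = ennreal (4 * B) * ennreal (LINT z|lebesgue. (cmod (f z))\<^sup>2)"
        using B by (subst ennreal_mult[symmetric]) (auto simp: mult.assoc)
      also have "ennreal (LINT z|lebesgue. (cmod (f z))\<^sup>2) = (\<integral>\<^sup>+z. (ennreal (cmod (f z)))\<^sup>2 \<partial>lebesgue)"
        using int by (subst nn_integral_eq_integral[symmetric]) (auto simp: ennreal_power)
      finally show "(\<Sum>i\<in>J. emeasure lebesgue (gball i) * (gcoef \<alpha> f i)\<^sup>2)
          \<le> ennreal (4 * B) * (\<integral>\<^sup>+z. (ennreal (cmod (f z)))\<^sup>2 \<partial>lebesgue)" .
    qed
  qed
  then show ?thesis using B by (intro exI[of _ "4 * B"]) auto
qed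

section \<open>The \<open>A_1\<close> condition in pointwise form and the weighted quadratic
  bound\<close>

lemma AE_essinf_le: "AE x in M. essinf M f \<le> f x"
proof -
  have "{c. AE x in M. c \<le> f x} \<noteq> {}"
    by (rule ex_in_conv[THEN iffD1], rule exI[of _ 0]) simp
  \<comment> \<open>The essential infimum is a supremum over possibly uncountably many lower bounds;
    a sequence with the same supremum leaves only countably many null sets to unite.\<close>
  then obtain g :: "nat \<Rightarrow> ennreal" where g: "range g \<subseteq> {c. AE x in M. c \<le> f x}" "essinf M f = (SUP i. g i)"
    unfolding essinf_def using ennreal_Sup_countable_SUP by metis
  have "AE x in M. \<forall>i. g i \<le> f x" using g(1) by (subst AE_all_countable) auto
  then show ?thesis unfolding g(2) by eventually_elim (auto intro: SUP_least)
qed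

lemma wmeas_mono: "E \<subseteq> E' \<Longrightarrow> wmeas w E \<le> wmeas w E'"
  unfolding wmeas_def by (rule nn_integral_mono) (auto split: split_indicator)

text \<open>The mean is multiplied out and the essential infimum replaced by an almost everywhere
  bound, so that the condition can be integrated against a function directly.\<close>

locale A1_bound =
  fixes w :: "real ^ 'n \<Rightarrow> real" and A :: real
  assumes weight: "weight w" and A_pos: "0 < A"
    and AE_le: "\<And>a r. 0 < r \<Longrightarrow> AE x in lebesgue. x \<in> ball a r \<longrightarrow>
      wmeas w (ball a r) \<le> ennreal A * emeasure lebesgue (ball a r) * ennreal (w x)"

lemma A1_weight_A1_bound:
  assumes "A1_weight w"
  obtains A where "A1_bound w A"
proof -
  from assms obtain C where w: "weight w" and C: "0 < C" and b: "\<And>a r. r > 0 \<Longrightarrow>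
        1 / emeasure lebesgue (ball a r) * wmeas w (ball a r)
          \<le> ennreal C * essinf (restrict_space lebesgue (ball a r)) (\<lambda>x. ennreal (w x))"
    unfolding A1_weight_def wmeas_def by auto
  have "A1_bound w C"
  proof
    fix a :: "real ^ 'a" and r :: real assume r: "0 < r"
    let ?E = "emeasure lebesgue (ball a r)"
    define e where "e = unit_ball_vol (real CARD('a)) * r ^ CARD('a)"
    have e: "?E = ennreal e" "0 < e" using r by (simp_all add: e_def emeasure_ball)
    have "AE x in restrict_space lebesgue (ball a r). essinf (restrict_space lebesgue (ball a r)) (\<lambda>x. ennreal (w x)) \<le> ennreal (w x)"
      by (rule AE_essinf_le)
    then have "AE x in lebesgue. x \<in> ball a r \<longrightarrow> essinf (restrict_space lebesgue (ball a r)) (\<lambda>x. ennreal (w x)) \<le> ennreal (w x)"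
      by (subst (asm) AE_restrict_space_iff) auto
    then show "AE x in lebesgue. x \<in> ball a r \<longrightarrow> wmeas w (ball a r) \<le> ennreal C * ?E * ennreal (w x)"
    proof eventually_elim
      case (elim x)
      show ?case
      proof
        assume x: "x \<in> ball a r"
        have "wmeas w (ball a r) = ?E * (1 / ?E * wmeas w (ball a r))"
        proof -
          have "?E * (1 / ?E) = 1" using e by (simp add: ennreal_divide_times ennreal_times_divide divide_ennreal ennreal_1)
          then show ?thesis by (simp add: mult.assoc[symmetric])
        qed
        also have "\<dots> \<le> ?E * (ennreal C * ennreal (w x))"
          using elim x by (intro mult_left_mono order_trans[OF b[OF r]]) auto
        finally show "wmeas w (ball a r) \<le> ennreal C * ?E * ennreal (w x)" by (simp add: ac_simps)
      qed
    qed
  qed (use w C in auto)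
  then show ?thesis by (rule that)
qed

lemma sigma_finite_lebesgue: "sigma_finite_measure (lebesgue :: 'a::euclidean_space measure)"
proof
  let ?A = "range (\<lambda>n::nat. cball (0::'a) (real n))"
  have "emeasure lebesgue (cball (0::'a) (real n)) \<noteq> \<infinity>" for n
    using fmeasurableD2[OF lmeasurable_cball] by simp
  moreover have "\<Union> ?A = space lebesgue"
    by (auto simp: real_arch_simple)
  ultimately show "\<exists>A::'a set set. countable A \<and> A \<subseteq> sets lebesgue \<and> \<Union> A = space lebesgue \<and> (\<forall>a\<in>A. emeasure lebesgue a \<noteq> \<infinity>)"
    by (intro exI[of _ ?A]) auto
qed

context A1_bound
begin

lemma w_nonneg [simp]: "0 \<le> w x"
  using weight by (simp add: weight_def)

lemma w_borel [measurable]: "w \<in> borel_measurable lebesgue"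
  using weight locally_integrable_borel by (auto simp: weight_def)

lemma wmeas_ball_finite: "wmeas w (ball a r) < top"
  using weight locally_integrable_nn_integral_ball[of w a r] by (simp add: weight_def wmeas_def)

text \<open>Integrates the pointwise \<open>A_1\<close> bound against \<open>h\<close>. Later
  passages from unweighted to weighted integrals over balls and cubes go through this
  inequality.\<close>

lemma wmeas_mult_integral_le:
  assumes r: "0 < r" and h [measurable]: "h \<in> borel_measurable lebesgue"
  shows "wmeas w (ball a r) * (\<integral>\<^sup>+x\<in>ball a r. h x \<partial>lebesgue)
    \<le> ennreal A * emeasure lebesgue (ball a r) * (\<integral>\<^sup>+x\<in>ball a r. h x * ennreal (w x) \<partial>lebesgue)"
proof -
  have "wmeas w (ball a r) * (\<integral>\<^sup>+x\<in>ball a r. h x \<partial>lebesgue)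
      = (\<integral>\<^sup>+x. wmeas w (ball a r) * (h x * indicator (ball a r) x) \<partial>lebesgue)"
    by (rule nn_integral_cmult[symmetric]) simp
  also have "\<dots> \<le> (\<integral>\<^sup>+x. ennreal A * emeasure lebesgue (ball a r) * (h x * ennreal (w x) * indicator (ball a r) x) \<partial>lebesgue)"
  proof (rule nn_integral_mono_AE)
    show "AE x in lebesgue. wmeas w (ball a r) * (h x * indicator (ball a r) x)
        \<le> ennreal A * emeasure lebesgue (ball a r) * (h x * ennreal (w x) * indicator (ball a r) x)"
      using AE_le[OF r, of a]
    proof eventually_elim
      case (elim x)
      show ?case
      proof (cases "x \<in> ball a r")
        case True
        then have "wmeas w (ball a r) * h x \<le> ennreal A * emeasure lebesgue (ball a r) * ennreal (w x) * h x"
          using elim by (intro mult_right_mono) auto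
        then show ?thesis using True by (simp add: ac_simps)
      qed simp
    qed
  qed
  also have "\<dots> = ennreal A * emeasure lebesgue (ball a r) * (\<integral>\<^sup>+x\<in>ball a r. h x * ennreal (w x) \<partial>lebesgue)"
    by (rule nn_integral_cmult) simp
  finally show ?thesis .
qed

text \<open>The interval from 0 to \<open>A * w z\<close> has length \<open>A * w z\<close>;
  exchanging the integrals writes a weighted integral as a superposition of unweighted ones over the
  superlevel sets of \<open>A * w\<close>.\<close>

lemma nn_integral_layers:
  assumes [measurable]: "g \<in> borel_measurable lebesgue"
  shows "(\<integral>\<^sup>+s. (\<integral>\<^sup>+z. g z * indicator {0<..<A * w z} s \<partial>lebesgue) \<partial>lborel) = ennreal A * (\<integral>\<^sup>+z. g z * ennreal (w z) \<partial>lebesgue)"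
proof -
  interpret sigma_finite_measure "lebesgue :: (real ^ 'n) measure" by (rule sigma_finite_lebesgue)
  interpret pair_sigma_finite "lebesgue :: (real ^ 'n) measure" "lborel :: real measure" ..
  have [measurable]: "(\<lambda>(z, s). g z * indicator {0<..<A * w z} s) \<in> borel_measurable (lebesgue \<Otimes>\<^sub>M lborel)"
  proof -
    have "(\<lambda>(z, s). g z * (if 0 < s \<and> s < A * w z then 1 else 0)) \<in> borel_measurable (lebesgue \<Otimes>\<^sub>M lborel)"
      by measurable
    also have "(\<lambda>(z, s). g z * (if 0 < s \<and> s < A * w z then 1 else 0)) = (\<lambda>(z, s). g z * indicator {0<..<A * w z} s)"
      by (auto simp: fun_eq_iff split: split_indicator)
    finally show ?thesis .
  qed
  have "(\<integral>\<^sup>+s. (\<integral>\<^sup>+z. g z * indicator {0<..<A * w z} s \<partial>lebesgue) \<partial>lborel)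
      = (\<integral>\<^sup>+z. (\<integral>\<^sup>+s. g z * indicator {0<..<A * w z} s \<partial>lborel) \<partial>lebesgue)"
    by (rule Fubini') measurable
  also have "\<dots> = (\<integral>\<^sup>+z. ennreal A * (g z * ennreal (w z)) \<partial>lebesgue)"
    using A_pos by (intro nn_integral_cong) (simp add: nn_integral_cmult_indicator ennreal_mult ac_simps)
  also have "\<dots> = ennreal A * (\<integral>\<^sup>+z. g z * ennreal (w z) \<partial>lebesgue)"
    by (rule nn_integral_cmult) simp
  finally show ?thesis .
qed

text \<open>If \<open>s\<close> is below the mean of \<open>w\<close> on \<open>gball i\<close>, then \<open>s < A * w\<close> almost everywhere on this ball, so
  restricting \<open>f\<close> to \<open>{z. s < A * w z}\<close> does not change \<open>gcoef \<alpha> f i\<close>.\<close>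

theorem gcoef_weighted_L2_bound:
  assumes a: "0 < \<alpha>" "\<alpha> \<le> 1"
  shows "\<exists>C>0. \<forall>f :: real ^ 'n \<Rightarrow> complex. locally_integrable f \<longrightarrow>
    csum (\<lambda>i. wmeas w (gball i) * (gcoef \<alpha> f i)\<^sup>2)
      \<le> ennreal C * (\<integral>\<^sup>+z. (ennreal (cmod (f z)))\<^sup>2 * ennreal (w z) \<partial>lebesgue)"
proof -
  obtain C where C: "0 < C" and L2: "\<And>f :: real ^ 'n \<Rightarrow> complex. locally_integrable f \<Longrightarrow>
    csum (\<lambda>i. emeasure lebesgue (gball i) * (gcoef \<alpha> f i)\<^sup>2)
      \<le> ennreal C * (\<integral>\<^sup>+z. (ennreal (cmod (f z)))\<^sup>2 \<partial>lebesgue)"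
    using gcoef_L2_bound[OF a] by blast
  have "csum (\<lambda>i. wmeas w (gball i) * (gcoef \<alpha> f i)\<^sup>2)
      \<le> ennreal (C * A) * (\<integral>\<^sup>+z. (ennreal (cmod (f z)))\<^sup>2 * ennreal (w z) \<partial>lebesgue)"
    if f: "locally_integrable f" for f :: "real ^ 'n \<Rightarrow> complex"
  proof -
    note [measurable] = locally_integrable_borel[OF f]
    define \<mu> :: "int \<times> (int ^ 'n) \<Rightarrow> real" where "\<mu> i = unit_ball_vol (real CARD('n)) * gradius i ^ CARD('n)" for i
    have mu: "emeasure lebesgue (gball i) = ennreal (\<mu> i)" "0 < \<mu> i" for i
      by (simp_all only: emeasure_gball \<mu>_def) simp_all
    \<comment> \<open>The mean of \<open>w\<close> over \<open>gball i\<close>: the threshold up to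
      which cutting \<open>f\<close> at a level leaves the coefficient unchanged.\<close>
    define W where "W i = enn2real (wmeas w (gball i)) / \<mu> i" for i
    have W0: "0 \<le> W i" for i using mu(2)[of i] by (simp add: W_def)
    have W: "wmeas w (gball i) = ennreal (\<mu> i) * ennreal (W i)" for i
      using mu(2)[of i] wmeas_ball_finite[of "gcentre i" "gradius i"] W0[of i]
      by (simp add: ennreal_mult[symmetric] less_imp_le W_def gball_def less_top)
    define fs where "fs s z = indicator {z. s < A * w z} z *\<^sub>R f z" for s z
    have fs_loc: "locally_integrable (fs s)" for s
      unfolding locally_integrable_def
    proof (intro allI impI)
      fix K :: "(real ^ 'n) set" assume "compact K"
      then have "set_integrable lebesgue K f" using f by (auto simp: locally_integrable_def)
      then have "integrable lebesgue (\<lambda>z. indicator {z. s < A * w z} z *\<^sub>R (indicator K z *\<^sub>R f z))"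
        unfolding set_integrable_def
      proof (rule integrable_mult_indicator[rotated])
        have "{z \<in> space lebesgue. s < A * w z} \<in> sets lebesgue" by measurable
        then show "{z. s < A * w z} \<in> sets lebesgue" by simp
      qed
      then show "set_integrable lebesgue K (fs s)"
        by (simp add: set_integrable_def fs_def mult.commute)
    qed
    have gc: "gcoef \<alpha> f i = gcoef \<alpha> (fs s) i" if "s < W i" for i s
    proof (rule gcoef_cong[OF a(1)])
      show "AE z in lebesgue. z \<in> gball i \<longrightarrow> f z = fs s z"
        using AE_le[of "gradius i" "gcentre i", OF gradius_pos(1)]
      proof eventually_elim
        case (elim z)
        show ?case
        proof
          assume "z \<in> gball i"
          then have "wmeas w (gball i) \<le> ennreal A * emeasure lebesgue (gball i) * ennreal (w z)"
            using elim by (simp only: gball_def simp_thms)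
          then have "ennreal (\<mu> i) * ennreal (W i) \<le> ennreal A * ennreal (\<mu> i) * ennreal (w z)"
            unfolding W mu(1) .
          then have "\<mu> i * W i \<le> A * \<mu> i * w z"
            using A_pos mu(2)[of i] W0 by (simp add: ennreal_mult[symmetric] less_imp_le)
          then have "\<mu> i * W i \<le> \<mu> i * (A * w z)" by (simp add: mult_ac)
          then have "W i \<le> A * w z" using mu(2)[of i] by simp
          then show "f z = fs s z" using that by (simp add: fs_def)
        qed
      qed
    qed (use locally_integrable_borel[OF fs_loc] in auto)
    \<comment> \<open>The mean \<open>W i\<close> is written as the length of an interval of levels.
      At a fixed level \<open>s\<close> only the balls with \<open>s < W i\<close> remain, and for
      these \<open>f\<close> may be replaced by \<open>fs s\<close>; the unweighted bound then
      applies level by level.\<close>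
    have "csum (\<lambda>i. wmeas w (gball i) * (gcoef \<alpha> f i)\<^sup>2)
        = csum (\<lambda>i. \<integral>\<^sup>+s. ennreal (\<mu> i) * (gcoef \<alpha> f i)\<^sup>2 * indicator {0<..<W i} s \<partial>lborel)"
    proof (rule nn_integral_cong)
      fix i
      have "(\<integral>\<^sup>+s. ennreal (\<mu> i) * (gcoef \<alpha> f i)\<^sup>2 * indicator {0<..<W i} s \<partial>lborel)
          = ennreal (\<mu> i) * (gcoef \<alpha> f i)\<^sup>2 * ennreal (W i)"
        using W0[of i] by (subst nn_integral_cmult_indicator) auto
      then show "wmeas w (gball i) * (gcoef \<alpha> f i)\<^sup>2
          = (\<integral>\<^sup>+s. ennreal (\<mu> i) * (gcoef \<alpha> f i)\<^sup>2 * indicator {0<..<W i} s \<partial>lborel)"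
        by (simp add: W mult_ac)
    qed
    also have "\<dots> = (\<integral>\<^sup>+s. csum (\<lambda>i. ennreal (\<mu> i) * (gcoef \<alpha> f i)\<^sup>2 * indicator {0<..<W i} s) \<partial>lborel)"
      by (rule nn_integral_csum[symmetric]) measurable
    also have "\<dots> \<le> (\<integral>\<^sup>+s. ennreal C * (\<integral>\<^sup>+z. (ennreal (cmod (f z)))\<^sup>2 * indicator {0<..<A * w z} s \<partial>lebesgue) \<partial>lborel)"
    proof (rule nn_integral_mono)
      fix s :: real
      show "csum (\<lambda>i. ennreal (\<mu> i) * (gcoef \<alpha> f i)\<^sup>2 * indicator {0<..<W i} s)
          \<le> ennreal C * (\<integral>\<^sup>+z. (ennreal (cmod (f z)))\<^sup>2 * indicator {0<..<A * w z} s \<partial>lebesgue)"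
      proof (cases "0 < s")
        case True
        have "csum (\<lambda>i. ennreal (\<mu> i) * (gcoef \<alpha> f i)\<^sup>2 * indicator {0<..<W i} s)
            \<le> csum (\<lambda>i. emeasure lebesgue (gball i) * (gcoef \<alpha> (fs s) i)\<^sup>2)"
          by (rule nn_integral_mono) (auto simp: mu gc split: split_indicator)
        also have "\<dots> \<le> ennreal C * (\<integral>\<^sup>+z. (ennreal (cmod (fs s z)))\<^sup>2 \<partial>lebesgue)"
          by (rule L2[OF fs_loc])
        also have "(\<integral>\<^sup>+z. (ennreal (cmod (fs s z)))\<^sup>2 \<partial>lebesgue) = (\<integral>\<^sup>+z. (ennreal (cmod (f z)))\<^sup>2 * indicator {0<..<A * w z} s \<partial>lebesgue)"
          using True by (intro nn_integral_cong) (auto simp: fs_def split: split_indicator)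
        finally show ?thesis .
      qed simp
    qed
    also have "\<dots> \<le> ennreal C * (\<integral>\<^sup>+s. (\<integral>\<^sup>+z. (ennreal (cmod (f z)))\<^sup>2 * indicator {0<..<A * w z} s \<partial>lebesgue) \<partial>lborel)"
    proof -
      interpret sigma_finite_measure "lebesgue :: (real ^ 'n) measure" by (rule sigma_finite_lebesgue)
      have m: "(\<lambda>(s, z). (ennreal (cmod (f z)))\<^sup>2 * indicator {0<..<A * w z} s) \<in> borel_measurable (lborel \<Otimes>\<^sub>M lebesgue)"
      proof -
        have "(\<lambda>(s, z). (ennreal (cmod (f z)))\<^sup>2 * (if 0 < s \<and> s < A * w z then 1 else 0)) \<in> borel_measurable (lborel \<Otimes>\<^sub>M lebesgue)"
          by measurable
        also have "(\<lambda>(s, z). (ennreal (cmod (f z)))\<^sup>2 * (if 0 < s \<and> s < A * w z then 1 else 0))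
            = (\<lambda>(s, z). (ennreal (cmod (f z)))\<^sup>2 * indicator {0<..<A * w z} s)"
          by (auto simp: fun_eq_iff split: split_indicator)
        finally show ?thesis .
      qed
      show ?thesis
        using borel_measurable_nn_integral[OF m] by (subst nn_integral_cmult) auto
    qed
    also have "\<dots> = ennreal (C * A) * (\<integral>\<^sup>+z. (ennreal (cmod (f z)))\<^sup>2 * ennreal (w z) \<partial>lebesgue)"
      using C A_pos by (subst nn_integral_layers) (auto simp: ennreal_mult mult.assoc)
    finally show ?thesis .
  qed
  then show ?thesis using C A_pos by (intro exI[of _ "C * A"]) auto
qed

end

section \<open>Dyadic cubes\<close>

text \<open>Described through \<open>cell\<close>: the cubes of one scale are the fibres of a
  function, hence disjoint and covering, and nesting between scales becomes integer
  division.\<close>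

definition dcube :: "int \<times> (int ^ 'n) \<Rightarrow> (real ^ 'n) set" where
  "dcube i = {x. cell (fst i) x = snd i}"

lemma mem_dcube_cell: "x \<in> dcube (k, cell k x)"
  by (simp add: dcube_def)

lemma mem_dcube_iff: "x \<in> dcube i \<longleftrightarrow> i = (fst i, cell (fst i) x)"
  by (cases i) (auto simp: dcube_def)

lemma norm_dcube_le:
  fixes x :: "real ^ 'n"
  assumes "x \<in> dcube i"
  shows "norm (x - gcentre i) \<le> real CARD('n) * dyad (fst i)"
  using assms dist_gcentre_cell[of x "fst i"] by (metis mem_dcube_iff)

lemma dcube_subset_gball: "dcube i \<subseteq> gball i"
proof
  fix x assume "x \<in> dcube i"
  then have "norm (x - gcentre i) \<le> real CARD('a) * dyad (fst i)" by (rule norm_dcube_le)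
  also have "\<dots> < gradius i" by (simp add: gradius_def)
  finally show "x \<in> gball i" by (simp add: gball_def dist_norm norm_minus_commute)
qed

lemma dcube_eq: "dcube i = (\<Inter>j. {x. dyad (fst i) * of_int (snd i $ j) \<le> x $ j \<and> x $ j < dyad (fst i) * (of_int (snd i $ j) + 1)})"
  unfolding dcube_def cell_def
  by (auto simp: vec_eq_iff floor_eq_iff pos_le_divide_eq pos_divide_less_eq mult.commute)

lemma dcube_sets_borel: "dcube i \<in> sets borel"
proof -
  have "(\<lambda>x. x $ j) \<in> borel_measurable borel" for j :: 'a
    by (intro borel_measurable_continuous_onI continuous_intros)
  then have "{x \<in> space borel. dyad (fst i) * of_int (snd i $ j) \<le> x $ j \<and> x $ j < dyad (fst i) * (of_int (snd i $ j) + 1)} \<in> sets borel" for j :: 'a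
    by measurable
  then show ?thesis unfolding dcube_eq by (intro sets.finite_INT) auto
qed

lemma dcube_sets [measurable, simp]: "dcube i \<in> sets lebesgue"
  using dcube_sets_borel by (metis sets_completionI_sets sets_lborel)

text \<open>The side lengths differ by a power of 2 that is a positive integer, and taking the floor
  before dividing by a positive integer does not change the floor of the quotient.
  \<open>div\<close> rounds down for negative coordinates too.\<close>

lemma cell_coarser:
  assumes "k \<le> k'"
  shows "cell k' x = (\<chi> j. cell k x $ j div 2 ^ nat (k' - k))"
proof -
  have "\<lfloor>x $ j / dyad k'\<rfloor> = \<lfloor>x $ j / dyad k\<rfloor> div 2 ^ nat (k' - k)" for j
  proof -
    have "x $ j / dyad k' = (x $ j / dyad k) / real_of_int (2 ^ nat (k' - k))"
      using dyad_diff[OF assms] by simp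
    then show ?thesis by (simp only: floor_divide_real_eq_div zero_le_power zero_le_numeral)
  qed
  then show ?thesis by (simp add: cell_def vec_eq_iff)
qed

lemma cell_coarser_cong: "cell k x = cell k y \<Longrightarrow> k \<le> k' \<Longrightarrow> cell k' x = cell k' y"
  by (simp only: cell_coarser)

lemma emeasure_dcube_le:
  fixes i :: "int \<times> (int ^ 'n)"
  shows "emeasure lebesgue (dcube i) \<le> ennreal (unit_ball_vol (real CARD('n)) * gradius i ^ CARD('n))"
  unfolding emeasure_gball[symmetric] by (rule emeasure_mono[OF dcube_subset_gball]) simp

text \<open>The ball about the midpoint of the cube with half the side as radius is inscribed.
  Together with the enclosing \<open>gball\<close> this makes the volumes of cubes and balls
  comparable.\<close>

lemma emeasure_dcube_ge:
  fixes i :: "int \<times> (int ^ 'n)"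
  shows "ennreal (unit_ball_vol (real CARD('n)) * (dyad (fst i) / 2) ^ CARD('n)) \<le> emeasure lebesgue (dcube i)"
proof -
  define c where "c = gcentre i + (\<chi> j. dyad (fst i) / 2)"
  have "ball c (dyad (fst i) / 2) \<subseteq> dcube i"
  proof
    fix x assume x: "x \<in> ball c (dyad (fst i) / 2)"
    have "\<bar>x $ j - (dyad (fst i) * of_int (snd i $ j) + dyad (fst i) / 2)\<bar> < dyad (fst i) / 2" for j
    proof -
      have "\<bar>(x - c) $ j\<bar> \<le> norm (x - c)" by (rule component_le_norm_cart)
      also have "\<dots> < dyad (fst i) / 2" using x by (simp add: dist_norm norm_minus_commute)
      finally show ?thesis by (simp add: c_def gcentre_def)
    qed
    then have *: "dyad (fst i) * of_int (snd i $ j) \<le> x $ j \<and> x $ j < dyad (fst i) * (of_int (snd i $ j) + 1)" for j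
      unfolding abs_less_iff distrib_left by (smt (verit) field_sum_of_halves mult.right_neutral)
    then show "x \<in> dcube i" by (simp add: dcube_eq)
  qed
  then have "emeasure lebesgue (ball c (dyad (fst i) / 2)) \<le> emeasure lebesgue (dcube i)"
    by (rule emeasure_mono) simp
  then show ?thesis by (simp add: emeasure_ball)
qed

lemma emeasure_gball_le_dcube:
  fixes i :: "int \<times> (int ^ 'n)"
  shows "emeasure lebesgue (gball i) \<le> ennreal ((2 * (real CARD('n) + 2)) ^ CARD('n)) * emeasure lebesgue (dcube i)"
proof -
  have "emeasure lebesgue (gball i) = ennreal ((2 * (real CARD('n) + 2)) ^ CARD('n) * (unit_ball_vol (real CARD('n)) * (dyad (fst i) / 2) ^ CARD('n)))"
  proof -
    have "gradius i ^ CARD('n) = (2 * (real CARD('n) + 2)) ^ CARD('n) * (dyad (fst i) / 2) ^ CARD('n)"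
    proof -
      have "gradius i = 2 * (real CARD('n) + 2) * (dyad (fst i) / 2)" by (simp add: gradius_def field_simps)
      then show ?thesis by (simp only: power_mult_distrib)
    qed
    then show ?thesis unfolding emeasure_gball by (simp only: mult.left_commute)
  qed
  also have "\<dots> = ennreal ((2 * (real CARD('n) + 2)) ^ CARD('n)) * ennreal (unit_ball_vol (real CARD('n)) * (dyad (fst i) / 2) ^ CARD('n))"
    by (rule ennreal_mult) auto
  also have "\<dots> \<le> ennreal ((2 * (real CARD('n) + 2)) ^ CARD('n)) * emeasure lebesgue (dcube i)"
    by (intro mult_left_mono emeasure_dcube_ge) simp
  finally show ?thesis .
qed

text \<open>A cube is kept if none of the coarser cubes over its points belongs to \<open>Q\<close>;
  scales in \<open>Q\<close> are bounded above, so each point of the union has a coarsest cube. The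
  last conclusion is the one that later bounds averages over a selected cube through its
  parent.\<close>

lemma maximal_cubes:
  fixes Q :: "(int \<times> (int ^ 'n)) set"
  assumes K: "\<And>i. i \<in> Q \<Longrightarrow> fst i \<le> K"
  obtains P where "P \<subseteq> Q" and "\<And>i j. i \<in> P \<Longrightarrow> j \<in> P \<Longrightarrow> i \<noteq> j \<Longrightarrow> dcube i \<inter> dcube j = {}"
    and "(\<Union>i\<in>P. dcube i) = (\<Union>i\<in>Q. dcube i)"
    and "\<And>i x k. i \<in> P \<Longrightarrow> x \<in> dcube i \<Longrightarrow> fst i < k \<Longrightarrow> (k, cell k x) \<notin> Q"
proof
  define P where "P = {i \<in> Q. \<forall>x\<in>dcube i. \<forall>k>fst i. (k, cell k x) \<notin> Q}"
  show PQ: "P \<subseteq> Q" by (auto simp: P_def)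
  show max: "(k, cell k x) \<notin> Q" if "i \<in> P" "x \<in> dcube i" "fst i < k" for i x k
    using that by (auto simp: P_def)
  show "dcube i \<inter> dcube j = {}" if ij: "i \<in> P" "j \<in> P" "i \<noteq> j" for i j
  proof (rule ccontr)
    assume "dcube i \<inter> dcube j \<noteq> {}"
    then obtain x where x: "x \<in> dcube i" "x \<in> dcube j" by blast
    then have i: "i = (fst i, cell (fst i) x)" and j: "j = (fst j, cell (fst j) x)"
      using mem_dcube_iff by blast+
    have "\<not> fst i < fst j" using max[OF ij(1) x(1), of "fst j"] j ij(2) PQ by auto
    moreover have "\<not> fst j < fst i" using max[OF ij(2) x(2), of "fst i"] i ij(1) PQ by auto
    ultimately have "fst i = fst j" by simp
    then show False using i j ij(3) by metis
  qed
  show "(\<Union>i\<in>P. dcube i) = (\<Union>i\<in>Q. dcube i)"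
  proof
    show "(\<Union>i\<in>Q. dcube i) \<subseteq> (\<Union>i\<in>P. dcube i)"
    proof
      fix x assume "x \<in> (\<Union>i\<in>Q. dcube i)"
      then obtain i where "i \<in> Q" "x \<in> dcube i" by blast
      then have "(fst i, cell (fst i) x) \<in> Q" using mem_dcube_iff by metis
      \<comment> \<open>Minimising \<open>nat (K - k)\<close> picks the coarsest cube of
        \<open>Q\<close> over \<open>x\<close>.\<close>
      then obtain k where k: "(k, cell k x) \<in> Q" and least: "\<And>l. (l, cell l x) \<in> Q \<Longrightarrow> nat (K - k) \<le> nat (K - l)"
        using ex_has_least_nat[of "\<lambda>k. (k, cell k x) \<in> Q" "fst i" "\<lambda>k. nat (K - k)"] by blast
      have "(k, cell k x) \<in> P"
        unfolding P_def
      proof (intro CollectI conjI k ballI allI impI notI)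
        fix y l assume y: "y \<in> dcube (k, cell k x)" and l: "fst (k, cell k x) < l" and Q: "(l, cell l y) \<in> Q"
        have "cell l y = cell l x"
          by (rule cell_coarser_cong[of k]) (use y l in \<open>auto simp: dcube_def\<close>)
        then have "(l, cell l x) \<in> Q" using Q by simp
        from least[OF this] K[OF this] K[OF k] l show False by simp
      qed
      then show "x \<in> (\<Union>i\<in>P. dcube i)" using mem_dcube_cell by blast
    qed
  qed (use PQ in auto)
qed

section \<open>Dyadic averages and stopping cubes\<close>

lemma nn_integral_disjoint_csum:
  fixes D :: "'i::countable \<Rightarrow> 'a set"
  assumes f [measurable]: "f \<in> borel_measurable M" and D [measurable]: "\<And>i. D i \<in> sets M" and dis: "disjoint_family D"
  shows "(\<integral>\<^sup>+x\<in>(\<Union>i. D i). f x \<partial>M) = csum (\<lambda>i. \<integral>\<^sup>+x\<in>D i. f x \<partial>M)"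
proof -
  have ind: "indicator (\<Union>i. D i) x = csum (\<lambda>i. indicator (D i) x :: ennreal)" for x
  proof (cases "x \<in> (\<Union>i. D i)")
    case True
    then obtain i where i: "x \<in> D i" by blast
    then have "j \<noteq> i \<Longrightarrow> x \<notin> D j" for j using dis by (auto simp: disjoint_family_on_def)
    then have "csum (\<lambda>i. indicator (D i) x :: ennreal) = (\<Sum>i\<in>{i}. indicator (D i) x)"
      by (intro nn_integral_count_space') auto
    moreover have "indicator (\<Union>i. D i) x = (1::ennreal)" using True by (simp only: indicator_simps)
    ultimately show ?thesis using i by simp
  qed auto
  have "(\<integral>\<^sup>+x\<in>(\<Union>i. D i). f x \<partial>M) = (\<integral>\<^sup>+x. csum (\<lambda>i. f x * indicator (D i) x) \<partial>M)"
    unfolding ind by (simp add: nn_integral_cmult)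
  also have "\<dots> = csum (\<lambda>i. \<integral>\<^sup>+x\<in>D i. f x \<partial>M)" by (rule nn_integral_csum) measurable
  finally show ?thesis .
qed

lemma dcube_diameter:
  fixes x y :: "real ^ 'n"
  assumes "x \<in> dcube i" "y \<in> dcube i"
  shows "norm (x - y) \<le> 2 * real CARD('n) * dyad (fst i)"
  using norm_triangle_ineq4[of "x - gcentre i" "y - gcentre i"] norm_dcube_le[OF assms(1)] norm_dcube_le[OF assms(2)]
  by simp

lemma small_dcube_in_open:
  fixes x :: "real ^ 'n"
  assumes "open U" "x \<in> U"
  shows "\<exists>k\<le>0. dcube (k, cell k x) \<subseteq> U"
proof -
  obtain e where e: "0 < e" "ball x e \<subseteq> U" using assms open_contains_ball by blast
  obtain d where d: "(1/2::real) ^ d < e / (2 * real CARD('n))"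
    using real_arch_pow_inv[of "e / (2 * real CARD('n))" "1/2"] e by auto
  have dy: "dyad (- int d) = (1/2) ^ d" by (simp add: dyad_def power_int_minus power_one_over inverse_eq_divide)
  have "dcube (- int d, cell (- int d) x) \<subseteq> U"
  proof
    fix y assume "y \<in> dcube (- int d, cell (- int d) x)"
    then have "norm (x - y) \<le> 2 * real CARD('n) * (1/2) ^ d"
      using dcube_diameter[OF mem_dcube_cell, of y "- int d" x] by (simp add: dy)
    also have "\<dots> < e" using d by (simp add: field_simps)
    finally show "y \<in> U" using e by (auto simp: dist_norm)
  qed
  then show ?thesis by (intro exI[of _ "- int d"]) simp
qed

text \<open>Stands in for the Lebesgue differentiation theorem: cover the exceptional set by maximal cubes
  inside an open set of nearly the same measure.\<close>

lemma AE_le_of_cube_averages: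
  fixes F :: "real ^ 'n \<Rightarrow> ennreal" and c :: real
  assumes F [measurable]: "F \<in> borel_measurable lebesgue" and E [measurable]: "E \<in> sets lebesgue" and c: "0 \<le> c"
    and avg: "\<And>x k. x \<in> E \<Longrightarrow> k \<le> 0 \<Longrightarrow>
      (\<integral>\<^sup>+z\<in>dcube (k, cell k x). F z \<partial>lebesgue) \<le> ennreal c * emeasure lebesgue (dcube (k, cell k x))"
  shows "AE x in lebesgue. x \<in> E \<longrightarrow> F x \<le> ennreal c"
proof -
  \<comment> \<open>Cut down to a ball so that the measure is finite, and with a definite excess
    \<open>1 / (N + 1)\<close> of \<open>F\<close> over \<open>c\<close>, to be played off against
    the averages.\<close>
  define B where "B N = {x \<in> space lebesgue. x \<in> E \<and> x \<in> ball 0 (real N) \<and> ennreal (c + 1 / real (Suc N)) \<le> F x}" for N :: nat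
  have B [measurable]: "B N \<in> sets lebesgue" for N unfolding B_def by measurable
  have null: "emeasure lebesgue (B N) = 0" for N
  proof -
    define d where "d = 1 / real (Suc N)"
    have d: "0 < d" by (simp add: d_def)
    have "emeasure lebesgue (B N) \<le> emeasure lebesgue (ball (0::real^'n) (real N))"
      by (rule emeasure_mono) (auto simp: B_def)
    also have "\<dots> < top" by (simp add: emeasure_ball)
    finally obtain b where b: "emeasure lebesgue (B N) = ennreal b" "0 \<le> b" by (cases "emeasure lebesgue (B N)") auto
    \<comment> \<open>Cubes inside \<open>U\<close> that meet \<open>B N\<close> have averages at
      most \<open>c\<close>, while \<open>F\<close> is at least \<open>c + d\<close> on
      \<open>B N\<close>. Summing over the maximal ones gives
      \<open>(c + d) * b <= c * (b + e)\<close>, where \<open>e\<close> bounds the excess measure of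
      \<open>U\<close>.\<close>
    have H: "d * b \<le> c * e" if e: "0 < e" for e
    proof -
      obtain U where U: "open U" "B N \<subseteq> U" "U - B N \<in> lmeasurable" "emeasure lebesgue (U - B N) < ennreal e"
        using sets_lebesgue_outer_open[OF B e] by metis
      define Q where "Q = {i. fst i \<le> 0 \<and> dcube i \<subseteq> U \<and> dcube i \<inter> B N \<noteq> {}}"
      obtain P where P: "P \<subseteq> Q" "\<And>i j. i \<in> P \<Longrightarrow> j \<in> P \<Longrightarrow> i \<noteq> j \<Longrightarrow> dcube i \<inter> dcube j = {}"
        "(\<Union>i\<in>P. dcube i) = (\<Union>i\<in>Q. dcube i)"
        "\<And>i x k. i \<in> P \<Longrightarrow> x \<in> dcube i \<Longrightarrow> fst i < k \<Longrightarrow> (k, cell k x) \<notin> Q"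
      proof (rule maximal_cubes[of Q 0])
        show "fst i \<le> 0" if "i \<in> Q" for i using that by (simp add: Q_def)
      qed (rule that)
      define D where "D i = (if i \<in> P then dcube i else {})" for i
      have D [measurable]: "D i \<in> sets lebesgue" for i by (simp add: D_def)
      have dis: "disjoint_family D" using P(2) by (auto simp: disjoint_family_on_def D_def)
      have UD: "(\<Union>i. D i) = (\<Union>i\<in>Q. dcube i)" unfolding P(3)[symmetric] by (auto simp: D_def split: if_splits)
      have cov: "B N \<subseteq> (\<Union>i. D i)"
      proof
        fix x assume x: "x \<in> B N"
        then obtain k where k: "k \<le> 0" "dcube (k, cell k x) \<subseteq> U" using small_dcube_in_open[OF U(1)] U(2) by blast
        then have "(k, cell k x) \<in> Q" using x mem_dcube_cell[of x k] by (auto simp: Q_def)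
        then show "x \<in> (\<Union>i. D i)" unfolding UD using mem_dcube_cell[of x k] by blast
      qed
      have DU: "(\<Union>i. D i) \<subseteq> U" unfolding UD by (auto simp: Q_def)
      have DF: "(\<integral>\<^sup>+z\<in>D i. F z \<partial>lebesgue) \<le> ennreal c * (\<integral>\<^sup>+z\<in>D i. 1 \<partial>lebesgue)" for i
      proof (cases "i \<in> P")
        case True
        then obtain x where x: "x \<in> dcube i" "x \<in> B N" "fst i \<le> 0" using P(1) by (auto simp: Q_def)
        then have "i = (fst i, cell (fst i) x)" using mem_dcube_iff by blast
        moreover have "x \<in> E" using x by (auto simp: B_def)
        ultimately show ?thesis using avg[of x "fst i"] x(3) True by (simp add: D_def)
      qed (simp add: D_def)
      have "ennreal (c + d) * emeasure lebesgue (B N) = (\<integral>\<^sup>+x. ennreal (c + d) * indicator (B N) x \<partial>lebesgue)"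
        by (simp add: nn_integral_cmult_indicator)
      also have "\<dots> \<le> (\<integral>\<^sup>+x\<in>(\<Union>i. D i). F x \<partial>lebesgue)"
        using cov by (intro nn_integral_mono) (auto simp: B_def d_def split: split_indicator)
      also have "\<dots> = csum (\<lambda>i. \<integral>\<^sup>+x\<in>D i. F x \<partial>lebesgue)"
        by (rule nn_integral_disjoint_csum[OF F D dis])
      also have "\<dots> \<le> csum (\<lambda>i. ennreal c * (\<integral>\<^sup>+z\<in>D i. 1 \<partial>lebesgue))"
        by (rule nn_integral_mono) (rule DF)
      also have "\<dots> = ennreal c * (\<integral>\<^sup>+x\<in>(\<Union>i. D i). 1 \<partial>lebesgue)"
        by (subst nn_integral_disjoint_csum[OF _ D dis]) (auto intro: nn_integral_cmult)
      also have "\<dots> = ennreal c * emeasure lebesgue (\<Union>i. D i)"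
        by (subst nn_integral_cmult_indicator) (auto intro!: sets.countable_UN)
      also have "\<dots> \<le> ennreal c * emeasure lebesgue (B N \<union> (U - B N))"
        using DU by (intro mult_left_mono emeasure_mono sets.Un B fmeasurableD[OF U(3)]) auto
      also have "\<dots> \<le> ennreal c * (ennreal b + ennreal e)"
        using U(4) b by (intro mult_left_mono order_trans[OF emeasure_subadditive[OF B fmeasurableD[OF U(3)]]] add_mono) auto
      also have "\<dots> = ennreal (c * (b + e))"
        using c b e by (simp add: ennreal_mult flip: ennreal_plus)
      finally have "ennreal (c + d) * ennreal b \<le> ennreal (c * (b + e))" unfolding b(1) .
      moreover have "ennreal (c + d) * ennreal b = ennreal ((c + d) * b)"
        by (rule ennreal_mult[symmetric]) (use b c d in auto)
      ultimately have "(c + d) * b \<le> c * (b + e)"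
        using b c e by (metis ennreal_le_iff mult_nonneg_nonneg add_nonneg_nonneg less_imp_le)
      then show ?thesis by (simp add: algebra_simps)
    qed
    have "d * b \<le> 0"
    proof (rule field_le_epsilon)
      fix e :: real assume "0 < e"
      \<comment> \<open>Dividing by \<open>c + 1\<close> rather than by \<open>c\<close> covers the
        case \<open>c = 0\<close>.\<close>
      have "d * b \<le> c * (e / (c + 1))" using H[of "e / (c + 1)"] \<open>0 < e\<close> c by simp
      also have "\<dots> \<le> e" using c \<open>0 < e\<close> by (simp add: field_simps)
      finally show "d * b \<le> 0 + e" by simp
    qed
    then have "b = 0" using b d by (simp add: mult_le_0_iff)
    then show ?thesis using b by simp
  qed
  have "AE x in lebesgue. \<forall>N. x \<notin> B N"
    using null B by (subst AE_all_countable) (auto intro!: AE_not_in null_setsI)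
  then show ?thesis
  proof eventually_elim
    case (elim x)
    show ?case
    proof (rule impI, rule ccontr)
      assume x: "x \<in> E" and "\<not> F x \<le> ennreal c"
      then have "ennreal c < F x" by simp
      then obtain y where y: "ennreal c < y" "y < F x" using dense by blast
      then obtain y' where y': "y = ennreal y'" "0 \<le> y'" by (cases y) auto
      then have "c < y'" using y c by (simp add: ennreal_less_iff)
      obtain M where M: "1 / real (Suc M) < y' - c"
        using reals_Archimedean[of "y' - c"] \<open>c < y'\<close> by (auto simp: inverse_eq_divide)
      obtain M' where M': "norm x < real M'" using reals_Archimedean2[of "norm x"] by blast
      define N where "N = max M M'"
      have "1 / real (Suc N) \<le> 1 / real (Suc M)" by (intro divide_left_mono) (auto simp: N_def)
      then have "ennreal (c + 1 / real (Suc N)) \<le> y" unfolding y' using M by (intro ennreal_leI) simp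
      moreover have "norm x < real N" using M' by (simp add: N_def)
      ultimately have "x \<in> B N" using x y by (auto simp: B_def)
      then show False using elim by blast
    qed
  qed
qed

text \<open>Stopping cubes: the coarsest cubes on which the mean of \<open>F\<close> exceeds
  \<open>l\<close>. Integrability of \<open>F\<close> bounds their size, failure of the condition on
  the parent bounds the mean from above, and off the cubes all dyadic means are at most
  \<open>l\<close>.\<close>

theorem calderon_zygmund_cubes:
  fixes F :: "real ^ 'n \<Rightarrow> ennreal" and l :: real
  assumes F [measurable]: "F \<in> borel_measurable lebesgue" and fin: "(\<integral>\<^sup>+z. F z \<partial>lebesgue) < top" and l: "0 < l"
  obtains P :: "(int \<times> (int ^ 'n)) set"
  where "\<And>i j. i \<in> P \<Longrightarrow> j \<in> P \<Longrightarrow> i \<noteq> j \<Longrightarrow> dcube i \<inter> dcube j = {}"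
    and "\<And>i. i \<in> P \<Longrightarrow> ennreal l * emeasure lebesgue (dcube i) \<le> (\<integral>\<^sup>+z\<in>dcube i. F z \<partial>lebesgue)"
    and "\<And>i. i \<in> P \<Longrightarrow> (\<integral>\<^sup>+z\<in>dcube i. F z \<partial>lebesgue)
        \<le> ennreal (l * (4 * (real CARD('n) + 2)) ^ CARD('n)) * emeasure lebesgue (dcube i)"
    and "AE x in lebesgue. x \<notin> (\<Union>i\<in>P. dcube i) \<longrightarrow> F x \<le> ennreal l"
proof -
  let ?n = "CARD('n)" let ?V = "unit_ball_vol (real CARD('n))"
  define Q where "Q = {i::int \<times> (int ^ 'n). ennreal l * emeasure lebesgue (dcube i) < (\<integral>\<^sup>+z\<in>dcube i. F z \<partial>lebesgue)}"
  obtain I where I: "(\<integral>\<^sup>+z. F z \<partial>lebesgue) = ennreal I" "0 \<le> I" using fin by (cases "\<integral>\<^sup>+z. F z \<partial>lebesgue") auto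
  \<comment> \<open>At scales above \<open>K\<close> a cube is so large that a mean exceeding
    \<open>l\<close> would require more mass than \<open>I\<close>.\<close>
  obtain K :: nat where K: "I / (l * ?V) * 2 ^ ?n < 2 ^ K"
    using real_arch_pow[of 2 "I / (l * ?V) * 2 ^ ?n"] by auto
  have bd: "fst i \<le> int K" if "i \<in> Q" for i
  proof (rule ccontr)
    assume "\<not> fst i \<le> int K"
    then have "dyad (int K) \<le> dyad (fst i)" by (intro dyad_mono) simp
    then have k: "2 ^ K \<le> dyad (fst i)" by (simp add: dyad_nat)
    have "(1::real) \<le> 2 ^ K" by simp
    then have "1 \<le> dyad (fst i)" using k by linarith
    then have "dyad (fst i) ^ 1 \<le> dyad (fst i) ^ ?n" by (intro power_increasing) (auto simp: Suc_leI)
    then have s: "2 ^ K \<le> dyad (fst i) ^ ?n" using k by simp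
    have "ennreal (l * (?V * (dyad (fst i) / 2) ^ ?n)) = ennreal l * ennreal (?V * (dyad (fst i) / 2) ^ ?n)"
      using l by (intro ennreal_mult) auto
    also have "\<dots> \<le> ennreal l * emeasure lebesgue (dcube i)" by (intro mult_left_mono emeasure_dcube_ge) simp
    also have "\<dots> \<le> (\<integral>\<^sup>+z\<in>dcube i. F z \<partial>lebesgue)" using that by (simp add: Q_def)
    also have "\<dots> \<le> (\<integral>\<^sup>+z. F z \<partial>lebesgue)" by (rule nn_integral_mono) (auto split: split_indicator)
    finally have "l * (?V * (dyad (fst i) / 2) ^ ?n) \<le> I" using I by simp
    then have "dyad (fst i) ^ ?n \<le> I / (l * ?V) * 2 ^ ?n"
      using l by (simp add: power_divide field_simps)
    then show False using s K by linarith
  qed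
  obtain P where P: "P \<subseteq> Q" "\<And>i j. i \<in> P \<Longrightarrow> j \<in> P \<Longrightarrow> i \<noteq> j \<Longrightarrow> dcube i \<inter> dcube j = {}"
    "(\<Union>i\<in>P. dcube i) = (\<Union>i\<in>Q. dcube i)"
    "\<And>i x k. i \<in> P \<Longrightarrow> x \<in> dcube i \<Longrightarrow> fst i < k \<Longrightarrow> (k, cell k x) \<notin> Q"
    using maximal_cubes[of Q "int K"] bd by metis
  show ?thesis
  proof (rule that[OF P(2)])
    fix i assume i: "i \<in> P"
    show "ennreal l * emeasure lebesgue (dcube i) \<le> (\<integral>\<^sup>+z\<in>dcube i. F z \<partial>lebesgue)"
      using i P(1) by (auto simp: Q_def)
    have "dcube i \<noteq> {}"
    proof
      assume "dcube i = {}"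
      then have "i \<notin> Q" by (simp add: Q_def)
      then show False using i P(1) by blast
    qed
    then obtain x where x: "x \<in> dcube i" by blast
    \<comment> \<open>The parent cube. The volume of the ball enclosing it, compared with that of
      the ball inscribed in cube \<open>i\<close>, gives the factor
      \<open>(4 * (n + 2)) ^ n\<close>.\<close>
    define j where "j = (fst i + 1, cell (fst i + 1) x)"
    have ij: "dcube i \<subseteq> dcube j"
    proof
      fix y assume "y \<in> dcube i"
      then have "cell (fst i) y = cell (fst i) x" using x by (simp add: dcube_def)
      then have "cell (fst i + 1) y = cell (fst i + 1) x" by (rule cell_coarser_cong) simp
      then show "y \<in> dcube j" by (simp add: j_def dcube_def)
    qed
    have "j \<notin> Q" unfolding j_def by (rule P(4)[OF i x]) simp
    have "dyad (fst i + 1) = 2 * dyad (fst i)" using dyad_add[of "fst i" 1] dyad_nat[of 1] by simp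
    then have gr: "gradius j = 4 * (real CARD('n) + 2) * (dyad (fst i) / 2)" by (simp add: gradius_def j_def)
    have "(\<integral>\<^sup>+z\<in>dcube i. F z \<partial>lebesgue) \<le> (\<integral>\<^sup>+z\<in>dcube j. F z \<partial>lebesgue)"
      using ij by (intro nn_integral_mono) (auto split: split_indicator)
    also have "\<dots> \<le> ennreal l * emeasure lebesgue (dcube j)" using \<open>j \<notin> Q\<close> by (simp add: Q_def)
    also have "\<dots> \<le> ennreal l * ennreal (?V * gradius j ^ ?n)"
      by (intro mult_left_mono emeasure_dcube_le) simp
    also have "\<dots> = ennreal (l * (4 * (real CARD('n) + 2)) ^ ?n) * ennreal (?V * (dyad (fst i) / 2) ^ ?n)"
      using l unfolding gr power_mult_distrib[of "4 * (real CARD('n) + 2)"]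
      by (simp add: ennreal_mult[symmetric] mult_ac)
    also have "\<dots> \<le> ennreal (l * (4 * (real CARD('n) + 2)) ^ ?n) * emeasure lebesgue (dcube i)"
      by (intro mult_left_mono emeasure_dcube_ge) simp
    finally show "(\<integral>\<^sup>+z\<in>dcube i. F z \<partial>lebesgue) \<le> \<dots>" .
  next
    have "AE x in lebesgue. x \<in> - (\<Union>i\<in>P. dcube i) \<longrightarrow> F x \<le> ennreal l"
    proof (rule AE_le_of_cube_averages[OF F])
      have "(\<Union>i\<in>P. dcube i) \<in> sets lebesgue" by (rule sets.countable_UN') auto
      then show "- (\<Union>i\<in>P. dcube i) \<in> sets lebesgue" by (simp only: Compl_in_sets_lebesgue)
      fix x k assume "x \<in> - (\<Union>i\<in>P. dcube i)"
      then have "(k, cell k x) \<notin> Q" unfolding P(3) using mem_dcube_cell[of x k] by blast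
      then show "(\<integral>\<^sup>+z\<in>dcube (k, cell k x). F z \<partial>lebesgue) \<le> ennreal l * emeasure lebesgue (dcube (k, cell k x))"
        by (simp add: Q_def)
    qed (use l in simp)
    then show "AE x in lebesgue. x \<notin> (\<Union>i\<in>P. dcube i) \<longrightarrow> F x \<le> ennreal l" by simp
  qed
qed

section \<open>Calderon-Zygmund decomposition\<close>

text \<open>Extended by the empty set to all indices, so that sums over the cubes are
  \<open>csum\<close> over one fixed countable type.\<close>

definition cubes_of :: "(int \<times> (int ^ 'n)) set \<Rightarrow> int \<times> (int ^ 'n) \<Rightarrow> (real ^ 'n) set" where
  "cubes_of P p = (if p \<in> P then dcube p else {})"

text \<open>The cubes are a parameter because one family, found from the \<open>l^2\<close> norm of
  the sequence, serves all components. Once the cubes are disjoint, \<open>SOME\<close> selects the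
  only cube over \<open>x\<close>.\<close>

definition cz_good :: "(int \<times> (int ^ 'n)) set \<Rightarrow> (real ^ 'n \<Rightarrow> complex) \<Rightarrow> real ^ 'n \<Rightarrow> complex" where
  "cz_good P f x = (if \<exists>p\<in>P. x \<in> dcube p
     then (let p = (SOME p. p \<in> P \<and> x \<in> dcube p) in
       (LINT z:dcube p|lebesgue. f z) /\<^sub>R measure lebesgue (dcube p))
     else f x)"

text \<open>The factor in \<open>kernel_osc\<close> for a kernel of box \<open>i\<close> against a
  mean-zero function on the cube \<open>p\<close>, doubled because the bad part on a cube has at
  most twice the mass that \<open>f\<close> has there.\<close>

definition osc_coef :: "real \<Rightarrow> int \<times> (int ^ 'n) \<Rightarrow> int \<times> (int ^ 'n) \<Rightarrow> real" where
  "osc_coef \<alpha> i p = (if dcube p \<inter> gball i = {} then 0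
     else 2 * (1 / gradius i ^ CARD('n) * (gradius p / gradius i) powr \<alpha>))"

lemma osc_coef_nonneg [simp]: "0 \<le> osc_coef \<alpha> i p"
  by (simp add: osc_coef_def)

lemma cubes_of_sets [measurable, simp]: "cubes_of P p \<in> sets lebesgue"
  by (simp add: cubes_of_def)

lemma cubes_of_Union: "(\<Union>p. cubes_of P p) = (\<Union>p\<in>P. dcube p)"
  by (auto simp: cubes_of_def split: if_splits)

lemma measure_dcube:
  "emeasure lebesgue (dcube p) = ennreal (measure lebesgue (dcube p))" and measure_dcube_pos: "0 < measure lebesgue (dcube p)"
proof -
  have "emeasure lebesgue (dcube p) < top" using emeasure_dcube_le[of p] by (rule order_le_less_trans) simp
  then show eq: "emeasure lebesgue (dcube p) = ennreal (measure lebesgue (dcube p))"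
    by (intro emeasure_eq_ennreal_measure) simp
  have "0 < ennreal (unit_ball_vol (real CARD('a)) * (dyad (fst p) / 2) ^ CARD('a))" by simp
  also have "\<dots> \<le> emeasure lebesgue (dcube p)" by (rule emeasure_dcube_ge)
  finally show "0 < measure lebesgue (dcube p)" unfolding eq by simp
qed

section \<open>Good and bad parts of a function\<close>

locale disjoint_cubes =
  fixes P :: "(int \<times> (int ^ 'n)) set"
  assumes dis: "\<And>i j. i \<in> P \<Longrightarrow> j \<in> P \<Longrightarrow> i \<noteq> j \<Longrightarrow> dcube i \<inter> dcube j = {}"
begin

lemma disjoint_family_cubes: "disjoint_family (cubes_of P)"
  using dis by (auto simp: disjoint_family_on_def cubes_of_def)

lemma cz_good_in:
  assumes "x \<in> cubes_of P p"
  shows "cz_good P f x = (LINT z:dcube p|lebesgue. f z) /\<^sub>R measure lebesgue (dcube p)"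
proof -
  have p: "p \<in> P" "x \<in> dcube p" using assms by (auto simp: cubes_of_def split: if_splits)
  have "(SOME p. p \<in> P \<and> x \<in> dcube p) = p"
  proof (rule some_equality)
    fix q assume "q \<in> P \<and> x \<in> dcube q"
    then show "q = p" using dis[of q p] p by blast
  qed (use p in simp)
  then show ?thesis using p by (auto simp: cz_good_def)
qed

lemma cz_good_out: "x \<notin> (\<Union>p. cubes_of P p) \<Longrightarrow> cz_good P f x = f x"
  by (auto simp: cz_good_def cubes_of_Union)

lemma Union_cubes_sets [measurable, simp]: "(\<Union>p. cubes_of P p) \<in> sets lebesgue"
  by (intro sets.countable_UN) auto

lemma cz_good_borel:
  assumes f: "f \<in> borel_measurable lebesgue"
  shows "cz_good P f \<in> borel_measurable lebesgue"
proof (rule measurable_piecewise_restrict[where C="insert (- (\<Union>p. cubes_of P p)) (range (cubes_of P))"])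
  fix \<Omega> assume "\<Omega> \<in> insert (- (\<Union>p. cubes_of P p)) (range (cubes_of P))"
  then consider "\<Omega> = - (\<Union>p. cubes_of P p)" | p where "\<Omega> = cubes_of P p" by blast
  then show "cz_good P f \<in> borel_measurable (restrict_space lebesgue \<Omega>)"
  proof cases
    case 1
    have "f \<in> borel_measurable (restrict_space lebesgue \<Omega>)" by (rule measurable_restrict_space1[OF f])
    then show ?thesis
      by (rule measurable_cong[THEN iffD1, rotated]) (use 1 in \<open>auto simp: space_restrict_space cz_good_out\<close>)
  next
    case (2 p)
    have "(\<lambda>_. (LINT z:dcube p|lebesgue. f z) /\<^sub>R measure lebesgue (dcube p)) \<in> borel_measurable (restrict_space lebesgue \<Omega>)"
      by simp
    then show ?thesis
      by (rule measurable_cong[THEN iffD1, rotated]) (use 2 in \<open>auto simp: space_restrict_space cz_good_in\<close>)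
  qed
  from \<open>\<Omega> \<in> _\<close> show "\<Omega> \<inter> space lebesgue \<in> sets lebesgue"
    using Union_cubes_sets by (auto simp: Compl_in_sets_lebesgue)
qed auto

lemma cz_good_norm_le:
  assumes f: "f \<in> borel_measurable lebesgue" and x: "x \<in> cubes_of P p"
  shows "ennreal (cmod (cz_good P f x)) * emeasure lebesgue (dcube p) \<le> (\<integral>\<^sup>+z\<in>dcube p. ennreal (cmod (f z)) \<partial>lebesgue)"
proof -
  let ?m = "measure lebesgue (dcube p)"
  have m: "0 < ?m" by (rule measure_dcube_pos)
  have "ennreal (cmod (cz_good P f x)) * emeasure lebesgue (dcube p) = ennreal (cmod (LINT z:dcube p|lebesgue. f z))"
    unfolding cz_good_in[OF x] measure_dcube using m by (subst ennreal_mult[symmetric]) auto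
  also have "\<dots> \<le> (\<integral>\<^sup>+z. ennreal (cmod (indicator (dcube p) z *\<^sub>R f z)) \<partial>lebesgue)"
    unfolding set_lebesgue_integral_def by (rule ennreal_norm_integral_le)
  also have "\<dots> = (\<integral>\<^sup>+z\<in>dcube p. ennreal (cmod (f z)) \<partial>lebesgue)"
    by (rule nn_integral_cong) (auto split: split_indicator)
  finally show ?thesis .
qed

lemma nn_integral_split_cubes:
  assumes [measurable]: "h \<in> borel_measurable lebesgue"
  shows "(\<integral>\<^sup>+z. h z \<partial>lebesgue) = csum (\<lambda>p. \<integral>\<^sup>+z\<in>cubes_of P p. h z \<partial>lebesgue) + (\<integral>\<^sup>+z\<in>- (\<Union>p. cubes_of P p). h z \<partial>lebesgue)"
proof -
  have c: "- (\<Union>p. cubes_of P p) \<in> sets lebesgue" using Union_cubes_sets by (simp only: Compl_in_sets_lebesgue)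
  have "(\<integral>\<^sup>+z. h z \<partial>lebesgue) = (\<integral>\<^sup>+z\<in>(\<Union>p. cubes_of P p) \<union> - (\<Union>p. cubes_of P p). h z \<partial>lebesgue)"
    by (simp only: Compl_partition indicator_UNIV mult_1_right)
  also have "\<dots> = (\<integral>\<^sup>+z\<in>(\<Union>p. cubes_of P p). h z \<partial>lebesgue) + (\<integral>\<^sup>+z\<in>- (\<Union>p. cubes_of P p). h z \<partial>lebesgue)"
    by (rule nn_integral_disjoint_pair[OF _ Union_cubes_sets c]) auto
  also have "(\<integral>\<^sup>+z\<in>(\<Union>p. cubes_of P p). h z \<partial>lebesgue) = csum (\<lambda>p. \<integral>\<^sup>+z\<in>cubes_of P p. h z \<partial>lebesgue)"
    by (rule nn_integral_disjoint_csum[OF _ _ disjoint_family_cubes]) auto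
  finally show ?thesis .
qed

lemma cz_good_cube_L1_le:
  assumes f: "f \<in> borel_measurable lebesgue"
  shows "(\<integral>\<^sup>+z\<in>cubes_of P p. ennreal (cmod (cz_good P f z)) \<partial>lebesgue) \<le> (\<integral>\<^sup>+z\<in>cubes_of P p. ennreal (cmod (f z)) \<partial>lebesgue)"
proof (cases "cubes_of P p = {}")
  case False
  then obtain x where x: "x \<in> cubes_of P p" by blast
  then have D: "cubes_of P p = dcube p" by (auto simp: cubes_of_def split: if_splits)
  have "(\<integral>\<^sup>+z\<in>cubes_of P p. ennreal (cmod (cz_good P f z)) \<partial>lebesgue)
      = (\<integral>\<^sup>+z. ennreal (cmod (cz_good P f x)) * indicator (dcube p) z \<partial>lebesgue)"
    by (rule nn_integral_cong) (auto simp: cz_good_in[OF x] cz_good_in D[symmetric] split: split_indicator)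
  also have "\<dots> = ennreal (cmod (cz_good P f x)) * emeasure lebesgue (dcube p)"
    by (rule nn_integral_cmult_indicator) simp
  also have "\<dots> \<le> (\<integral>\<^sup>+z\<in>cubes_of P p. ennreal (cmod (f z)) \<partial>lebesgue)"
    unfolding D by (rule cz_good_norm_le[OF f x])
  finally show ?thesis .
qed simp

lemma cz_good_integrable:
  assumes f: "integrable lebesgue f"
  shows "integrable lebesgue (cz_good P f)"
proof (rule integrableI_bounded)
  have [measurable]: "f \<in> borel_measurable lebesgue" using f by simp
  show [measurable]: "cz_good P f \<in> borel_measurable lebesgue" by (rule cz_good_borel) simp
  have "(\<integral>\<^sup>+z. ennreal (cmod (cz_good P f z)) \<partial>lebesgue) \<le> (\<integral>\<^sup>+z. ennreal (cmod (f z)) \<partial>lebesgue)"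
  proof -
    have "(\<integral>\<^sup>+z. ennreal (cmod (cz_good P f z)) \<partial>lebesgue) = csum (\<lambda>p. \<integral>\<^sup>+z\<in>cubes_of P p. ennreal (cmod (cz_good P f z)) \<partial>lebesgue)
        + (\<integral>\<^sup>+z\<in>- (\<Union>p. cubes_of P p). ennreal (cmod (cz_good P f z)) \<partial>lebesgue)"
      by (rule nn_integral_split_cubes) measurable
    also have "\<dots> \<le> csum (\<lambda>p. \<integral>\<^sup>+z\<in>cubes_of P p. ennreal (cmod (f z)) \<partial>lebesgue)
        + (\<integral>\<^sup>+z\<in>- (\<Union>p. cubes_of P p). ennreal (cmod (f z)) \<partial>lebesgue)"
    proof (rule add_mono; rule nn_integral_mono)
      fix p show "(\<integral>\<^sup>+z\<in>cubes_of P p. ennreal (cmod (cz_good P f z)) \<partial>lebesgue) \<le> (\<integral>\<^sup>+z\<in>cubes_of P p. ennreal (cmod (f z)) \<partial>lebesgue)"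
        by (rule cz_good_cube_L1_le) simp
    next
      fix z show "ennreal (cmod (cz_good P f z)) * indicator (- (\<Union>p. cubes_of P p)) z \<le> ennreal (cmod (f z)) * indicator (- (\<Union>p. cubes_of P p)) z"
        using cz_good_out[of z f] by (auto split: split_indicator)
    qed
    also have "\<dots> = (\<integral>\<^sup>+z. ennreal (cmod (f z)) \<partial>lebesgue)"
      by (rule nn_integral_split_cubes[symmetric]) measurable
    finally show "(\<integral>\<^sup>+z. ennreal (cmod (cz_good P f z)) \<partial>lebesgue) \<le> (\<integral>\<^sup>+z. ennreal (cmod (f z)) \<partial>lebesgue)" .
  qed
  also have "\<dots> < \<infinity>" using f by (simp add: integrable_iff_bounded)
  finally show "(\<integral>\<^sup>+z. ennreal (cmod (cz_good P f z)) \<partial>lebesgue) < \<infinity>" .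
qed

text \<open>On each cube \<open>cz_good\<close> is the mean of \<open>f\<close>, so the bad part has
  mean zero there and the oscillation bound applies; on a cube that misses \<open>gball i\<close>
  the kernel vanishes.\<close>

lemma bad_cube_integral_le:
  assumes v: "v \<in> kernels \<alpha> (gcentre i) (gradius i)" and a: "0 < \<alpha>" "\<alpha> \<le> 1" and f: "integrable lebesgue f"
  shows "ennreal (cmod (LINT z:cubes_of P p|lebesgue. v z *\<^sub>R (f z - cz_good P f z)))
    \<le> ennreal (osc_coef \<alpha> i p) * (\<integral>\<^sup>+z\<in>cubes_of P p. ennreal (cmod (f z)) \<partial>lebesgue)"
proof -
  have [measurable]: "f \<in> borel_measurable lebesgue" using f by simp
  have [measurable]: "cz_good P f \<in> borel_measurable lebesgue" by (rule cz_good_borel) simp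
  define b where "b z = indicator (cubes_of P p) z *\<^sub>R (f z - cz_good P f z)" for z
  have eq: "(LINT z:cubes_of P p|lebesgue. v z *\<^sub>R (f z - cz_good P f z)) = (LINT z|lebesgue. v z *\<^sub>R b z)"
    unfolding set_lebesgue_integral_def b_def by (rule Bochner_Integration.integral_cong) (auto simp: mult.commute)
  consider "cubes_of P p = {}" | "cubes_of P p \<noteq> {}" "dcube p \<inter> gball i = {}" | "cubes_of P p \<noteq> {}" "dcube p \<inter> gball i \<noteq> {}"
    by blast
  then show ?thesis
  proof cases
    case 1
    then show ?thesis by (simp add: set_lebesgue_integral_def)
  next
    case 2
    have "(\<lambda>z. v z *\<^sub>R b z) = (\<lambda>_. 0)"
    proof
      fix z
      show "v z *\<^sub>R b z = 0"
      proof (cases "z \<in> gball i")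
        case True
        then have "z \<notin> cubes_of P p" using 2 by (auto simp: cubes_of_def)
        then show ?thesis by (simp add: b_def)
      next
        case False
        then have "v z = 0" using v by (auto simp: kernels_def gball_def)
        then show ?thesis by simp
      qed
    qed
    then show ?thesis unfolding eq by simp
  next
    case 3
    then obtain x where x: "x \<in> cubes_of P p" by blast
    then have D: "cubes_of P p = dcube p" by (auto simp: cubes_of_def split: if_splits)
    let ?m = "measure lebesgue (dcube p)"
    have m: "0 < ?m" by (rule measure_dcube_pos)
    have fi: "set_integrable lebesgue (dcube p) f"
      unfolding set_integrable_def using f by (intro integrable_mult_indicator) auto
    have gi: "set_integrable lebesgue (dcube p) (cz_good P f)"
      unfolding set_integrable_def using cz_good_integrable[OF f] by (intro integrable_mult_indicator) auto
    have bi: "integrable lebesgue b"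
      using set_integral_diff(1)[OF fi gi] unfolding set_integrable_def b_def D .
    have "(LINT z|lebesgue. b z) = (LINT z:dcube p|lebesgue. f z) - (LINT z:dcube p|lebesgue. cz_good P f z)"
      using set_integral_diff(2)[OF fi gi] unfolding set_lebesgue_integral_def b_def D by simp
    also have "(LINT z:dcube p|lebesgue. cz_good P f z) = (LINT z:dcube p|lebesgue. (LINT z:dcube p|lebesgue. f z) /\<^sub>R ?m)"
      by (rule set_lebesgue_integral_cong) (use cz_good_in[of _ p f] in \<open>auto simp: D\<close>)
    also have "\<dots> = (LINT z:dcube p|lebesgue. f z)"
      using m measure_dcube[of p] by (subst set_integral_const) auto
    finally have b0: "(LINT z|lebesgue. b z) = 0" by simp
    have supp: "norm (z - gcentre p) \<le> gradius p" if "b z \<noteq> 0" for z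
    proof -
      have "z \<in> dcube p" using that by (auto simp: b_def D split: split_indicator_asm)
      then have "z \<in> gball p" using dcube_subset_gball by blast
      then show ?thesis by (simp add: gball_def dist_norm norm_minus_commute)
    qed
    have "ennreal (norm (LINT z|lebesgue. v z *\<^sub>R b z))
        \<le> ennreal (1 / gradius i ^ CARD('n) * (gradius p / gradius i) powr \<alpha>) * (\<integral>\<^sup>+z. ennreal (norm (b z)) \<partial>lebesgue)"
      by (rule kernel_osc[OF v a _ bi b0 supp]) simp
    also have "(\<integral>\<^sup>+z. ennreal (norm (b z)) \<partial>lebesgue) \<le> 2 * (\<integral>\<^sup>+z\<in>cubes_of P p. ennreal (cmod (f z)) \<partial>lebesgue)"
    proof -
      have "(\<integral>\<^sup>+z. ennreal (norm (b z)) \<partial>lebesgue) \<le> (\<integral>\<^sup>+z. ennreal (cmod (f z)) * indicator (cubes_of P p) z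
          + ennreal (cmod (cz_good P f z)) * indicator (cubes_of P p) z \<partial>lebesgue)"
        by (rule nn_integral_mono) (auto simp: b_def norm_triangle_ineq4 ennreal_leI simp flip: ennreal_plus split: split_indicator)
      also have "\<dots> = (\<integral>\<^sup>+z\<in>cubes_of P p. ennreal (cmod (f z)) \<partial>lebesgue) + (\<integral>\<^sup>+z\<in>cubes_of P p. ennreal (cmod (cz_good P f z)) \<partial>lebesgue)"
        by (rule nn_integral_add) measurable
      also have "\<dots> \<le> (\<integral>\<^sup>+z\<in>cubes_of P p. ennreal (cmod (f z)) \<partial>lebesgue) + (\<integral>\<^sup>+z\<in>cubes_of P p. ennreal (cmod (f z)) \<partial>lebesgue)"
        by (intro add_mono order_refl cz_good_cube_L1_le) simp
      finally show ?thesis by (simp add: mult_2)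
    qed
    also have "ennreal (1 / gradius i ^ CARD('n) * (gradius p / gradius i) powr \<alpha>) * (2 * (\<integral>\<^sup>+z\<in>cubes_of P p. ennreal (cmod (f z)) \<partial>lebesgue))
        = ennreal (osc_coef \<alpha> i p) * (\<integral>\<^sup>+z\<in>cubes_of P p. ennreal (cmod (f z)) \<partial>lebesgue)"
    proof -
      have "ennreal (osc_coef \<alpha> i p) = ennreal 2 * ennreal (1 / gradius i ^ CARD('n) * (gradius p / gradius i) powr \<alpha>)"
        using 3 unfolding osc_coef_def by (subst ennreal_mult[symmetric]) auto
      then show ?thesis by (simp only: ennreal_numeral mult_ac)
    qed
    finally show ?thesis unfolding eq by (simp add: mult_left_mono)
  qed
qed

text \<open>Collects the bounds of all bad cubes for box \<open>i\<close> into a single density. In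
  this form Minkowski's inequality applies to the whole sequence of functions at once.\<close>

definition osc_weight :: "real \<Rightarrow> int \<times> (int ^ 'n) \<Rightarrow> real ^ 'n \<Rightarrow> ennreal" where
  "osc_weight \<alpha> i z = csum (\<lambda>p. ennreal (osc_coef \<alpha> i p) * indicator (cubes_of P p) z)"

lemma osc_weight_borel [measurable]: "osc_weight \<alpha> i \<in> borel_measurable lebesgue"
  unfolding osc_weight_def[abs_def] by measurable

lemma nn_integral_osc_weight:
  assumes [measurable]: "h \<in> borel_measurable lebesgue"
  shows "(\<integral>\<^sup>+z. osc_weight \<alpha> i z * h z \<partial>lebesgue) = csum (\<lambda>p. ennreal (osc_coef \<alpha> i p) * (\<integral>\<^sup>+z\<in>cubes_of P p. h z \<partial>lebesgue))"
proof -
  have "(\<integral>\<^sup>+z. osc_weight \<alpha> i z * h z \<partial>lebesgue) = (\<integral>\<^sup>+z. csum (\<lambda>p. ennreal (osc_coef \<alpha> i p) * (h z * indicator (cubes_of P p) z)) \<partial>lebesgue)"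
    unfolding osc_weight_def by (rule nn_integral_cong, subst nn_integral_multc[symmetric]) (simp, simp only: mult_ac)
  also have "\<dots> = csum (\<lambda>p. \<integral>\<^sup>+z. ennreal (osc_coef \<alpha> i p) * (h z * indicator (cubes_of P p) z) \<partial>lebesgue)"
    by (rule nn_integral_csum) measurable
  also have "\<dots> = csum (\<lambda>p. ennreal (osc_coef \<alpha> i p) * (\<integral>\<^sup>+z\<in>cubes_of P p. h z \<partial>lebesgue))"
    by (intro nn_integral_cong nn_integral_cmult) measurable
  finally show ?thesis .
qed

lemma gcoef_bad_le:
  assumes a: "0 < \<alpha>" "\<alpha> \<le> 1" and f: "integrable lebesgue f"
  shows "gcoef \<alpha> (\<lambda>z. f z - cz_good P f z) i \<le> (\<integral>\<^sup>+z. osc_weight \<alpha> i z * ennreal (cmod (f z)) \<partial>lebesgue)"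
  unfolding gcoef_def
proof (rule SUP_least)
  fix v assume v: "v \<in> kernels \<alpha> (gcentre i) (gradius i)"
  have [measurable]: "f \<in> borel_measurable lebesgue" using f by simp
  have int: "integrable lebesgue (\<lambda>z. v z *\<^sub>R (f z - cz_good P f z))"
    by (rule integrable_bounded_scaleR[OF _ kernel_borel(1)[OF v a(1)] kernel_bound[OF v a]])
      (use f cz_good_integrable[OF f] in auto)
  have "ennreal (cmod (LINT z|lebesgue. v z *\<^sub>R (f z - cz_good P f z)))
      \<le> csum (\<lambda>p. ennreal (cmod (LINT z:cubes_of P p|lebesgue. v z *\<^sub>R (f z - cz_good P f z))))"
    by (rule ennreal_norm_integral_le_csum[OF int _ disjoint_family_cubes]) (auto simp: cz_good_out)
  also have "\<dots> \<le> csum (\<lambda>p. ennreal (osc_coef \<alpha> i p) * (\<integral>\<^sup>+z\<in>cubes_of P p. ennreal (cmod (f z)) \<partial>lebesgue))"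
    by (intro nn_integral_mono bad_cube_integral_le v a f)
  also have "\<dots> = (\<integral>\<^sup>+z. osc_weight \<alpha> i z * ennreal (cmod (f z)) \<partial>lebesgue)"
    by (rule nn_integral_osc_weight[symmetric]) measurable
  finally show "ennreal (cmod (LINT z|lebesgue. v z *\<^sub>R (f z - cz_good P f z))) \<le> \<dots>" .
qed

end

section \<open>Weighted bounds for cubes and for the sums of oscillation coefficients\<close>

context A1_bound
begin

lemma wmeas_ball_mult_integral_le:
  assumes r: "0 < r" and E [measurable]: "E \<in> sets lebesgue" and sub: "E \<subseteq> ball a r"
    and h [measurable]: "h \<in> borel_measurable lebesgue"
  shows "wmeas w (ball a r) * (\<integral>\<^sup>+x\<in>E. h x \<partial>lebesgue)
    \<le> ennreal A * emeasure lebesgue (ball a r) * (\<integral>\<^sup>+x\<in>E. h x * ennreal (w x) \<partial>lebesgue)"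
proof -
  have 1: "(\<integral>\<^sup>+x\<in>ball a r. h x * indicator E x \<partial>lebesgue) = (\<integral>\<^sup>+x\<in>E. h x \<partial>lebesgue)"
    by (rule nn_integral_cong) (use sub in \<open>auto split: split_indicator\<close>)
  have 2: "(\<integral>\<^sup>+x\<in>ball a r. (h x * indicator E x) * ennreal (w x) \<partial>lebesgue) = (\<integral>\<^sup>+x\<in>E. h x * ennreal (w x) \<partial>lebesgue)"
    by (rule nn_integral_cong) (use sub in \<open>auto split: split_indicator\<close>)
  show ?thesis
    using wmeas_mult_integral_le[OF r, of "\<lambda>x. h x * indicator E x" a] unfolding 1 2 by simp
qed

text \<open>The enlarged ball is comparable in volume to the cube, with factor
  \<open>\<rho> ^ n * (2 * (n + 2)) ^ n\<close>. The case \<rho> = 3 will bound the weight of the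
  exceptional set, the case \<rho> = 1 the weighted mass of the averages.\<close>

lemma wmeas_cube_ball_le:
  assumes rho: "1 \<le> \<rho>" and h [measurable]: "h \<in> borel_measurable lebesgue"
  shows "wmeas w (ball (gcentre p) (\<rho> * gradius p)) * (\<integral>\<^sup>+x\<in>dcube p. h x \<partial>lebesgue)
    \<le> ennreal (A * \<rho> ^ CARD('n) * (2 * (real CARD('n) + 2)) ^ CARD('n)) * emeasure lebesgue (dcube p)
      * (\<integral>\<^sup>+x\<in>dcube p. h x * ennreal (w x) \<partial>lebesgue)"
proof -
  have r: "0 < \<rho> * gradius p" using rho by simp
  have le: "gradius p \<le> \<rho> * gradius p" using rho by simp
  have "gball p \<subseteq> ball (gcentre p) (\<rho> * gradius p)" unfolding gball_def by (rule subset_ball[OF le])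
  then have sub: "dcube p \<subseteq> ball (gcentre p) (\<rho> * gradius p)" using dcube_subset_gball by blast
  have "emeasure lebesgue (ball (gcentre p) (\<rho> * gradius p)) = ennreal (\<rho> ^ CARD('n)) * emeasure lebesgue (gball p)"
    unfolding emeasure_gball using r rho by (subst emeasure_lebesgue_ball) (simp_all add: power_mult_distrib ennreal_mult[symmetric] mult_ac)
  also have "\<dots> \<le> ennreal (\<rho> ^ CARD('n)) * (ennreal ((2 * (real CARD('n) + 2)) ^ CARD('n)) * emeasure lebesgue (dcube p))"
    by (intro mult_left_mono emeasure_gball_le_dcube) simp
  finally have vol: "emeasure lebesgue (ball (gcentre p) (\<rho> * gradius p)) \<le> \<dots>" .
  have "wmeas w (ball (gcentre p) (\<rho> * gradius p)) * (\<integral>\<^sup>+x\<in>dcube p. h x \<partial>lebesgue)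
      \<le> ennreal A * emeasure lebesgue (ball (gcentre p) (\<rho> * gradius p)) * (\<integral>\<^sup>+x\<in>dcube p. h x * ennreal (w x) \<partial>lebesgue)"
    by (rule wmeas_ball_mult_integral_le[OF r _ sub]) simp_all
  also have "\<dots> \<le> ennreal A * (ennreal (\<rho> ^ CARD('n)) * (ennreal ((2 * (real CARD('n) + 2)) ^ CARD('n)) * emeasure lebesgue (dcube p)))
      * (\<integral>\<^sup>+x\<in>dcube p. h x * ennreal (w x) \<partial>lebesgue)"
    by (intro mult_right_mono mult_left_mono vol) simp_all
  also have "\<dots> = ennreal (A * \<rho> ^ CARD('n) * (2 * (real CARD('n) + 2)) ^ CARD('n)) * emeasure lebesgue (dcube p)
      * (\<integral>\<^sup>+x\<in>dcube p. h x * ennreal (w x) \<partial>lebesgue)"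
    using A_pos rho by (simp add: ennreal_mult mult.assoc)
  finally show ?thesis .
qed

text \<open>A ball that meets the cube and leaves the tripled ball around it is coarser than the cube, so the
  oscillation coefficients decay geometrically and only boundedly many balls occur at each scale.\<close>

lemma wmeas_osc_sum_le:
  assumes a: "0 < \<alpha>" "\<alpha> \<le> 1"
  shows "\<exists>C>0. \<forall>p (F :: real ^ 'n \<Rightarrow> ennreal). F \<in> borel_measurable lebesgue \<longrightarrow>
    csum (\<lambda>i. wmeas w (gball i - ball (gcentre p) (3 * gradius p)) * (ennreal (osc_coef \<alpha> i p) * (\<integral>\<^sup>+z\<in>dcube p. F z \<partial>lebesgue)))
      \<le> ennreal C * (\<integral>\<^sup>+z\<in>dcube p. F z * ennreal (w z) \<partial>lebesgue)"
proof -
  let ?n = "CARD('n)" let ?V = "unit_ball_vol (real CARD('n))"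
  define q where "q = (1/2::real) powr \<alpha>"
  define K where "K = 2 * A * ?V * 3 ^ ?n"
  define M where "M = (4 * (real ?n + 2) + 1) ^ ?n"
  have q: "0 < q" "q < 1" using half_powr_bounds[OF a(1)] by (auto simp: q_def)
  have K: "0 < K" using A_pos by (simp add: K_def)
  have M: "0 < M" by (auto simp: M_def intro!: zero_less_power add_nonneg_pos)
  have "csum (\<lambda>i. wmeas w (gball i - ball (gcentre p) (3 * gradius p)) * (ennreal (osc_coef \<alpha> i p) * (\<integral>\<^sup>+z\<in>dcube p. F z \<partial>lebesgue)))
      \<le> ennreal (M * K * (2 / (1 - q))) * (\<integral>\<^sup>+z\<in>dcube p. F z * ennreal (w z) \<partial>lebesgue)"
    if F [measurable]: "F \<in> borel_measurable lebesgue" for p and F :: "real ^ 'n \<Rightarrow> ennreal"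
  proof -
    define X where "X = (\<integral>\<^sup>+z\<in>dcube p. F z * ennreal (w z) \<partial>lebesgue)"
    define g where "g i = ennreal (K * q ^ nat \<bar>fst i - fst p\<bar>) * X * indicator (ball (gcentre p) (2 * gradius i)) (gcentre i)" for i :: "int \<times> (int ^ 'n)"
    have term_le: "wmeas w (gball i - ball (gcentre p) (3 * gradius p)) * (ennreal (osc_coef \<alpha> i p) * (\<integral>\<^sup>+z\<in>dcube p. F z \<partial>lebesgue)) \<le> g i" for i
    proof (cases "dcube p \<inter> gball i = {} \<or> gball i - ball (gcentre p) (3 * gradius p) = {}")
      case True
      then show ?thesis
      proof
        assume "gball i - ball (gcentre p) (3 * gradius p) = {}"
        then have "wmeas w (gball i - ball (gcentre p) (3 * gradius p)) = wmeas w {}" by (rule arg_cong)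
        also have "\<dots> = 0" by (simp add: wmeas_def)
        finally have "wmeas w (gball i - ball (gcentre p) (3 * gradius p)) = 0" .
        then show ?thesis by simp
      qed (simp add: osc_coef_def)
    next
      case False
      then obtain z x where z: "z \<in> dcube p" "z \<in> gball i" and x: "x \<in> gball i" "x \<notin> ball (gcentre p) (3 * gradius p)" by blast
      have zp: "dist (gcentre p) z < gradius p" using subsetD[OF dcube_subset_gball z(1)] by (simp add: gball_def)
      have zi: "dist (gcentre i) z < gradius i" and xi: "dist (gcentre i) x < gradius i" using z x by (auto simp: gball_def)
      have "3 * gradius p \<le> dist (gcentre p) x" using x by simp
      also have "\<dots> \<le> dist (gcentre p) z + (dist (gcentre i) z + dist (gcentre i) x)"
        using dist_triangle[of "gcentre p" x z] dist_triangle3[of z x "gcentre i"] by linarith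
      \<comment> \<open>The distances give \<open>3 * gradius p < gradius p + 2 * gradius i\<close>:
        leaving the tripled ball forces \<open>gball i\<close> to be the larger one.\<close>
      finally have gr: "gradius p < gradius i" using zp zi xi by linarith
      then have k: "fst p \<le> fst i" by (simp add: gradius_def mult_less_cancel_left)
      have sub: "dcube p \<subseteq> ball (gcentre i) (3 * gradius i)"
      proof
        fix y assume "y \<in> dcube p"
        then have "dist (gcentre p) y < gradius p" using subsetD[OF dcube_subset_gball] by (simp add: gball_def)
        moreover have "dist (gcentre i) y \<le> dist (gcentre i) z + (dist (gcentre p) z + dist (gcentre p) y)"
          using dist_triangle[of "gcentre i" y z] dist_triangle3[of z y "gcentre p"] by linarith
        ultimately show "y \<in> ball (gcentre i) (3 * gradius i)" using zp zi gr by simp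
      qed
      have cen: "gcentre i \<in> ball (gcentre p) (2 * gradius i)"
        using dist_triangle2[of "gcentre p" "gcentre i" z] zp zi gr by simp
      have gb: "gball i \<subseteq> ball (gcentre i) (3 * gradius i)" unfolding gball_def by (rule subset_ball) simp
      have wle: "wmeas w (gball i - ball (gcentre p) (3 * gradius p)) \<le> wmeas w (ball (gcentre i) (3 * gradius i))"
        using gb by (intro wmeas_mono) auto
      have "wmeas w (gball i - ball (gcentre p) (3 * gradius p)) * (\<integral>\<^sup>+z\<in>dcube p. F z \<partial>lebesgue)
          \<le> wmeas w (ball (gcentre i) (3 * gradius i)) * (\<integral>\<^sup>+z\<in>dcube p. F z \<partial>lebesgue)"
        by (intro mult_right_mono wle) simp
      also have "\<dots> \<le> ennreal A * emeasure lebesgue (ball (gcentre i) (3 * gradius i)) * X"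
        unfolding X_def by (rule wmeas_ball_mult_integral_le[OF _ _ sub]) simp_all
      also have "ennreal A * emeasure lebesgue (ball (gcentre i) (3 * gradius i)) = ennreal (A * (?V * (3 * gradius i) ^ ?n))"
        using A_pos by (subst emeasure_lebesgue_ball) (auto simp: ennreal_mult[symmetric])
      finally have 1: "wmeas w (gball i - ball (gcentre p) (3 * gradius p)) * (\<integral>\<^sup>+z\<in>dcube p. F z \<partial>lebesgue)
          \<le> ennreal (A * (?V * (3 * gradius i) ^ ?n)) * X" .
      have oc: "osc_coef \<alpha> i p = 2 * (1 / gradius i ^ ?n * q ^ nat \<bar>fst i - fst p\<bar>)"
        using z gradius_ratio(2)[OF k, of \<alpha>] by (auto simp: osc_coef_def q_def)
      have "wmeas w (gball i - ball (gcentre p) (3 * gradius p)) * (ennreal (osc_coef \<alpha> i p) * (\<integral>\<^sup>+z\<in>dcube p. F z \<partial>lebesgue))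
          = ennreal (osc_coef \<alpha> i p) * (wmeas w (gball i - ball (gcentre p) (3 * gradius p)) * (\<integral>\<^sup>+z\<in>dcube p. F z \<partial>lebesgue))"
        by (simp only: mult.left_commute)
      also have "\<dots> \<le> ennreal (osc_coef \<alpha> i p) * (ennreal (A * (?V * (3 * gradius i) ^ ?n)) * X)"
        by (intro mult_left_mono 1) simp
      also have "\<dots> = ennreal (osc_coef \<alpha> i p * (A * (?V * (3 * gradius i) ^ ?n))) * X"
        using A_pos by (subst ennreal_mult) (auto simp: mult.assoc)
      \<comment> \<open>The volume of the tripled ball cancels the normalisation
        \<open>1 / gradius i ^ n\<close> in the coefficient; only the decay in the difference of
        scales is left.\<close>
      also have "osc_coef \<alpha> i p * (A * (?V * (3 * gradius i) ^ ?n)) = K * q ^ nat \<bar>fst i - fst p\<bar>"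
        unfolding oc K_def power_mult_distrib by simp
      also have "ennreal (K * q ^ nat \<bar>fst i - fst p\<bar>) * X = g i" using cen by (simp add: g_def)
      finally show ?thesis .
    qed
    have row: "csum (\<lambda>m. g (k, m)) \<le> ennreal (M * K) * X * ennreal (q ^ nat \<bar>k - fst p\<bar>)" for k
    proof -
      define r where "r = (real ?n + 2) * dyad k"
      have r: "gradius (k, m) = r" for m :: "int^'n" by (simp add: gradius_def r_def)
      have r0: "0 < r" using r gradius_pos(1) by metis
      have "csum (\<lambda>m. g (k, m)) = ennreal (K * q ^ nat \<bar>k - fst p\<bar>) * X * csum (\<lambda>m. indicator (ball (gcentre p) (2 * r)) (gcentre (k, m)))"
        unfolding g_def r fst_conv by (rule nn_integral_cmult) simp
      also have "\<dots> \<le> ennreal (K * q ^ nat \<bar>k - fst p\<bar>) * X * ennreal ((2 * (2 * r) / dyad k + 1) ^ ?n)"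
        using r0 by (intro mult_left_mono csum_grid_le) auto
      also have "(2 * (2 * r) / dyad k + 1) ^ ?n = M" by (simp add: r_def M_def)
      also have "ennreal (K * q ^ nat \<bar>k - fst p\<bar>) * X * ennreal M = ennreal (M * K) * X * ennreal (q ^ nat \<bar>k - fst p\<bar>)"
        using K M q by (simp add: ennreal_mult mult_ac)
      finally show ?thesis .
    qed
    have "csum (\<lambda>i. wmeas w (gball i - ball (gcentre p) (3 * gradius p)) * (ennreal (osc_coef \<alpha> i p) * (\<integral>\<^sup>+z\<in>dcube p. F z \<partial>lebesgue)))
        \<le> csum g" by (rule nn_integral_mono) (rule term_le)
    also have "\<dots> = csum (\<lambda>k. csum (\<lambda>m. g (k, m)))" by (rule csum_prod)
    also have "\<dots> \<le> csum (\<lambda>k. ennreal (M * K) * X * ennreal (q ^ nat \<bar>k - fst p\<bar>))"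
      by (rule nn_integral_mono) (rule row)
    also have "\<dots> = ennreal (M * K) * X * csum (\<lambda>k. ennreal (q ^ nat \<bar>k - fst p\<bar>))"
      by (rule nn_integral_cmult) simp
    also have "\<dots> \<le> ennreal (M * K) * X * ennreal (2 / (1 - q))"
      by (intro mult_left_mono csum_geometric_int q) simp
    also have "\<dots> = ennreal (M * K * (2 / (1 - q))) * X"
    proof -
      have "ennreal (M * K * (2 / (1 - q))) = ennreal (M * K) * ennreal (2 / (1 - q))"
        by (rule ennreal_mult) (use K M q in auto)
      then show ?thesis by (simp only: mult_ac)
    qed
    finally show ?thesis by (simp add: X_def)
  qed
  moreover have "0 < M * K * (2 / (1 - q))" using K M q by simp
  ultimately show ?thesis by blast
qed

end

section \<open>Weak type (1,1)\<close>

text \<open>The square of the discretised vector-valued square function. Up to a constant it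
  dominates the sum of the squares of \<open>S_fun \<alpha> (f j)\<close>, and it is measurable by
  construction.\<close>

definition vec_square :: "real \<Rightarrow> (nat \<Rightarrow> real ^ 'n \<Rightarrow> complex) \<Rightarrow> real ^ 'n \<Rightarrow> ennreal" where
  "vec_square \<alpha> f x = (\<Sum>j. csum (\<lambda>i. (gcoef \<alpha> (f j) i)\<^sup>2 * indicator (gball i) x))"

lemma vec_square_borel [measurable]: "vec_square \<alpha> f \<in> borel_measurable lebesgue"
  unfolding vec_square_def[abs_def] by measurable

lemma vec_square_swap:
  "vec_square \<alpha> f x = csum (\<lambda>i. (\<Sum>j. (gcoef \<alpha> (f j) i)\<^sup>2) * indicator (gball i) x)"
  unfolding vec_square_def
  by (simp add: nn_integral_count_space_nat[symmetric] nn_integral_multc[symmetric] csum_swap[of "\<lambda>j i. (gcoef \<alpha> (f j) i)\<^sup>2 * indicator (gball i) x"])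

lemma integrable_imp_locally_integrable:
  fixes f :: "'a::euclidean_space \<Rightarrow> 'b::{banach,second_countable_topology}"
  assumes "integrable lebesgue f"
  shows "locally_integrable f"
  unfolding locally_integrable_def set_integrable_def
  using assms by (intro allI impI integrable_mult_indicator fmeasurableD[OF lmeasurable_compact])

text \<open>Squaring turns sublinearity into the inequality with the two factors 2; the thresholds
  for the two parts are later chosen to match them.\<close>

lemma vec_square_add_le:
  assumes a: "0 < \<alpha>" "\<alpha> \<le> 1" and f: "\<And>j. locally_integrable (f j)" and g: "\<And>j. locally_integrable (g j)"
  shows "vec_square \<alpha> (\<lambda>j z. f j z + g j z) x \<le> 2 * vec_square \<alpha> f x + 2 * vec_square \<alpha> g x"
proof -
  have "vec_square \<alpha> (\<lambda>j z. f j z + g j z) x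
      \<le> (\<Sum>j. csum (\<lambda>i. 2 * ((gcoef \<alpha> (f j) i)\<^sup>2 * indicator (gball i) x) + 2 * ((gcoef \<alpha> (g j) i)\<^sup>2 * indicator (gball i) x)))"
    unfolding vec_square_def
  proof (intro suminf_le nn_integral_mono)
    fix j i
    have "(gcoef \<alpha> (\<lambda>z. f j z + g j z) i)\<^sup>2 \<le> (gcoef \<alpha> (f j) i + gcoef \<alpha> (g j) i)\<^sup>2"
      by (intro power_mono gcoef_add_le a f g) simp
    also have "\<dots> \<le> 2 * (gcoef \<alpha> (f j) i)\<^sup>2 + 2 * (gcoef \<alpha> (g j) i)\<^sup>2" by (rule ennreal_power2_sum_le)
    finally have *: "(gcoef \<alpha> (\<lambda>z. f j z + g j z) i)\<^sup>2 \<le> \<dots>" .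
    show "(gcoef \<alpha> (\<lambda>z. f j z + g j z) i)\<^sup>2 * indicator (gball i) x
        \<le> 2 * ((gcoef \<alpha> (f j) i)\<^sup>2 * indicator (gball i) x) + 2 * ((gcoef \<alpha> (g j) i)\<^sup>2 * indicator (gball i) x)"
      using * by (simp split: split_indicator)
  qed auto
  also have "\<dots> = 2 * vec_square \<alpha> f x + 2 * vec_square \<alpha> g x"
    unfolding vec_square_def by (simp add: nn_integral_add nn_integral_cmult suminf_add[symmetric] ennreal_suminf_cmult)
  finally show ?thesis .
qed

context A1_bound
begin

lemma wmeas_Un_le:
  assumes [measurable]: "E \<in> sets lebesgue" "E' \<in> sets lebesgue"
  shows "wmeas w (E \<union> E') \<le> wmeas w E + wmeas w E'"
proof -
  have "wmeas w (E \<union> E') \<le> (\<integral>\<^sup>+x. ennreal (w x) * indicator E x + ennreal (w x) * indicator E' x \<partial>lebesgue)"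
    unfolding wmeas_def by (rule nn_integral_mono) (auto split: split_indicator)
  also have "\<dots> = wmeas w E + wmeas w E'" unfolding wmeas_def by (rule nn_integral_add) measurable
  finally show ?thesis .
qed

lemma wmeas_UN_le:
  fixes E :: "'i::countable \<Rightarrow> (real ^ 'n) set"
  assumes [measurable]: "\<And>i. E i \<in> sets lebesgue"
  shows "wmeas w (\<Union>i. E i) \<le> csum (\<lambda>i. wmeas w (E i))"
proof -
  have "wmeas w (\<Union>i. E i) \<le> (\<integral>\<^sup>+x. csum (\<lambda>i. ennreal (w x) * indicator (E i) x) \<partial>lebesgue)"
    unfolding wmeas_def
  proof (rule nn_integral_mono)
    fix x
    show "ennreal (w x) * indicator (\<Union>i. E i) x \<le> csum (\<lambda>i. ennreal (w x) * indicator (E i) x)"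
    proof (cases "x \<in> (\<Union>i. E i)")
      case True
      then obtain i where "x \<in> E i" by blast
      then have "ennreal (w x) * indicator (\<Union>i. E i) x \<le> ennreal (w x) * indicator (E i) x"
        using True by (simp add: indicator_def)
      also have "\<dots> \<le> csum (\<lambda>i. ennreal (w x) * indicator (E i) x)" by (rule le_csum)
      finally show ?thesis .
    qed (simp add: indicator_def)
  qed
  also have "\<dots> = csum (\<lambda>i. wmeas w (E i))" unfolding wmeas_def by (rule nn_integral_csum) measurable
  finally show ?thesis .
qed

lemma wmeas_Markov:
  assumes [measurable]: "U \<in> borel_measurable lebesgue" "E \<in> sets lebesgue"
  shows "c * wmeas w {x \<in> E. c \<le> U x} \<le> (\<integral>\<^sup>+x\<in>E. U x * ennreal (w x) \<partial>lebesgue)"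
proof -
  have "{x \<in> space lebesgue. x \<in> E \<and> c \<le> U x} \<in> sets lebesgue" by measurable
  then have [measurable]: "{x \<in> E. c \<le> U x} \<in> sets lebesgue" by simp
  have "c * wmeas w {x \<in> E. c \<le> U x} = (\<integral>\<^sup>+x. c * (ennreal (w x) * indicator {x \<in> E. c \<le> U x} x) \<partial>lebesgue)"
    unfolding wmeas_def by (rule nn_integral_cmult[symmetric]) measurable
  also have "\<dots> \<le> (\<integral>\<^sup>+x\<in>E. U x * ennreal (w x) \<partial>lebesgue)"
    by (rule nn_integral_mono) (auto split: split_indicator intro: mult_right_mono)
  finally show ?thesis .
qed

lemma ennreal_mult_le_cancel_left:
  fixes a b c :: ennreal
  assumes "c * a \<le> c * b" "0 < c" "c < top"
  shows "a \<le> b"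
proof -
  obtain r where r: "c = ennreal r" "0 < r" using assms(2,3) by (cases c) auto
  have inv: "ennreal (1 / r) * c = 1" using r by (simp add: ennreal_mult[symmetric])
  have "ennreal (1 / r) * (c * a) \<le> ennreal (1 / r) * (c * b)" by (intro mult_left_mono assms(1)) simp
  then show ?thesis by (simp add: mult.assoc[symmetric] inv)
qed

lemma ennreal_mult_divide_self:
  fixes m x :: ennreal
  assumes "0 < m" "m < top"
  shows "m * (x / m) = x"
  using assms ennreal_mult_divide_eq[of m x] by (simp add: ennreal_times_divide mult.commute[of m])

text \<open>The cubes are chosen for the \<open>l^2\<close> norm \<open>F\<close> at height
  \<open>l\<close> and used for every component. The good parts are controlled by Markov's
  inequality in \<open>L^2(w)\<close>, the bad parts by Markov's inequality in \<open>L^1(w)\<close>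
  away from the tripled balls, whose own weight is controlled by \<open>A_1\<close>.\<close>

theorem weak_type_vec_square:
  assumes a: "0 < \<alpha>" "\<alpha> \<le> 1"
  shows "\<exists>C>0. \<forall>(f :: nat \<Rightarrow> real ^ 'n \<Rightarrow> complex) F l. (\<forall>j. integrable lebesgue (f j)) \<longrightarrow>
    F \<in> borel_measurable lebesgue \<longrightarrow> (\<forall>x. (\<Sum>j. (ennreal (cmod (f j x)))\<^sup>2) = (F x)\<^sup>2) \<longrightarrow>
    (\<integral>\<^sup>+x. F x \<partial>lebesgue) < top \<longrightarrow> 0 < l \<longrightarrow>
    ennreal l * wmeas w {x. ennreal (l\<^sup>2) < vec_square \<alpha> f x} \<le> ennreal C * (\<integral>\<^sup>+x. F x * ennreal (w x) \<partial>lebesgue)"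
proof -
  let ?N = "real CARD('n) + 2" let ?n = "CARD('n)"
  obtain C1 where C1: "0 < C1" "\<And>f :: real ^ 'n \<Rightarrow> complex. locally_integrable f \<Longrightarrow>
    csum (\<lambda>i. wmeas w (gball i) * (gcoef \<alpha> f i)\<^sup>2)
      \<le> ennreal C1 * (\<integral>\<^sup>+z. (ennreal (cmod (f z)))\<^sup>2 * ennreal (w z) \<partial>lebesgue)"
    using gcoef_weighted_L2_bound[OF a] by blast
  obtain C2 where C2: "0 < C2" "\<And>p (F :: real ^ 'n \<Rightarrow> ennreal). F \<in> borel_measurable lebesgue \<Longrightarrow>
    csum (\<lambda>i. wmeas w (gball i - ball (gcentre p) (3 * gradius p)) * (ennreal (osc_coef \<alpha> i p) * (\<integral>\<^sup>+z\<in>dcube p. F z \<partial>lebesgue)))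
      \<le> ennreal C2 * (\<integral>\<^sup>+z\<in>dcube p. F z * ennreal (w z) \<partial>lebesgue)"
    using wmeas_osc_sum_le[OF a] by blast
  \<comment> \<open>\<open>K\<close> is the upper factor of the stopping cubes; \<open>C3\<close>
    and \<open>C4\<close> come from \<open>wmeas_cube_ball_le\<close> with the radius factors 3 and
    1. The summand 1 in \<open>C4\<close> takes care of the points outside the cubes.\<close>
  define K where "K = (4 * ?N) ^ ?n"
  define C3 where "C3 = A * 3 ^ ?n * (2 * ?N) ^ ?n"
  define C4 where "C4 = 1 + A * 1 ^ ?n * (2 * ?N) ^ ?n"
  have K: "1 \<le> K" unfolding K_def by (rule one_le_power) simp
  have C3: "0 < C3" using A_pos by (auto simp: C3_def intro!: mult_pos_pos zero_less_power add_nonneg_pos)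
  have C4: "1 \<le> C4" using A_pos by (simp add: C4_def)
  define C where "C = C3 + 4 * (C1 * K * C4) + 2 * C2"
  have C: "0 < C" using C1(1) C2(1) C3 C4 K by (auto simp: C_def intro!: add_pos_pos mult_pos_pos)
  have "ennreal l * wmeas w {x. ennreal (l\<^sup>2) < vec_square \<alpha> f x} \<le> ennreal C * (\<integral>\<^sup>+x. F x * ennreal (w x) \<partial>lebesgue)"
    if f: "\<And>j. integrable lebesgue (f j)" and F [measurable]: "F \<in> borel_measurable lebesgue"
      and fF: "\<And>x. (\<Sum>j. (ennreal (cmod (f j x)))\<^sup>2) = (F x)\<^sup>2"
      and fin: "(\<integral>\<^sup>+x. F x \<partial>lebesgue) < top" and l: "0 < l"
    for f :: "nat \<Rightarrow> real ^ 'n \<Rightarrow> complex" and F l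
  proof -
    obtain P :: "(int \<times> (int ^ 'n)) set"
      where dis: "\<And>i j. i \<in> P \<Longrightarrow> j \<in> P \<Longrightarrow> i \<noteq> j \<Longrightarrow> dcube i \<inter> dcube j = {}"
      and low: "\<And>i. i \<in> P \<Longrightarrow> ennreal l * emeasure lebesgue (dcube i) \<le> (\<integral>\<^sup>+z\<in>dcube i. F z \<partial>lebesgue)"
      and upp: "\<And>i. i \<in> P \<Longrightarrow> (\<integral>\<^sup>+z\<in>dcube i. F z \<partial>lebesgue) \<le> ennreal (l * K) * emeasure lebesgue (dcube i)"
      and off: "AE x in lebesgue. x \<notin> (\<Union>i\<in>P. dcube i) \<longrightarrow> F x \<le> ennreal l"
      by (rule calderon_zygmund_cubes[OF F fin l, folded K_def]) (rule that)
    interpret disjoint_cubes P by standard (rule dis)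
    have [measurable]: "f j \<in> borel_measurable lebesgue" for j using f by simp
    have gm [measurable]: "cz_good P (f j) \<in> borel_measurable lebesgue" for j by (rule cz_good_borel) simp
    have gi: "integrable lebesgue (cz_good P (f j))" for j by (rule cz_good_integrable[OF f])
    define b where "b j z = f j z - cz_good P (f j) z" for j z
    define I where "I = (\<integral>\<^sup>+x. F x * ennreal (w x) \<partial>lebesgue)"
    define Fw where "Fw p = (\<integral>\<^sup>+x\<in>cubes_of P p. F x * ennreal (w x) \<partial>lebesgue)" for p
    have Fw_le: "csum Fw \<le> I"
      using nn_integral_split_cubes[of "\<lambda>x. F x * ennreal (w x)"] by (simp add: I_def Fw_def)
    define Om where "Om = (\<Union>p. if p \<in> P then ball (gcentre p) (3 * gradius p) else {})"
    have Om [measurable]: "Om \<in> sets lebesgue" unfolding Om_def by (intro sets.countable_UN) auto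

    \<comment> \<open>The lower bound for the mean of \<open>F\<close> trades the volume of a cube
      for mass of \<open>F\<close>, and \<open>A_1\<close> trades the weight of the tripled ball for
      weighted mass on the cube.\<close>
    have part1: "ennreal l * wmeas w Om \<le> ennreal C3 * I"
    proof -
      have "ennreal l * wmeas w Om \<le> ennreal l * csum (\<lambda>p. wmeas w (if p \<in> P then ball (gcentre p) (3 * gradius p) else {}))"
        unfolding Om_def by (intro mult_left_mono wmeas_UN_le) auto
      also have "\<dots> = csum (\<lambda>p. ennreal l * wmeas w (if p \<in> P then ball (gcentre p) (3 * gradius p) else {}))"
        by (rule nn_integral_cmult[symmetric]) simp
      also have "\<dots> \<le> csum (\<lambda>p. ennreal C3 * Fw p)"
      proof (rule nn_integral_mono)
        fix p
        show "ennreal l * wmeas w (if p \<in> P then ball (gcentre p) (3 * gradius p) else {}) \<le> ennreal C3 * Fw p"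
        proof (cases "p \<in> P")
          case True
          let ?m = "emeasure lebesgue (dcube p)" let ?B = "ball (gcentre p) (3 * gradius p)"
          have "?m * (ennreal l * wmeas w ?B) = wmeas w ?B * (ennreal l * ?m)" by (simp only: mult_ac)
          also have "\<dots> \<le> wmeas w ?B * (\<integral>\<^sup>+z\<in>dcube p. F z \<partial>lebesgue)" by (intro mult_left_mono low True) simp
          also have "\<dots> \<le> ennreal C3 * ?m * (\<integral>\<^sup>+x\<in>dcube p. F x * ennreal (w x) \<partial>lebesgue)"
            unfolding C3_def by (rule wmeas_cube_ball_le[OF _ F]) simp
          also have "\<dots> = ?m * (ennreal C3 * Fw p)" using True by (simp add: Fw_def cubes_of_def mult_ac)
          finally have "ennreal l * wmeas w ?B \<le> ennreal C3 * Fw p"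
            by (rule ennreal_mult_le_cancel_left) (use measure_dcube_pos[of p] in \<open>simp_all add: measure_dcube\<close>)
          then show ?thesis using True by simp
        qed (simp add: wmeas_def)
      qed
      also have "\<dots> = ennreal C3 * csum Fw" by (rule nn_integral_cmult) simp
      also have "\<dots> \<le> ennreal C3 * I" by (intro mult_left_mono Fw_le) simp
      finally show ?thesis .
    qed

    \<comment> \<open>\<open>F\<close> averaged over the cubes: a majorant of the \<open>l^2\<close>
      norm of the good parts that is almost everywhere at most \<open>K * l\<close> and whose
      weighted mass is controlled by that of \<open>F\<close>.\<close>
    define G where "G x = csum (\<lambda>p. (\<integral>\<^sup>+z\<in>cubes_of P p. F z \<partial>lebesgue) / emeasure lebesgue (dcube p) * indicator (cubes_of P p) x)
        + F x * indicator (- (\<Union>p. cubes_of P p)) x" for x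
    have Uc [measurable]: "- (\<Union>p. cubes_of P p) \<in> sets lebesgue" using Union_cubes_sets by (simp only: Compl_in_sets_lebesgue)
    have G [measurable]: "G \<in> borel_measurable lebesgue" unfolding G_def[abs_def] by measurable
    have G_in: "G x = (\<integral>\<^sup>+z\<in>dcube p. F z \<partial>lebesgue) / emeasure lebesgue (dcube p)" if x: "x \<in> cubes_of P p" for x p
    proof -
      have D: "cubes_of P p = dcube p" using x by (auto simp: cubes_of_def split: if_splits)
      have "x \<notin> cubes_of P q" if "q \<noteq> p" for q
        using disjoint_family_onD[OF disjoint_family_cubes UNIV_I UNIV_I that] x by blast
      then have "csum (\<lambda>p. (\<integral>\<^sup>+z\<in>cubes_of P p. F z \<partial>lebesgue) / emeasure lebesgue (dcube p) * indicator (cubes_of P p) x)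
          = (\<Sum>p\<in>{p}. (\<integral>\<^sup>+z\<in>cubes_of P p. F z \<partial>lebesgue) / emeasure lebesgue (dcube p) * indicator (cubes_of P p) x)"
        by (intro nn_integral_count_space') (auto simp: indicator_def)
      moreover have "indicator (cubes_of P p) x = (1::ennreal)" by (rule indicator_simps(1)[OF x])
      moreover have "indicator (- (\<Union>p. cubes_of P p)) x = (0::ennreal)"
        by (rule indicator_simps(2)) (use x in blast)
      ultimately show ?thesis
        by (simp only: G_def D sum.insert finite.emptyI empty_iff not_False_eq_True sum.empty add_0_right mult_1_right mult_zero_right)
    qed
    have G_out: "G x = F x" if "x \<notin> (\<Union>p. cubes_of P p)" for x
    proof -
      have 0: "indicator (cubes_of P p) x = (0::ennreal)" for p
        by (rule indicator_simps(2)) (use that in blast)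
      have 1: "indicator (- (\<Union>p. cubes_of P p)) x = (1::ennreal)"
        by (rule indicator_simps(1)) (use that in blast)
      show ?thesis unfolding G_def 0 1 by simp
    qed
    have gG: "(\<Sum>j. (ennreal (cmod (cz_good P (f j) x)))\<^sup>2) \<le> (G x)\<^sup>2" for x
    proof (cases "x \<in> (\<Union>p. cubes_of P p)")
      case True
      then obtain p where p: "x \<in> cubes_of P p" by blast
      let ?m = "emeasure lebesgue (dcube p)"
      have m: "0 < ?m" "?m < top" using measure_dcube_pos[of p] by (simp_all add: measure_dcube)
      \<comment> \<open>The normalised indicator of the cube: Minkowski's inequality then bounds the
        \<open>l^2\<close> norm of the means by the mean of the \<open>l^2\<close> norm.\<close>
      define h where "h z = 1 / ?m * indicator (dcube p) z" for z
      have h [measurable]: "h \<in> borel_measurable lebesgue" unfolding h_def[abs_def] by measurable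
      have hint: "(\<integral>\<^sup>+z. h z * H z \<partial>lebesgue) = (\<integral>\<^sup>+z\<in>dcube p. H z \<partial>lebesgue) / ?m"
        if [measurable]: "H \<in> borel_measurable lebesgue" for H
      proof -
        have "(\<integral>\<^sup>+z. h z * H z \<partial>lebesgue) = (\<integral>\<^sup>+z. 1 / ?m * (H z * indicator (dcube p) z) \<partial>lebesgue)"
          unfolding h_def by (rule nn_integral_cong) (simp only: mult_ac)
        also have "\<dots> = 1 / ?m * (\<integral>\<^sup>+z\<in>dcube p. H z \<partial>lebesgue)" by (rule nn_integral_cmult) measurable
        finally show ?thesis by (simp add: ennreal_divide_times)
      qed
      have "ennreal (cmod (cz_good P (f j) x)) \<le> (\<integral>\<^sup>+z. h z * ennreal (cmod (f j z)) \<partial>lebesgue)" for j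
      proof -
        have "?m * ennreal (cmod (cz_good P (f j) x)) \<le> (\<integral>\<^sup>+z\<in>dcube p. ennreal (cmod (f j z)) \<partial>lebesgue)"
          using cz_good_norm_le[OF _ p, of "f j"] by (simp add: mult.commute)
        also have "\<dots> = ?m * ((\<integral>\<^sup>+z\<in>dcube p. ennreal (cmod (f j z)) \<partial>lebesgue) / ?m)"
          by (simp only: ennreal_mult_divide_self[OF m])
        also have "\<dots> = ?m * (\<integral>\<^sup>+z. h z * ennreal (cmod (f j z)) \<partial>lebesgue)"
          by (subst hint) auto
        finally show ?thesis by (rule ennreal_mult_le_cancel_left[OF _ m])
      qed
      then have "(\<Sum>j. (ennreal (cmod (cz_good P (f j) x)))\<^sup>2) \<le> (\<Sum>j. (\<integral>\<^sup>+z. h z * ennreal (cmod (f j z)) \<partial>lebesgue)\<^sup>2)"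
        by (intro suminf_le power_mono) auto
      also have "\<dots> \<le> (\<integral>\<^sup>+z. h z * F z \<partial>lebesgue)\<^sup>2" by (rule minkowski_csum[OF _ h F fF]) simp
      also have "(\<integral>\<^sup>+z. h z * F z \<partial>lebesgue) = G x" using hint[OF F] G_in[OF p] by simp
      finally show ?thesis .
    next
      case False
      show ?thesis unfolding cz_good_out[OF False] G_out[OF False] fF by (rule order_refl)
    qed
    have G_le: "AE x in lebesgue. G x \<le> ennreal (K * l)"
      using off
    proof eventually_elim
      case (elim x)
      show ?case
      proof (cases "x \<in> (\<Union>p. cubes_of P p)")
        case True
        then obtain p where p: "x \<in> cubes_of P p" by blast
        then have pP: "p \<in> P" by (auto simp: cubes_of_def split: if_splits)
        let ?m = "emeasure lebesgue (dcube p)"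
        have m: "0 < ?m" "?m < top" using measure_dcube_pos[of p] by (simp_all add: measure_dcube)
        have "?m * G x = (\<integral>\<^sup>+z\<in>dcube p. F z \<partial>lebesgue)"
          unfolding G_in[OF p] by (simp only: ennreal_mult_divide_self[OF m])
        also have "\<dots> \<le> ennreal (l * K) * ?m" by (rule upp[OF pP])
        also have "\<dots> = ?m * ennreal (K * l)" by (simp only: mult_ac)
        finally show ?thesis by (rule ennreal_mult_le_cancel_left[OF _ m])
      next
        case False
        then have "F x \<le> ennreal l" using elim by (simp only: cubes_of_Union simp_thms)
        also have "\<dots> \<le> ennreal (K * l)" using K l by (intro ennreal_leI) simp
        finally show ?thesis using G_out[OF False] by simp
      qed
    qed
    have Gw: "(\<integral>\<^sup>+x. G x * ennreal (w x) \<partial>lebesgue) \<le> ennreal C4 * I"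
    proof -
      have "(\<integral>\<^sup>+x. G x * ennreal (w x) \<partial>lebesgue) = csum (\<lambda>p. \<integral>\<^sup>+x\<in>cubes_of P p. G x * ennreal (w x) \<partial>lebesgue)
          + (\<integral>\<^sup>+x\<in>- (\<Union>p. cubes_of P p). G x * ennreal (w x) \<partial>lebesgue)"
        by (rule nn_integral_split_cubes) measurable
      also have "\<dots> \<le> csum (\<lambda>p. ennreal C4 * Fw p) + ennreal C4 * (\<integral>\<^sup>+x\<in>- (\<Union>p. cubes_of P p). F x * ennreal (w x) \<partial>lebesgue)"
      proof (rule add_mono)
        show "csum (\<lambda>p. \<integral>\<^sup>+x\<in>cubes_of P p. G x * ennreal (w x) \<partial>lebesgue) \<le> csum (\<lambda>p. ennreal C4 * Fw p)"
        proof (rule nn_integral_mono)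
          fix p
          show "(\<integral>\<^sup>+x\<in>cubes_of P p. G x * ennreal (w x) \<partial>lebesgue) \<le> ennreal C4 * Fw p"
          proof (cases "p \<in> P")
            case True
            then have D: "cubes_of P p = dcube p" by (simp add: cubes_of_def)
            let ?m = "emeasure lebesgue (dcube p)" let ?I = "\<integral>\<^sup>+z\<in>dcube p. F z \<partial>lebesgue"
            have m: "0 < ?m" "?m < top" using measure_dcube_pos[of p] by (simp_all add: measure_dcube)
            have "(\<integral>\<^sup>+x\<in>cubes_of P p. G x * ennreal (w x) \<partial>lebesgue) = (\<integral>\<^sup>+x. ?I / ?m * (ennreal (w x) * indicator (dcube p) x) \<partial>lebesgue)"
            proof (rule nn_integral_cong)
              fix x
              show "G x * ennreal (w x) * indicator (cubes_of P p) x = ?I / ?m * (ennreal (w x) * indicator (dcube p) x)"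
              proof (cases "x \<in> cubes_of P p")
                case True
                show ?thesis unfolding G_in[OF True] D by (simp only: mult.assoc)
              next
                case False
                then have "indicator (dcube p) x = (0::ennreal)" unfolding D by (rule indicator_simps(2))
                then show ?thesis unfolding D by (simp only: mult_zero_right)
              qed
            qed
            also have "\<dots> = ?I / ?m * wmeas w (dcube p)" unfolding wmeas_def by (rule nn_integral_cmult) measurable
            finally have eq: "(\<integral>\<^sup>+x\<in>cubes_of P p. G x * ennreal (w x) \<partial>lebesgue) = ?I / ?m * wmeas w (dcube p)" .
            have mI: "?m * (?I / ?m) = ?I"
              by (simp only: ennreal_mult_divide_self[OF m])
            have "?m * (?I / ?m * wmeas w (dcube p)) = wmeas w (dcube p) * ?I"
              by (simp only: mult.assoc[symmetric] mI) (simp only: mult.commute)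
            also have "\<dots> \<le> wmeas w (ball (gcentre p) (1 * gradius p)) * ?I"
              using dcube_subset_gball[of p] by (intro mult_right_mono wmeas_mono) (auto simp: gball_def)
            also have "\<dots> \<le> ennreal (A * 1 ^ ?n * (2 * ?N) ^ ?n) * ?m * (\<integral>\<^sup>+x\<in>dcube p. F x * ennreal (w x) \<partial>lebesgue)"
              by (rule wmeas_cube_ball_le[OF _ F]) simp
            also have "\<dots> \<le> ennreal C4 * ?m * (\<integral>\<^sup>+x\<in>dcube p. F x * ennreal (w x) \<partial>lebesgue)"
              by (intro mult_right_mono ennreal_leI) (auto simp: C4_def)
            also have "\<dots> = ?m * (ennreal C4 * Fw p)" by (simp add: Fw_def D mult_ac)
            finally show ?thesis unfolding eq by (rule ennreal_mult_le_cancel_left[OF _ m])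
          qed (simp add: cubes_of_def)
        qed
        have "(\<integral>\<^sup>+x\<in>- (\<Union>p. cubes_of P p). G x * ennreal (w x) \<partial>lebesgue) = (\<integral>\<^sup>+x\<in>- (\<Union>p. cubes_of P p). F x * ennreal (w x) \<partial>lebesgue)"
          by (rule nn_integral_cong) (use G_out in \<open>auto split: split_indicator\<close>)
        also have "\<dots> \<le> ennreal C4 * (\<integral>\<^sup>+x\<in>- (\<Union>p. cubes_of P p). F x * ennreal (w x) \<partial>lebesgue)"
          using mult_right_mono[of 1 "ennreal C4"] C4 by simp
        finally show "(\<integral>\<^sup>+x\<in>- (\<Union>p. cubes_of P p). G x * ennreal (w x) \<partial>lebesgue) \<le> \<dots>" .
      qed
      also have "\<dots> = ennreal C4 * (csum Fw + (\<integral>\<^sup>+x\<in>- (\<Union>p. cubes_of P p). F x * ennreal (w x) \<partial>lebesgue))"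
        by (simp add: nn_integral_cmult distrib_left)
      also have "\<dots> = ennreal C4 * I" unfolding I_def Fw_def
        by (subst nn_integral_split_cubes[of "\<lambda>x. F x * ennreal (w x)"]) auto
      finally show ?thesis .
    qed
    \<comment> \<open>The bounds on \<open>G\<close> give \<open>G^2 <= K * l * G\<close>, which
      turns the quadratic estimate into a linear one; multiplication by \<open>4 / l\<close> then
      reduces the level \<open>l^2 / 4\<close> to \<open>l\<close>.\<close>
    have part2: "ennreal l * wmeas w {x. ennreal (l\<^sup>2 / 4) \<le> vec_square \<alpha> (\<lambda>j. cz_good P (f j)) x} \<le> ennreal (4 * (C1 * K * C4)) * I"
    proof -
      let ?g = "\<lambda>j. cz_good P (f j)"
      have "ennreal (l\<^sup>2 / 4) * wmeas w {x \<in> UNIV. ennreal (l\<^sup>2 / 4) \<le> vec_square \<alpha> ?g x} \<le> (\<integral>\<^sup>+x\<in>UNIV. vec_square \<alpha> ?g x * ennreal (w x) \<partial>lebesgue)"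
        by (rule wmeas_Markov) simp_all
      also have "\<dots> = (\<integral>\<^sup>+x. (\<Sum>j. csum (\<lambda>i. (gcoef \<alpha> (?g j) i)\<^sup>2 * (ennreal (w x) * indicator (gball i) x))) \<partial>lebesgue)"
        unfolding vec_square_def
      proof (rule nn_integral_cong)
        fix x
        have "csum (\<lambda>i. (gcoef \<alpha> (?g j) i)\<^sup>2 * (ennreal (w x) * indicator (gball i) x))
            = csum (\<lambda>i. (gcoef \<alpha> (?g j) i)\<^sup>2 * indicator (gball i) x) * ennreal (w x)" for j
          by (subst nn_integral_multc[symmetric]) (simp, simp only: mult_ac)
        then show "(\<Sum>j. csum (\<lambda>i. (gcoef \<alpha> (?g j) i)\<^sup>2 * indicator (gball i) x)) * ennreal (w x) * indicator UNIV x
            = (\<Sum>j. csum (\<lambda>i. (gcoef \<alpha> (?g j) i)\<^sup>2 * (ennreal (w x) * indicator (gball i) x)))"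
          by (simp only: ennreal_suminf_multc indicator_UNIV mult_1_right)
      qed
      also have "\<dots> = (\<Sum>j. \<integral>\<^sup>+x. csum (\<lambda>i. (gcoef \<alpha> (?g j) i)\<^sup>2 * (ennreal (w x) * indicator (gball i) x)) \<partial>lebesgue)"
        by (rule nn_integral_suminf) measurable
      also have "\<dots> = (\<Sum>j. csum (\<lambda>i. wmeas w (gball i) * (gcoef \<alpha> (?g j) i)\<^sup>2))"
      proof (rule suminf_cong)
        fix j
        have "(\<integral>\<^sup>+x. csum (\<lambda>i. (gcoef \<alpha> (?g j) i)\<^sup>2 * (ennreal (w x) * indicator (gball i) x)) \<partial>lebesgue)
            = csum (\<lambda>i. \<integral>\<^sup>+x. (gcoef \<alpha> (?g j) i)\<^sup>2 * (ennreal (w x) * indicator (gball i) x) \<partial>lebesgue)"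
          by (rule nn_integral_csum) measurable
        also have "\<dots> = csum (\<lambda>i. (gcoef \<alpha> (?g j) i)\<^sup>2 * wmeas w (gball i))"
          unfolding wmeas_def by (intro nn_integral_cong nn_integral_cmult) measurable
        finally show "(\<integral>\<^sup>+x. csum (\<lambda>i. (gcoef \<alpha> (?g j) i)\<^sup>2 * (ennreal (w x) * indicator (gball i) x)) \<partial>lebesgue)
            = csum (\<lambda>i. wmeas w (gball i) * (gcoef \<alpha> (?g j) i)\<^sup>2)" by (simp only: mult.commute)
      qed
      also have "\<dots> \<le> (\<Sum>j. ennreal C1 * (\<integral>\<^sup>+z. (ennreal (cmod (?g j z)))\<^sup>2 * ennreal (w z) \<partial>lebesgue))"
        by (intro suminf_le C1(2) integrable_imp_locally_integrable gi) auto
      also have "\<dots> = ennreal C1 * (\<integral>\<^sup>+z. (\<Sum>j. (ennreal (cmod (?g j z)))\<^sup>2) * ennreal (w z) \<partial>lebesgue)"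
      proof -
        have "(\<Sum>j. \<integral>\<^sup>+z. (ennreal (cmod (?g j z)))\<^sup>2 * ennreal (w z) \<partial>lebesgue)
            = (\<integral>\<^sup>+z. (\<Sum>j. (ennreal (cmod (?g j z)))\<^sup>2 * ennreal (w z)) \<partial>lebesgue)"
          by (rule nn_integral_suminf[symmetric]) measurable
        then show ?thesis by (simp only: ennreal_suminf_cmult ennreal_suminf_multc)
      qed
      also have "\<dots> \<le> ennreal C1 * (\<integral>\<^sup>+z. ennreal (K * l) * (G z * ennreal (w z)) \<partial>lebesgue)"
      proof (intro mult_left_mono nn_integral_mono_AE)
        show "AE z in lebesgue. (\<Sum>j. (ennreal (cmod (?g j z)))\<^sup>2) * ennreal (w z) \<le> ennreal (K * l) * (G z * ennreal (w z))"
          using G_le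
        proof eventually_elim
          case (elim z)
          have "(\<Sum>j. (ennreal (cmod (?g j z)))\<^sup>2) \<le> G z * G z" using gG[of z] by (simp add: power2_eq_square)
          also have "\<dots> \<le> ennreal (K * l) * G z" by (intro mult_right_mono elim) simp
          finally show ?case unfolding mult.assoc[symmetric] by (rule mult_right_mono) simp
        qed
      qed simp
      also have "\<dots> = ennreal C1 * (ennreal (K * l) * (\<integral>\<^sup>+z. G z * ennreal (w z) \<partial>lebesgue))"
        by (subst nn_integral_cmult) auto
      also have "\<dots> \<le> ennreal C1 * (ennreal (K * l) * (ennreal C4 * I))"
        by (intro mult_left_mono Gw) auto
      finally have "ennreal (l\<^sup>2 / 4) * wmeas w {x. ennreal (l\<^sup>2 / 4) \<le> vec_square \<alpha> ?g x} \<le> ennreal C1 * (ennreal (K * l) * (ennreal C4 * I))"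
        by simp
      then have "ennreal (4 / l) * (ennreal (l\<^sup>2 / 4) * wmeas w {x. ennreal (l\<^sup>2 / 4) \<le> vec_square \<alpha> ?g x}) \<le> ennreal (4 / l) * (ennreal C1 * (ennreal (K * l) * (ennreal C4 * I)))"
        by (rule mult_left_mono) simp
      moreover have "ennreal (4 / l) * (ennreal (l\<^sup>2 / 4) * wmeas w {x. ennreal (l\<^sup>2 / 4) \<le> vec_square \<alpha> ?g x}) = ennreal l * wmeas w {x. ennreal (l\<^sup>2 / 4) \<le> vec_square \<alpha> ?g x}"
        using l by (subst mult.assoc[symmetric], subst ennreal_mult[symmetric]) (auto simp: power2_eq_square)
      moreover have "ennreal (4 / l) * (ennreal C1 * (ennreal (K * l) * (ennreal C4 * I))) = ennreal (4 * (C1 * K * C4)) * I"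
      proof -
        have "ennreal (4 * (C1 * K * C4)) = ennreal (4 / l) * (ennreal C1 * (ennreal (K * l) * ennreal C4))"
          using l C1(1) K C4 by (simp add: ennreal_mult[symmetric])
        then show ?thesis by (simp only: mult.assoc)
      qed
      ultimately show ?thesis by simp
    qed

    \<comment> \<open>A plain sum over the boxes in place of the root of a sum of squares, so that
      its weighted integral off \<open>Om\<close> can be bounded cube by cube.\<close>
    define U where "U x = csum (\<lambda>i. indicator (gball i) x * (\<integral>\<^sup>+z. osc_weight \<alpha> i z * F z \<partial>lebesgue))" for x
    have U [measurable]: "U \<in> borel_measurable lebesgue" unfolding U_def[abs_def] by measurable
    have bU: "vec_square \<alpha> b x \<le> (U x)\<^sup>2" for x
    proof -
      have "vec_square \<alpha> b x \<le> csum (\<lambda>i. (indicator (gball i) x * (\<integral>\<^sup>+z. osc_weight \<alpha> i z * F z \<partial>lebesgue))\<^sup>2)"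
        unfolding vec_square_swap
      proof (rule nn_integral_mono)
        fix i
        have "(\<Sum>j. (gcoef \<alpha> (b j) i)\<^sup>2) \<le> (\<Sum>j. (\<integral>\<^sup>+z. osc_weight \<alpha> i z * ennreal (cmod (f j z)) \<partial>lebesgue)\<^sup>2)"
          unfolding b_def[abs_def] by (intro suminf_le power_mono gcoef_bad_le a f) auto
        also have "\<dots> \<le> (\<integral>\<^sup>+z. osc_weight \<alpha> i z * F z \<partial>lebesgue)\<^sup>2"
          by (rule minkowski_csum[OF _ _ F fF]) simp_all
        finally show "(\<Sum>j. (gcoef \<alpha> (b j) i)\<^sup>2) * indicator (gball i) x \<le> (indicator (gball i) x * (\<integral>\<^sup>+z. osc_weight \<alpha> i z * F z \<partial>lebesgue))\<^sup>2"
          by (simp split: split_indicator)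
      qed
      also have "\<dots> \<le> (U x)\<^sup>2" unfolding U_def by (rule csum_power2_le)
      finally show ?thesis .
    qed
    have part3: "ennreal l * wmeas w {x \<in> - Om. ennreal (l / 2) \<le> U x} \<le> ennreal (2 * C2) * I"
    proof -
      have Omc: "- Om \<in> sets lebesgue" using Om by (simp only: Compl_in_sets_lebesgue)
      note [measurable] = Omc
      have "ennreal (l / 2) * wmeas w {x \<in> - Om. ennreal (l / 2) \<le> U x} \<le> (\<integral>\<^sup>+x\<in>- Om. U x * ennreal (w x) \<partial>lebesgue)"
        by (rule wmeas_Markov) simp_all
      also have "\<dots> = (\<integral>\<^sup>+x. csum (\<lambda>i. (\<integral>\<^sup>+z. osc_weight \<alpha> i z * F z \<partial>lebesgue) * (ennreal (w x) * indicator (gball i - Om) x)) \<partial>lebesgue)"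
        unfolding U_def
      proof (rule nn_integral_cong)
        fix x
        show "csum (\<lambda>i. indicator (gball i) x * (\<integral>\<^sup>+z. osc_weight \<alpha> i z * F z \<partial>lebesgue)) * ennreal (w x) * indicator (- Om) x
            = csum (\<lambda>i. (\<integral>\<^sup>+z. osc_weight \<alpha> i z * F z \<partial>lebesgue) * (ennreal (w x) * indicator (gball i - Om) x))"
        proof -
          have "csum (\<lambda>i. indicator (gball i) x * J i) * ennreal (w x) * indicator (- Om) x
              = csum (\<lambda>i. J i * (ennreal (w x) * indicator (gball i - Om) x))" for J :: "int \<times> (int ^ 'n) \<Rightarrow> ennreal"
          proof -
            have "csum (\<lambda>i. J i * (ennreal (w x) * indicator (gball i - Om) x))
                = csum (\<lambda>i. (indicator (gball i) x * J i) * (ennreal (w x) * indicator (- Om) x))"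
              by (rule nn_integral_cong) (auto simp: mult_ac split: split_indicator)
            also have "\<dots> = csum (\<lambda>i. indicator (gball i) x * J i) * (ennreal (w x) * indicator (- Om) x)"
              by (rule nn_integral_multc) simp
            finally show ?thesis by (simp only: mult.assoc)
          qed
          then show ?thesis .
        qed
      qed
      also have "\<dots> = csum (\<lambda>i. \<integral>\<^sup>+x. (\<integral>\<^sup>+z. osc_weight \<alpha> i z * F z \<partial>lebesgue) * (ennreal (w x) * indicator (gball i - Om) x) \<partial>lebesgue)"
        by (rule nn_integral_csum) measurable
      also have "\<dots> = csum (\<lambda>i. (\<integral>\<^sup>+z. osc_weight \<alpha> i z * F z \<partial>lebesgue) * wmeas w (gball i - Om))"
        unfolding wmeas_def by (intro nn_integral_cong nn_integral_cmult) measurable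
      also have "\<dots> = csum (\<lambda>i. csum (\<lambda>p. wmeas w (gball i - Om) * (ennreal (osc_coef \<alpha> i p) * (\<integral>\<^sup>+z\<in>cubes_of P p. F z \<partial>lebesgue))))"
        unfolding nn_integral_osc_weight[OF F]
        by (intro nn_integral_cong) (simp add: nn_integral_cmult mult.commute)
      also have "\<dots> = csum (\<lambda>p. csum (\<lambda>i. wmeas w (gball i - Om) * (ennreal (osc_coef \<alpha> i p) * (\<integral>\<^sup>+z\<in>cubes_of P p. F z \<partial>lebesgue))))"
        by (rule csum_swap)
      also have "\<dots> \<le> csum (\<lambda>p. ennreal C2 * Fw p)"
      proof (rule nn_integral_mono)
        fix p
        show "csum (\<lambda>i. wmeas w (gball i - Om) * (ennreal (osc_coef \<alpha> i p) * (\<integral>\<^sup>+z\<in>cubes_of P p. F z \<partial>lebesgue))) \<le> ennreal C2 * Fw p"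
        proof (cases "p \<in> P")
          case True
          then have D: "cubes_of P p = dcube p" by (simp add: cubes_of_def)
          have "ball (gcentre p) (3 * gradius p) \<subseteq> Om" unfolding Om_def using True by (intro UN_upper[of p UNIV, THEN order_trans[rotated]]) auto
          then have "csum (\<lambda>i. wmeas w (gball i - Om) * (ennreal (osc_coef \<alpha> i p) * (\<integral>\<^sup>+z\<in>cubes_of P p. F z \<partial>lebesgue)))
              \<le> csum (\<lambda>i. wmeas w (gball i - ball (gcentre p) (3 * gradius p)) * (ennreal (osc_coef \<alpha> i p) * (\<integral>\<^sup>+z\<in>dcube p. F z \<partial>lebesgue)))"
            unfolding D by (intro nn_integral_mono mult_right_mono wmeas_mono) auto
          also have "\<dots> \<le> ennreal C2 * Fw p" unfolding Fw_def D by (rule C2(2)[OF F])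
          finally show ?thesis .
        qed (simp add: cubes_of_def)
      qed
      also have "\<dots> = ennreal C2 * csum Fw" by (rule nn_integral_cmult) simp
      also have "\<dots> \<le> ennreal C2 * I" by (intro mult_left_mono Fw_le) simp
      finally have "ennreal 2 * (ennreal (l / 2) * wmeas w {x \<in> - Om. ennreal (l / 2) \<le> U x}) \<le> ennreal 2 * (ennreal C2 * I)"
        by (rule mult_left_mono) simp
      moreover have "ennreal 2 * (ennreal (l / 2) * wmeas w {x \<in> - Om. ennreal (l / 2) \<le> U x}) = ennreal l * wmeas w {x \<in> - Om. ennreal (l / 2) \<le> U x}"
        using l by (subst mult.assoc[symmetric], subst ennreal_mult[symmetric]) auto
      moreover have "ennreal 2 * (ennreal C2 * I) = ennreal (2 * C2) * I"
        using C2(1) by (subst ennreal_mult) (auto simp: mult.assoc)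
      ultimately show ?thesis by simp
    qed

    \<comment> \<open>Off the three sets both squared parts are at most \<open>l^2 / 4\<close>, and
      \<open>2 * l^2 / 4 + 2 * l^2 / 4 = l^2\<close>.\<close>
    have sub: "{x. ennreal (l\<^sup>2) < vec_square \<alpha> f x} \<subseteq> (Om \<union> {x. ennreal (l\<^sup>2 / 4) \<le> vec_square \<alpha> (\<lambda>j. cz_good P (f j)) x})
        \<union> {x \<in> - Om. ennreal (l / 2) \<le> U x}"
    proof
      fix x assume "x \<in> {x. ennreal (l\<^sup>2) < vec_square \<alpha> f x}"
      then have x: "ennreal (l\<^sup>2) < vec_square \<alpha> f x" by simp
      show "x \<in> (Om \<union> {x. ennreal (l\<^sup>2 / 4) \<le> vec_square \<alpha> (\<lambda>j. cz_good P (f j)) x}) \<union> {x \<in> - Om. ennreal (l / 2) \<le> U x}"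
      proof (rule ccontr)
        assume "\<not> ?thesis"
        then have 1: "vec_square \<alpha> (\<lambda>j. cz_good P (f j)) x < ennreal (l\<^sup>2 / 4)" and 2: "U x < ennreal (l / 2)"
          by (auto simp: not_le)
        have "vec_square \<alpha> b x \<le> (U x)\<^sup>2" by (rule bU)
        also have "\<dots> \<le> (ennreal (l / 2))\<^sup>2" using 2 by (intro power_mono) auto
        also have "\<dots> = ennreal (l\<^sup>2 / 4)" using l by (simp add: ennreal_power power_divide)
        finally have 3: "vec_square \<alpha> b x \<le> ennreal (l\<^sup>2 / 4)" .
        have "vec_square \<alpha> f x = vec_square \<alpha> (\<lambda>j z. b j z + cz_good P (f j) z) x" by (simp add: b_def)
        also have "\<dots> \<le> 2 * vec_square \<alpha> b x + 2 * vec_square \<alpha> (\<lambda>j. cz_good P (f j)) x"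
        proof (rule vec_square_add_le[OF a])
          fix j
          show "locally_integrable (b j)"
            unfolding b_def[abs_def] by (intro integrable_imp_locally_integrable Bochner_Integration.integrable_diff f gi)
          show "locally_integrable (cz_good P (f j))" by (intro integrable_imp_locally_integrable gi)
        qed
        also have "\<dots> \<le> 2 * ennreal (l\<^sup>2 / 4) + 2 * ennreal (l\<^sup>2 / 4)"
          using 1 3 by (intro add_mono mult_left_mono) auto
        also have "\<dots> = ennreal 4 * ennreal (l\<^sup>2 / 4)" by (simp add: mult_2[symmetric] mult.assoc[symmetric])
        also have "\<dots> = ennreal (l\<^sup>2)" by (subst ennreal_mult[symmetric]) auto
        finally show False using x by simp
      qed
    qed
    have m2: "{x. ennreal (l\<^sup>2 / 4) \<le> vec_square \<alpha> (\<lambda>j. cz_good P (f j)) x} \<in> sets lebesgue"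
    proof -
      have "{x \<in> space lebesgue. ennreal (l\<^sup>2 / 4) \<le> vec_square \<alpha> (\<lambda>j. cz_good P (f j)) x} \<in> sets lebesgue" by measurable
      then show ?thesis by simp
    qed
    have m3: "{x \<in> - Om. ennreal (l / 2) \<le> U x} \<in> sets lebesgue"
    proof -
      have "{x \<in> space lebesgue. x \<notin> Om \<and> ennreal (l / 2) \<le> U x} \<in> sets lebesgue" by measurable
      then show ?thesis by simp
    qed
    have "ennreal l * wmeas w {x. ennreal (l\<^sup>2) < vec_square \<alpha> f x}
        \<le> ennreal l * ((wmeas w Om + wmeas w {x. ennreal (l\<^sup>2 / 4) \<le> vec_square \<alpha> (\<lambda>j. cz_good P (f j)) x}) + wmeas w {x \<in> - Om. ennreal (l / 2) \<le> U x})"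
      by (intro mult_left_mono order_trans[OF wmeas_mono[OF sub]] order_trans[OF wmeas_Un_le] add_mono sets.Un Om m2 m3 wmeas_Un_le order_refl) simp
    also have "\<dots> \<le> (ennreal C3 * I + ennreal (4 * (C1 * K * C4)) * I) + ennreal (2 * C2) * I"
      unfolding distrib_left by (intro add_mono part1 part2 part3)
    also have "\<dots> = ennreal C * I"
    proof -
      have "ennreal C = ennreal C3 + ennreal (4 * (C1 * K * C4)) + ennreal (2 * C2)"
        unfolding C_def using C1(1) C2(1) C3 C4 K by (subst ennreal_plus[symmetric], simp, simp)+ simp
      then show ?thesis by (simp only: distrib_right)
    qed
    finally show ?thesis by (simp add: I_def)
  qed
  then show ?thesis using C by blast
qed

end

section \<open>Reverse doubling and the tail\<close>

context A1_bound
begin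

definition W :: "real ^ 'n \<Rightarrow> real \<Rightarrow> real" where
  "W a r = enn2real (wmeas w (ball a r))"

lemma wmeas_W: "wmeas w (ball a r) = ennreal (W a r)"
  using wmeas_ball_finite[of a r] by (simp add: W_def)

lemma W_nonneg [simp]: "0 \<le> W a r"
  by (simp add: W_def)

lemma wmeas_mult_emeasure_le:
  assumes r: "0 < r" and E: "E \<in> sets lebesgue" "E \<subseteq> ball a r"
  shows "wmeas w (ball a r) * emeasure lebesgue E \<le> ennreal A * emeasure lebesgue (ball a r) * wmeas w E"
  using wmeas_ball_mult_integral_le[OF r E, of "\<lambda>_. 1"] E(1) by (simp add: wmeas_def)

text \<open>The \<open>A_1\<close> bound with the smaller ball as a subset of the larger one; the
  ratio of the volumes gives \<open>\<rho> ^ n\<close>.\<close>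

lemma W_doubling:
  assumes r: "0 < r" and rho: "1 \<le> \<rho>"
  shows "W a (\<rho> * r) \<le> A * \<rho> ^ CARD('n) * W a r"
proof -
  let ?v = "unit_ball_vol (real CARD('n)) * r ^ CARD('n)"
  have v: "0 < ?v" using r by simp
  have pr: "0 < \<rho> * r" using r rho by simp
  have "wmeas w (ball a (\<rho> * r)) * emeasure lebesgue (ball a r) \<le> ennreal A * emeasure lebesgue (ball a (\<rho> * r)) * wmeas w (ball a r)"
    by (rule wmeas_mult_emeasure_le[OF pr]) (use r rho in \<open>auto intro!: subset_ball\<close>)
  then have "ennreal (W a (\<rho> * r)) * ennreal ?v \<le> ennreal A * ennreal (unit_ball_vol (real CARD('n)) * (\<rho> * r) ^ CARD('n)) * ennreal (W a r)"
    unfolding wmeas_W emeasure_lebesgue_ball[OF less_imp_le[OF r]] emeasure_lebesgue_ball[OF less_imp_le[OF pr]] .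
  then have "W a (\<rho> * r) * ?v \<le> A * (unit_ball_vol (real CARD('n)) * (\<rho> * r) ^ CARD('n)) * W a r"
    using A_pos r rho v by (simp add: ennreal_mult[symmetric])
  also have "\<dots> = (A * \<rho> ^ CARD('n) * W a r) * ?v" by (simp add: power_mult_distrib mult_ac)
  finally show ?thesis using v by (simp add: mult_le_cancel_right)
qed

text \<open>The annulus between concentric balls of ratio 2 holds at least half the volume of the
  larger one, hence by \<open>A_1\<close> at least the fraction \<open>1 / (2 * A)\<close> of its
  weight; \<theta> bounds what remains for the inner ball. The maximum with 1 keeps it
  positive.\<close>

definition \<theta> :: real where "\<theta> = 1 - 1 / (2 * max A 1)"

lemma theta_bounds: "0 < \<theta>" "\<theta> < 1"
proof -
  have "1 / (2 * max A 1) \<le> 1 / 2" by (rule divide_left_mono) auto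
  then show "0 < \<theta>" by (simp add: \<theta>_def)
  have "0 < 1 / (2 * max A 1)" by simp
  then show "\<theta> < 1" by (simp add: \<theta>_def)
qed

lemma W_reverse_doubling:
  assumes r: "0 < r"
  shows "W a r \<le> \<theta> * W a (2 * r)"
proof -
  let ?V = "unit_ball_vol (real CARD('n))" let ?n = "CARD('n)"
  define E where "E = ball a (2 * r) - ball a r"
  have E [measurable]: "E \<in> sets lebesgue" by (simp add: E_def)
  have sub: "ball a r \<subseteq> ball a (2 * r)" using r by (intro subset_ball) simp
  have Elt: "wmeas w E < top"
    using wmeas_ball_finite[of a "2 * r"] wmeas_mono[of E "ball a (2 * r)" w] by (auto simp: E_def)
  define e where "e = enn2real (wmeas w E)"
  have e: "wmeas w E = ennreal e" "0 \<le> e" using Elt by (simp_all add: e_def)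
  have "wmeas w (ball a (2 * r)) = wmeas w (ball a r) + wmeas w E"
  proof -
    have "wmeas w (ball a (2 * r)) = (\<integral>\<^sup>+x\<in>ball a r \<union> E. ennreal (w x) \<partial>lebesgue)"
      unfolding wmeas_def E_def using sub by (simp add: Un_absorb1)
    also have "\<dots> = wmeas w (ball a r) + wmeas w E"
      unfolding wmeas_def by (rule nn_integral_disjoint_pair) (auto simp: E_def)
    finally show ?thesis .
  qed
  then have sum: "W a (2 * r) = W a r + e" using e by (simp add: wmeas_W flip: ennreal_plus)
  have vol: "ennreal (?V * (2 * r) ^ ?n / 2) \<le> emeasure lebesgue E"
  proof -
    \<comment> \<open>The dimension is at least 1, so the inner ball has at most half the
      volume.\<close>
    have "(2::real) ^ 1 \<le> 2 ^ ?n" by (rule power_increasing) (auto simp: Suc_leI)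
    then have "r ^ ?n * 2 \<le> r ^ ?n * 2 ^ ?n" using r by (intro mult_left_mono) auto
    then have h: "?V * r ^ ?n \<le> ?V * ((2 * r) ^ ?n / 2)" by (intro mult_left_mono) (auto simp: power_mult_distrib mult.commute)
    have "emeasure lebesgue E = emeasure lebesgue (ball a (2 * r)) - emeasure lebesgue (ball a r)"
      unfolding E_def by (rule emeasure_Diff) (use r sub in \<open>auto simp: emeasure_ball\<close>)
    also have "\<dots> = ennreal (?V * (2 * r) ^ ?n - ?V * r ^ ?n)"
      using r by (subst (1 2) emeasure_lebesgue_ball) (auto simp: ennreal_minus)
    finally have eq: "emeasure lebesgue E = ennreal (?V * (2 * r) ^ ?n - ?V * r ^ ?n)" .
    have "?V * (2 * r) ^ ?n / 2 \<le> ?V * (2 * r) ^ ?n - ?V * r ^ ?n"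
      using h unfolding times_divide_eq_right by linarith
    then show ?thesis unfolding eq by (rule ennreal_leI)
  qed
  have "wmeas w (ball a (2 * r)) * ennreal (?V * (2 * r) ^ ?n / 2) \<le> wmeas w (ball a (2 * r)) * emeasure lebesgue E"
    by (intro mult_left_mono vol) simp
  also have "\<dots> \<le> ennreal A * emeasure lebesgue (ball a (2 * r)) * wmeas w E"
    by (rule wmeas_mult_emeasure_le) (use r E in \<open>auto simp: E_def\<close>)
  also have "emeasure lebesgue (ball a (2 * r)) = ennreal (?V * (2 * r) ^ ?n)"
    using r by (intro emeasure_lebesgue_ball) simp
  finally have "W a (2 * r) * (?V * (2 * r) ^ ?n / 2) \<le> A * (?V * (2 * r) ^ ?n) * e"
    using A_pos r e by (simp add: wmeas_W ennreal_mult[symmetric])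
  then have "(?V * (2 * r) ^ ?n) * W a (2 * r) \<le> (?V * (2 * r) ^ ?n) * (2 * A * e)" by (simp add: mult_ac)
  then have "W a (2 * r) \<le> 2 * A * e" using r by (subst (asm) mult_le_cancel_left_pos) auto
  also have "\<dots> \<le> 2 * max A 1 * e" using e by (intro mult_right_mono) auto
  finally have "W a (2 * r) / (2 * max A 1) \<le> e" by (simp add: divide_le_eq mult.commute)
  then show ?thesis using sum by (simp add: \<theta>_def left_diff_distrib)
qed

lemma W_reverse_doubling_power:
  assumes r: "0 < r"
  shows "W a r \<le> \<theta> ^ d * W a (2 ^ d * r)"
proof (induction d)
  case (Suc d)
  have "W a (2 ^ d * r) \<le> \<theta> * W a (2 * (2 ^ d * r))" by (rule W_reverse_doubling) (use r in simp)
  then have "\<theta> ^ d * W a (2 ^ d * r) \<le> \<theta> ^ d * (\<theta> * W a (2 * (2 ^ d * r)))"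
    using theta_bounds by (intro mult_left_mono) auto
  then show ?case using Suc.IH by (simp add: mult_ac)
qed simp

lemma W_mono: "ball a r \<subseteq> ball b s \<Longrightarrow> W a r \<le> W b s"
  using wmeas_mono[of "ball a r" "ball b s" w] by (simp add: wmeas_W)

text \<open>Reverse doubling is iterated from radius \<open>2 * t0\<close>, which exceeds
  \<open>r\<close>, up to twice the radius of \<open>gball i\<close>. The resulting ball about
  \<open>a\<close> lies in the ball of 5 times the radius about \<open>gcentre i\<close>, the
  centres being less than 3 radii apart, and doubling leads back to \<open>gball i\<close>.\<close>

lemma W_gball_ge:
  assumes r: "0 < r" and k0: "r < 2 * ((real CARD('n) + 2) * dyad k0)" and ki: "k0 \<le> fst i"
    and x: "x \<in> gball i" "x \<in> ball a r"
  shows "W a r \<le> \<theta> ^ nat \<bar>fst i - k0\<bar> * (A * 5 ^ CARD('n)) * W (gcentre i) (gradius i)"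
proof -
  define t0 where "t0 = (real CARD('n) + 2) * dyad k0"
  define d where "d = nat (fst i - k0)"
  have d: "nat \<bar>fst i - k0\<bar> = d" using ki by (simp add: d_def)
  have t0: "0 < 2 * t0" using r k0 by (simp add: t0_def)
  have gi: "gradius i = 2 ^ d * t0" unfolding gradius_def t0_def d_def using dyad_diff[OF ki] by simp
  have "t0 \<le> gradius i" using gi t0 mult_right_mono[of 1 "2 ^ d" t0] by simp
  then have rt: "r < 2 * gradius i" using k0 by (simp add: t0_def)
  have "W a r \<le> W a (2 * t0)" using k0 by (intro W_mono subset_ball) (simp add: t0_def)
  also have "\<dots> \<le> \<theta> ^ d * W a (2 ^ d * (2 * t0))" by (rule W_reverse_doubling_power[OF t0])
  also have "2 ^ d * (2 * t0) = 2 * gradius i" by (simp add: gi)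
  also have "\<theta> ^ d * W a (2 * gradius i) \<le> \<theta> ^ d * W (gcentre i) (5 * gradius i)"
  proof (intro mult_left_mono W_mono)
    have "dist (gcentre i) a \<le> dist (gcentre i) x + dist a x" by (rule dist_triangle2)
    also have "\<dots> < gradius i + r" using x by (simp add: gball_def)
    finally have ca: "dist (gcentre i) a < 3 * gradius i" using rt by linarith
    show "ball a (2 * gradius i) \<subseteq> ball (gcentre i) (5 * gradius i)"
    proof
      fix y assume "y \<in> ball a (2 * gradius i)"
      then show "y \<in> ball (gcentre i) (5 * gradius i)"
        using ca dist_triangle[of "gcentre i" y a] by simp
    qed
  qed (use theta_bounds in simp)
  also have "\<dots> \<le> \<theta> ^ d * (A * 5 ^ CARD('n) * W (gcentre i) (gradius i))"
    using theta_bounds by (intro mult_left_mono W_doubling) auto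
  finally show ?thesis unfolding d by (simp add: mult.assoc)
qed

section \<open>Morrey norms and the tail of the square function\<close>

lemma integral_le_morrey:
  assumes kap: "0 < \<kappa>" and r: "0 < r" and W: "0 < W a r"
  shows "(\<integral>\<^sup>+x\<in>ball a r. F x * ennreal (w x) \<partial>lebesgue) \<le> ennreal (W a r powr \<kappa>) * morrey_norm \<kappa> w F"
proof -
  let ?I = "\<integral>\<^sup>+x\<in>ball a r. F x * ennreal (w x) \<partial>lebesgue"
  have p: "ennreal_powr (wmeas w (ball a r)) \<kappa> = ennreal (W a r powr \<kappa>)"
    by (simp add: ennreal_powr_def wmeas_W)
  have p0: "0 < W a r powr \<kappa>" using W by simp
  have "1 / ennreal_powr (wmeas w (ball a r)) \<kappa> * ?I \<le> morrey_norm \<kappa> w F"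
    unfolding morrey_norm_def by (rule SUP_upper2[of "(a, r)"]) (use r in auto)
  then have "ennreal (W a r powr \<kappa>) * (1 / ennreal (W a r powr \<kappa>) * ?I) \<le> ennreal (W a r powr \<kappa>) * morrey_norm \<kappa> w F"
    unfolding p by (rule mult_left_mono) simp
  moreover have "ennreal (W a r powr \<kappa>) * (1 / ennreal (W a r powr \<kappa>)) = 1"
    using ennreal_mult_divide_self[of "ennreal (W a r powr \<kappa>)" 1] p0 by simp
  ultimately show ?thesis by (simp only: mult.assoc[symmetric] mult_1_left)
qed

text \<open>The weighted integral has the exponent \<kappa>; removing the weight from the integrand
  by \<open>A_1\<close> costs a division by \<open>W a r\<close>, which leaves \<kappa> - 1.\<close>

lemma integral_ball_le_morrey:
  assumes kap: "0 < \<kappa>" and r: "0 < r" and W: "0 < W a r" and F: "F \<in> borel_measurable lebesgue"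
  shows "(\<integral>\<^sup>+x\<in>ball a r. F x \<partial>lebesgue)
    \<le> ennreal (A * (unit_ball_vol (real CARD('n)) * r ^ CARD('n)) * W a r powr (\<kappa> - 1)) * morrey_norm \<kappa> w F"
proof -
  let ?v = "unit_ball_vol (real CARD('n)) * r ^ CARD('n)"
  have "ennreal (W a r) * (\<integral>\<^sup>+x\<in>ball a r. F x \<partial>lebesgue)
      \<le> ennreal A * ennreal ?v * (\<integral>\<^sup>+x\<in>ball a r. F x * ennreal (w x) \<partial>lebesgue)"
    using wmeas_mult_integral_le[OF r F, of a] unfolding wmeas_W emeasure_lebesgue_ball[OF less_imp_le[OF r]] .
  also have "\<dots> \<le> ennreal A * ennreal ?v * (ennreal (W a r powr \<kappa>) * morrey_norm \<kappa> w F)"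
    by (intro mult_left_mono integral_le_morrey kap r W) simp
  also have "\<dots> = ennreal (A * ?v * W a r powr \<kappa>) * morrey_norm \<kappa> w F"
    using A_pos r by (simp add: ennreal_mult mult.assoc)
  also have "A * ?v * W a r powr \<kappa> = W a r * (A * ?v * W a r powr (\<kappa> - 1))"
    using W by (simp add: powr_diff)
  also have "ennreal \<dots> * morrey_norm \<kappa> w F = ennreal (W a r) * (ennreal (A * ?v * W a r powr (\<kappa> - 1)) * morrey_norm \<kappa> w F)"
    using A_pos r W by (subst ennreal_mult) (auto simp: mult.assoc)
  finally show ?thesis by (rule ennreal_mult_le_cancel_left) (use W in auto)
qed

text \<open>A box contributes at \<open>x\<close> only if its ball leaves the doubled ball, so its
  radius exceeds \<open>r / 2\<close>. Its contribution is at most a constant times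
  \<open>W (gcentre i) (gradius i) powr (\<kappa> - 1)\<close> times the Morrey norm, and reverse
  doubling turns this into \<open>W a r powr (\<kappa> - 1)\<close> with a factor that decays
  geometrically in the scale.\<close>

lemma tail_le:
  assumes a: "0 < \<alpha>" "\<alpha> \<le> 1" and kap: "0 < \<kappa>" "\<kappa> < 1" and Wpos0: "\<forall>a r. 0 < r \<longrightarrow> 0 < W a r"
  obtains C where "0 < C" and "\<And>(f :: nat \<Rightarrow> real ^ 'n \<Rightarrow> complex) F a r x. (\<And>j. f j \<in> borel_measurable lebesgue) \<Longrightarrow>
    F \<in> borel_measurable lebesgue \<Longrightarrow> (\<And>x. (\<Sum>j. (ennreal (cmod (f j x)))\<^sup>2) = (F x)\<^sup>2) \<Longrightarrow>
    0 < r \<Longrightarrow> (\<And>j z. z \<in> ball a (2 * r) \<Longrightarrow> f j z = 0) \<Longrightarrow> x \<in> ball a r \<Longrightarrow>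
    vec_square \<alpha> f x \<le> (ennreal (C * W a r powr (\<kappa> - 1)) * morrey_norm \<kappa> w F)\<^sup>2"
proof -
  let ?n = "CARD('n)" let ?V = "unit_ball_vol (real CARD('n))"
  have Wpos: "0 < W a r" if "0 < r" for a r using Wpos0 that by blast
  \<comment> \<open>Less than 1 because \<theta> < 1 and \<kappa> < 1: this is where \<kappa> < 1
    makes the sum over the scales converge.\<close>
  define q where "q = \<theta> powr (1 - \<kappa>)"
  define D where "D = A * 5 ^ ?n"
  define K where "K = 2 * A * ?V * D powr (1 - \<kappa>)"
  define N where "N = (2 * (real ?n + 2) + 1) ^ ?n"
  have q: "0 < q" "q < 1" using theta_bounds kap powr_less_mono2[of "1 - \<kappa>" \<theta> 1] by (simp_all add: q_def)
  have D: "0 < D" using A_pos by (simp add: D_def)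
  have K: "0 < K" using A_pos D by (simp add: K_def)
  have N: "0 < N" by (auto simp: N_def intro!: zero_less_power add_nonneg_pos)
  have qd: "(\<theta> ^ d) powr (1 - \<kappa>) = q ^ d" for d
  proof (induction d)
    case (Suc d)
    have "(\<theta> ^ Suc d) powr (1 - \<kappa>) = \<theta> powr (1 - \<kappa>) * (\<theta> ^ d) powr (1 - \<kappa>)"
      unfolding power_Suc by (rule powr_mult)
    then show ?case using Suc.IH by (simp add: q_def)
  qed (use theta_bounds in simp)
  have bound: "vec_square \<alpha> f x \<le> (ennreal (N * K * (2 / (1 - q)) * W a r powr (\<kappa> - 1)) * morrey_norm \<kappa> w F)\<^sup>2"
    if f [measurable]: "\<And>j. f j \<in> borel_measurable lebesgue" and F [measurable]: "F \<in> borel_measurable lebesgue"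
      and fF: "\<And>x. (\<Sum>j. (ennreal (cmod (f j x)))\<^sup>2) = (F x)\<^sup>2" and r: "0 < r"
      and zero: "\<And>j z. z \<in> ball a (2 * r) \<Longrightarrow> f j z = 0" and x: "x \<in> ball a r"
    for f :: "nat \<Rightarrow> real ^ 'n \<Rightarrow> complex" and F a r x
  proof -
    define M where "M = morrey_norm \<kappa> w F"
    define \<omega> where "\<omega> = W a r"
    have om: "0 < \<omega>" using Wpos[OF r] by (simp add: \<omega>_def)
    define N2 where "N2 = 2 * (real ?n + 2)"
    have N2: "0 < N2" by (simp add: N2_def add_nonneg_pos)
    \<comment> \<open>\<open>k0\<close> is to be the smallest scale at which
      \<open>r < 2 * gradius i\<close>. In terms of \<open>T\<close> this condition reads
      \<open>T < dyad (fst i)\<close>, and \<open>dyad k1 <= T\<close> makes \<open>k1 + 1\<close>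
      minimal.\<close>
    define T where "T = r / N2"
    have "0 < T" using r N2 by (simp add: T_def)
    then obtain k1 where k1: "dyad k1 \<le> T" "T < 2 * dyad k1" using dyad_exists by blast
    define k0 where "k0 = k1 + 1"
    have "dyad k0 = 2 * dyad k1" using dyad_add[of k1 1] dyad_nat[of 1] by (simp add: k0_def)
    then have "T < dyad k0" using k1 by simp
    then have "r < N2 * dyad k0" using N2 by (simp add: T_def pos_divide_less_eq mult.commute)
    then have k0: "r < 2 * ((real ?n + 2) * dyad k0)" unfolding N2_def by (simp only: mult.assoc)
    have kge: "k0 \<le> fst i" if "r < 2 * gradius i" for i :: "int \<times> (int ^ 'n)"
    proof -
      have "r < N2 * dyad (fst i)" using that unfolding N2_def gradius_def by (simp only: mult.assoc)
      then have "T < dyad (fst i)" using N2 by (simp add: T_def pos_divide_less_eq mult.commute)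
      then have "dyad k1 < dyad (fst i)" using k1 by linarith
      then show ?thesis by (simp add: k0_def)
    qed
    define g where "g i = ennreal (K * \<omega> powr (\<kappa> - 1) * q ^ nat \<bar>fst i - k0\<bar>) * M * indicator (ball x (gradius i)) (gcentre i)"
      for i :: "int \<times> (int ^ 'n)"
    have term_le: "(\<Sum>j. (gcoef \<alpha> (f j) i)\<^sup>2) * indicator (gball i) x \<le> (g i)\<^sup>2" for i
    proof (cases "x \<in> gball i")
      case xi: True
      show ?thesis
      proof (cases "r < 2 * gradius i")
        case True
        let ?c = "ennreal (2 / gradius i ^ ?n)"
        have ki: "k0 \<le> fst i" by (rule kge[OF True])
        define \<omega>i where "\<omega>i = W (gcentre i) (gradius i)"
        have omi: "0 < \<omega>i" unfolding \<omega>i_def by (rule Wpos) simp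
        define d where "d = nat \<bar>fst i - k0\<bar>"
        have "\<omega> \<le> \<theta> ^ d * D * \<omega>i"
          unfolding \<omega>_def \<omega>i_def D_def d_def by (rule W_gball_ge[OF r k0 ki xi x])
        \<comment> \<open>The exponent \<kappa> - 1 is negative, which reverses the
          inequality.\<close>
        then have "(\<theta> ^ d * D * \<omega>i) powr (\<kappa> - 1) \<le> \<omega> powr (\<kappa> - 1)"
          using om kap by (intro powr_mono2') auto
        then have "(\<theta> ^ d * D) powr (1 - \<kappa>) * (\<theta> ^ d * D * \<omega>i) powr (\<kappa> - 1) \<le> (\<theta> ^ d * D) powr (1 - \<kappa>) * \<omega> powr (\<kappa> - 1)"
          by (rule mult_left_mono) simp
        also have "(\<theta> ^ d * D) powr (1 - \<kappa>) * (\<theta> ^ d * D * \<omega>i) powr (\<kappa> - 1) = \<omega>i powr (\<kappa> - 1)"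
        proof -
          have "(\<theta> ^ d * D * \<omega>i) powr (\<kappa> - 1) = (\<theta> ^ d * D) powr (\<kappa> - 1) * \<omega>i powr (\<kappa> - 1)"
            by (rule powr_mult)
          moreover have "(\<theta> ^ d * D) powr (1 - \<kappa>) * (\<theta> ^ d * D) powr (\<kappa> - 1) = 1"
            using theta_bounds D by (subst powr_add[symmetric]) simp
          ultimately show ?thesis by (simp only: mult.assoc[symmetric] mult_1_left)
        qed
        also have "(\<theta> ^ d * D) powr (1 - \<kappa>) = q ^ d * D powr (1 - \<kappa>)"
          unfolding powr_mult qd ..
        finally have omle: "\<omega>i powr (\<kappa> - 1) \<le> q ^ d * D powr (1 - \<kappa>) * \<omega> powr (\<kappa> - 1)" .
        have "gcoef \<alpha> (f j) i \<le> (\<integral>\<^sup>+z. ?c * indicator (gball i) z * ennreal (cmod (f j z)) \<partial>lebesgue)" for j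
        proof -
          have "gcoef \<alpha> (f j) i \<le> ?c * (\<integral>\<^sup>+z\<in>gball i. ennreal (cmod (f j z)) \<partial>lebesgue)"
            by (rule gcoef_le[OF a f])
          also have "\<dots> = (\<integral>\<^sup>+z. ?c * (ennreal (cmod (f j z)) * indicator (gball i) z) \<partial>lebesgue)"
            by (rule nn_integral_cmult[symmetric]) measurable
          finally show ?thesis by (simp only: mult_ac)
        qed
        then have "(\<Sum>j. (gcoef \<alpha> (f j) i)\<^sup>2) \<le> (\<Sum>j. (\<integral>\<^sup>+z. ?c * indicator (gball i) z * ennreal (cmod (f j z)) \<partial>lebesgue)\<^sup>2)"
          by (intro suminf_le power_mono) auto
        also have "\<dots> \<le> (\<integral>\<^sup>+z. ?c * indicator (gball i) z * F z \<partial>lebesgue)\<^sup>2"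
          by (rule minkowski_csum[OF f _ F fF]) measurable
        also have "(\<integral>\<^sup>+z. ?c * indicator (gball i) z * F z \<partial>lebesgue) = ?c * (\<integral>\<^sup>+z\<in>gball i. F z \<partial>lebesgue)"
        proof -
          have "(\<integral>\<^sup>+z. ?c * indicator (gball i) z * F z \<partial>lebesgue) = (\<integral>\<^sup>+z. ?c * (F z * indicator (gball i) z) \<partial>lebesgue)"
            by (simp only: mult_ac)
          also have "\<dots> = ?c * (\<integral>\<^sup>+z\<in>gball i. F z \<partial>lebesgue)" by (rule nn_integral_cmult) measurable
          finally show ?thesis .
        qed
        also have "(?c * (\<integral>\<^sup>+z\<in>gball i. F z \<partial>lebesgue))\<^sup>2 \<le> (g i)\<^sup>2"
        proof (rule power_mono)
          have "?c * (\<integral>\<^sup>+z\<in>gball i. F z \<partial>lebesgue) \<le> ?c * (ennreal (A * (?V * gradius i ^ ?n) * \<omega>i powr (\<kappa> - 1)) * M)"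
            unfolding gball_def \<omega>i_def M_def
            by (intro mult_left_mono integral_ball_le_morrey kap(1) gradius_pos(1) Wpos F) simp
          also have "\<dots> = ennreal (2 / gradius i ^ ?n * (A * (?V * gradius i ^ ?n) * \<omega>i powr (\<kappa> - 1))) * M"
            using A_pos by (subst ennreal_mult) (auto simp: mult.assoc)
          also have "2 / gradius i ^ ?n * (A * (?V * gradius i ^ ?n) * \<omega>i powr (\<kappa> - 1)) = 2 * A * ?V * \<omega>i powr (\<kappa> - 1)"
            by simp
          also have "ennreal (2 * A * ?V * \<omega>i powr (\<kappa> - 1)) * M \<le> ennreal (K * \<omega> powr (\<kappa> - 1) * q ^ d) * M"
          proof (intro mult_right_mono ennreal_leI)
            have "2 * A * ?V * \<omega>i powr (\<kappa> - 1) \<le> 2 * A * ?V * (q ^ d * D powr (1 - \<kappa>) * \<omega> powr (\<kappa> - 1))"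
              using A_pos by (intro mult_left_mono omle) auto
            then show "2 * A * ?V * \<omega>i powr (\<kappa> - 1) \<le> K * \<omega> powr (\<kappa> - 1) * q ^ d" by (simp add: K_def mult_ac)
          qed simp
          also have "\<dots> = g i" using xi by (simp add: g_def d_def gball_def dist_commute)
          finally show "?c * (\<integral>\<^sup>+z\<in>gball i. F z \<partial>lebesgue) \<le> g i" .
        qed simp
        finally show ?thesis using xi by simp
      next
        \<comment> \<open>A small ball containing \<open>x\<close> lies in the doubled ball, where
          all \<open>f j\<close> vanish.\<close>
        case False
        have sub: "gball i \<subseteq> ball a (2 * r)"
        proof
          fix z assume "z \<in> gball i"
          then have "dist (gcentre i) z < gradius i" by (simp add: gball_def)
          moreover have "dist (gcentre i) x < gradius i" using xi by (simp add: gball_def)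
          moreover have "dist a z \<le> dist a x + (dist (gcentre i) x + dist (gcentre i) z)"
            using dist_triangle[of a z x] dist_triangle3[of x z "gcentre i"] by linarith
          ultimately show "z \<in> ball a (2 * r)" using x False by simp
        qed
        have "gcoef \<alpha> (f j) i = 0" for j
        proof -
          have "(\<integral>\<^sup>+z\<in>gball i. ennreal (cmod (f j z)) \<partial>lebesgue) = (\<integral>\<^sup>+z. 0 \<partial>(lebesgue :: (real ^ 'n) measure))"
            by (rule nn_integral_cong) (use sub zero in \<open>auto split: split_indicator\<close>)
          then show ?thesis using gcoef_le[OF a f[of j], of i] by simp
        qed
        then show ?thesis by simp
      qed
    qed simp
    have row: "csum (\<lambda>m. g (k, m)) \<le> ennreal (N * K * \<omega> powr (\<kappa> - 1)) * M * ennreal (q ^ nat \<bar>k - k0\<bar>)" for k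
    proof -
      define t where "t = (real ?n + 2) * dyad k"
      have t: "gradius (k, m) = t" for m :: "int^'n" by (simp add: gradius_def t_def)
      have t0: "0 < t" using t gradius_pos(1) by metis
      have "csum (\<lambda>m. g (k, m)) = ennreal (K * \<omega> powr (\<kappa> - 1) * q ^ nat \<bar>k - k0\<bar>) * M * csum (\<lambda>m. indicator (ball x t) (gcentre (k, m)))"
        unfolding g_def t fst_conv by (rule nn_integral_cmult) simp
      also have "\<dots> \<le> ennreal (K * \<omega> powr (\<kappa> - 1) * q ^ nat \<bar>k - k0\<bar>) * M * ennreal ((2 * t / dyad k + 1) ^ ?n)"
        using t0 by (intro mult_left_mono csum_grid_le) auto
      also have "(2 * t / dyad k + 1) ^ ?n = N" by (simp add: t_def N_def)
      also have "ennreal (K * \<omega> powr (\<kappa> - 1) * q ^ nat \<bar>k - k0\<bar>) * M * ennreal N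
          = ennreal (N * K * \<omega> powr (\<kappa> - 1)) * M * ennreal (q ^ nat \<bar>k - k0\<bar>)"
        using K N q by (simp add: ennreal_mult mult_ac)
      finally show ?thesis .
    qed
    have "csum g = csum (\<lambda>k. csum (\<lambda>m. g (k, m)))" by (rule csum_prod)
    also have "\<dots> \<le> csum (\<lambda>k. ennreal (N * K * \<omega> powr (\<kappa> - 1)) * M * ennreal (q ^ nat \<bar>k - k0\<bar>))"
      by (rule nn_integral_mono) (rule row)
    also have "\<dots> = ennreal (N * K * \<omega> powr (\<kappa> - 1)) * M * csum (\<lambda>k. ennreal (q ^ nat \<bar>k - k0\<bar>))"
      by (rule nn_integral_cmult) simp
    also have "\<dots> \<le> ennreal (N * K * \<omega> powr (\<kappa> - 1)) * M * ennreal (2 / (1 - q))"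
      by (intro mult_left_mono csum_geometric_int q) simp
    also have "\<dots> = ennreal (N * K * (2 / (1 - q)) * \<omega> powr (\<kappa> - 1)) * M"
    proof -
      have "N * K * (2 / (1 - q)) * \<omega> powr (\<kappa> - 1) = (N * K * \<omega> powr (\<kappa> - 1)) * (2 / (1 - q))" by simp
      also have "ennreal \<dots> = ennreal (N * K * \<omega> powr (\<kappa> - 1)) * ennreal (2 / (1 - q))"
        by (rule ennreal_mult) (use K N q in auto)
      finally show ?thesis by (simp only: mult_ac)
    qed
    finally have csg: "csum g \<le> ennreal (N * K * (2 / (1 - q)) * \<omega> powr (\<kappa> - 1)) * M" .
    have "vec_square \<alpha> f x \<le> csum (\<lambda>i. (g i)\<^sup>2)"
      unfolding vec_square_swap by (rule nn_integral_mono) (rule term_le)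
    also have "\<dots> \<le> (csum g)\<^sup>2" by (rule csum_power2_le)
    also have "\<dots> \<le> (ennreal (N * K * (2 / (1 - q)) * \<omega> powr (\<kappa> - 1)) * M)\<^sup>2"
      by (rule power_mono[OF csg]) simp
    finally show ?thesis by (simp only: \<omega>_def M_def)
  qed
  have "0 < N * K * (2 / (1 - q))" using N K q by simp
  then show ?thesis using bound by (rule that)
qed

text \<open>By doubling, all larger concentric balls of the form considered have weight 0, and they
  exhaust the space. So either the weight is null or every ball has positive weight and may be
  divided by.\<close>

lemma wmeas_trivial:
  assumes r: "0 < r" and z: "W a r = 0"
  shows "wmeas w E = 0"
proof -
  have ball: "wmeas w (ball a (real (Suc m) * r)) = 0" for m :: nat
  proof -
    have "W a (real (Suc m) * r) \<le> 0" using W_doubling[OF r, of "real (Suc m)" a] z by simp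
    then have "W a (real (Suc m) * r) = 0" using W_nonneg by (rule antisym)
    then show ?thesis by (simp only: wmeas_W ennreal_0)
  qed
  have "AE x in lebesgue. \<forall>m. ennreal (w x) * indicator (ball a (real (Suc m) * r)) x = 0"
    unfolding AE_all_countable
  proof
    fix m :: nat
    have "(\<integral>\<^sup>+x. ennreal (w x) * indicator (ball a (real (Suc m) * r)) x \<partial>lebesgue) = 0"
      using ball[of m] by (simp only: wmeas_def)
    then show "AE x in lebesgue. ennreal (w x) * indicator (ball a (real (Suc m) * r)) x = 0"
      by (subst (asm) nn_integral_0_iff_AE) auto
  qed
  then have "AE x in lebesgue. ennreal (w x) * indicator E x = 0"
  proof eventually_elim
    case (elim x)
    obtain m :: nat where "dist a x / r < real m" using reals_Archimedean2 by blast
    then have "dist a x < real (Suc m) * r" using r by (simp add: field_simps add_strict_increasing)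
    then have "x \<in> ball a (real (Suc m) * r)" by simp
    then have "ennreal (w x) = 0" using elim[rule_format, of m] by simp
    then show ?case by simp
  qed
  then have "(\<integral>\<^sup>+x. ennreal (w x) * indicator E x \<partial>lebesgue) = (\<integral>\<^sup>+x. 0 \<partial>(lebesgue :: (real ^ 'n) measure))"
    by (rule nn_integral_cong_AE)
  then show ?thesis by (simp add: wmeas_def)
qed

end

section \<open>The estimate in Morrey spaces\<close>

lemma borel_measurable_ennreal_powr [measurable (raw)]:
  assumes [measurable]: "g \<in> borel_measurable M"
  shows "(\<lambda>x. ennreal_powr (g x) p) \<in> borel_measurable M"
  unfolding ennreal_powr_def by measurable

theorem theorem1p2:
  fixes \<alpha> \<kappa> :: real and w :: "real ^ 'n \<Rightarrow> real"
  assumes "0 < \<alpha>" and "\<alpha> \<le> 1" and "0 < \<kappa>" and "\<kappa> < 1" and "A1_weight w"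
  shows "\<exists>C::real. C > 0 \<and>
    (\<forall>f :: nat \<Rightarrow> real ^ 'n \<Rightarrow> complex. (\<forall>j. locally_integrable (f j)) \<longrightarrow>
      weak_morrey_norm \<kappa> w (\<lambda>x. ennreal_powr (\<Sum>j. (S_fun \<alpha> (f j) x)\<^sup>2) (1/2))
        \<le> ennreal C *
          morrey_norm \<kappa> w (\<lambda>x. ennreal_powr (\<Sum>j. (ennreal (cmod (f j x)))\<^sup>2) (1/2)))"
proof -
  obtain A where "A1_bound w A" using A1_weight_A1_bound[OF assms(5)] by blast
  then interpret A1_bound w A .
  note a = assms(1,2) and kap = assms(3,4)
  show ?thesis
  \<comment> \<open>For a null weight the weak norm is 0, since \<open>1 / 0 * 0 = 0\<close>; in the
    other case all balls have positive weight.\<close>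
  proof (cases "\<exists>a r. 0 < r \<and> W a r = 0")
    case True
    then have "wmeas w E = 0" for E using wmeas_trivial by blast
    then have "weak_morrey_norm \<kappa> w g = 0" for g
      unfolding weak_morrey_norm_def by (simp add: image_constant_conv)
    then show ?thesis by (intro exI[of _ 1]) simp
  next
    case False
    then have Wpos0: "\<forall>a r. 0 < r \<longrightarrow> 0 < W a r" using W_nonneg by (metis order_le_less)
    then have Wpos: "0 < W a r" if "0 < r" for a r using that by blast
    obtain cS where cS: "0 < cS" "\<And>(f :: real ^ 'n \<Rightarrow> complex) x.
        (S_fun \<alpha> f x)\<^sup>2 \<le> ennreal cS * csum (\<lambda>i. (gcoef \<alpha> f i)\<^sup>2 * indicator (gball i) x)"
      using S_fun_power2_le a by blast
    obtain CW where CW: "0 < CW" "\<And>(f :: nat \<Rightarrow> real ^ 'n \<Rightarrow> complex) F l. (\<And>j. integrable lebesgue (f j)) \<Longrightarrow>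
        F \<in> borel_measurable lebesgue \<Longrightarrow> (\<And>x. (\<Sum>j. (ennreal (cmod (f j x)))\<^sup>2) = (F x)\<^sup>2) \<Longrightarrow>
        (\<integral>\<^sup>+x. F x \<partial>lebesgue) < top \<Longrightarrow> 0 < l \<Longrightarrow>
        ennreal l * wmeas w {x. ennreal (l\<^sup>2) < vec_square \<alpha> f x} \<le> ennreal CW * (\<integral>\<^sup>+x. F x * ennreal (w x) \<partial>lebesgue)"
      using weak_type_vec_square[OF a] by blast
    obtain CT where CT: "0 < CT" "\<And>(f :: nat \<Rightarrow> real ^ 'n \<Rightarrow> complex) F a r x. (\<And>j. f j \<in> borel_measurable lebesgue) \<Longrightarrow>
        F \<in> borel_measurable lebesgue \<Longrightarrow> (\<And>x. (\<Sum>j. (ennreal (cmod (f j x)))\<^sup>2) = (F x)\<^sup>2) \<Longrightarrow>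
        0 < r \<Longrightarrow> (\<And>j z. z \<in> ball a (2 * r) \<Longrightarrow> f j z = 0) \<Longrightarrow> x \<in> ball a r \<Longrightarrow>
        vec_square \<alpha> f x \<le> (ennreal (CT * W a r powr (\<kappa> - 1)) * morrey_norm \<kappa> w F)\<^sup>2"
    proof (rule tail_le[OF a kap Wpos0], goal_cases)
      case (1 C)
      show ?case by (rule 1(1)[OF 1(2)], rule 1(3)) blast+
    qed
    define D where "D = A * 2 ^ CARD('n)"
    define C0 where "C0 = CW * D powr \<kappa> + CT"
    \<comment> \<open>\<open>2 * sqrt cS\<close> is the ratio of the level \<open>s\<close> for the
      square function to the level \<open>l\<close> at which the local part and the tail are
      estimated.\<close>
    define C where "C = 2 * sqrt cS * C0"
    have D: "0 < D" using A_pos by (simp add: D_def)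
    have C0: "0 < C0" using CW(1) CT(1) D by (simp add: C0_def add_pos_pos)
    have C: "0 < C" using cS(1) C0 by (simp add: C_def)
    have main: "1 / ennreal_powr (wmeas w (ball a r)) \<kappa> *
        (ennreal s * wmeas w {x \<in> ball a r. ennreal_powr (\<Sum>j. (S_fun \<alpha> (f j) x)\<^sup>2) (1/2) > ennreal s})
        \<le> ennreal C * morrey_norm \<kappa> w (\<lambda>x. ennreal_powr (\<Sum>j. (ennreal (cmod (f j x)))\<^sup>2) (1/2))"
      if f: "\<And>j. locally_integrable (f j)" and r: "0 < r" and s: "0 < s"
      for f :: "nat \<Rightarrow> real ^ 'n \<Rightarrow> complex" and a r s
    proof -
      define F where "F x = ennreal_powr (\<Sum>j. (ennreal (cmod (f j x)))\<^sup>2) (1/2)" for x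
      define M where "M = morrey_norm \<kappa> w F"
      have [measurable]: "f j \<in> borel_measurable lebesgue" for j by (rule locally_integrable_borel[OF f])
      have F [measurable]: "F \<in> borel_measurable lebesgue" unfolding F_def[abs_def] by measurable
      have fF: "(\<Sum>j. (ennreal (cmod (f j x)))\<^sup>2) = (F x)\<^sup>2" for x by (simp only: F_def ennreal_powr_half_power2)
      define \<omega> where "\<omega> = W a r"
      have om: "0 < \<omega>" unfolding \<omega>_def by (rule Wpos[OF r])
      define E where "E = {x \<in> ball a r. ennreal s < ennreal_powr (\<Sum>j. (S_fun \<alpha> (f j) x)\<^sup>2) (1/2)}"
      have "1 / ennreal (\<omega> powr \<kappa>) * (ennreal s * wmeas w E) \<le> ennreal C * M"
      \<comment> \<open>Finiteness of \<open>M\<close> makes the local part \<open>F0\<close>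
        integrable, as the weak type bound requires.\<close>
      proof (cases "M = top")
        case True
        then show ?thesis using C by (simp add: ennreal_mult_top)
      next
        case False
        define B2 where "B2 = ball a (2 * r)"
        have B2 [measurable]: "B2 \<in> sets lebesgue" by (simp add: B2_def)
        have r2: "0 < 2 * r" using r by simp
        define f0 where "f0 j z = indicator B2 z *\<^sub>R f j z" for j z
        define f1 where "f1 j z = (1 - indicator B2 z) *\<^sub>R f j z" for j z
        define F0 where "F0 z = F z * indicator B2 z" for z
        define F1 where "F1 z = F z * indicator (- B2) z" for z
        have B2c: "- B2 \<in> sets lebesgue" using B2 by (simp only: Compl_in_sets_lebesgue)
        note [measurable] = B2c
        have f01: "f j z = f0 j z + f1 j z" for j z by (simp add: f0_def f1_def flip: scaleR_left_distrib)
        have f0i: "integrable lebesgue (f0 j)" for j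
          using locally_integrable_set_integrable_ball[OF f] unfolding f0_def[abs_def] B2_def set_integrable_def .
        have f0l: "locally_integrable (f0 j)" for j by (rule integrable_imp_locally_integrable[OF f0i])
        have f1l: "locally_integrable (f1 j)" for j
          unfolding locally_integrable_def
        proof (intro allI impI)
          fix S :: "(real ^ 'n) set" assume S: "compact S"
          have "set_integrable lebesgue S (f j)" "set_integrable lebesgue S (f0 j)"
            using f f0l S by (auto simp: locally_integrable_def)
          then have "set_integrable lebesgue S (\<lambda>z. f j z - f0 j z)" by (rule set_integral_diff)
          then show "set_integrable lebesgue S (f1 j)" using f01 by (simp add: fun_eq_iff)
        qed
        have F0 [measurable]: "F0 \<in> borel_measurable lebesgue" unfolding F0_def[abs_def] by measurable
        have F1 [measurable]: "F1 \<in> borel_measurable lebesgue" unfolding F1_def[abs_def] by measurable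
        have fF0: "(\<Sum>j. (ennreal (cmod (f0 j x)))\<^sup>2) = (F0 x)\<^sup>2" for x
          using fF[of x] by (simp add: f0_def F0_def split: split_indicator)
        have fF1: "(\<Sum>j. (ennreal (cmod (f1 j x)))\<^sup>2) = (F1 x)\<^sup>2" for x
          using fF[of x] by (simp add: f1_def F1_def split: split_indicator)
        have MF1: "morrey_norm \<kappa> w F1 \<le> M"
          unfolding M_def morrey_norm_def F1_def
          by (intro SUP_mono') (auto intro!: mult_left_mono nn_integral_mono split: split_indicator)
        have F0fin: "(\<integral>\<^sup>+x. F0 x \<partial>lebesgue) < top"
        proof -
          have "(\<integral>\<^sup>+x\<in>ball a (2 * r). F x \<partial>lebesgue) < top"
            using False by (intro order_le_less_trans[OF integral_ball_le_morrey[OF kap(1) r2 Wpos[OF r2] F]])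
              (simp add: M_def ennreal_mult_less_top less_top)
          then show ?thesis by (simp only: F0_def B2_def)
        qed
        \<comment> \<open>Chosen so that \<open>cS * (2 * l^2 + 2 * l^2) = s^2\<close>: where
          neither part exceeds \<open>l^2\<close>, the square function cannot exceed
          \<open>s\<close>.\<close>
        define l where "l = s / (2 * sqrt cS)"
        have l: "0 < l" using s cS(1) by (simp add: l_def)
        have l2: "cS * (4 * l\<^sup>2) = s\<^sup>2" using cS(1) by (simp add: l_def power_divide power_mult_distrib)
        define E0 where "E0 = {x. ennreal (l\<^sup>2) < vec_square \<alpha> f0 x}"
        define E1 where "E1 = {x \<in> ball a r. ennreal (l\<^sup>2) \<le> vec_square \<alpha> f1 x}"
        have E0m: "E0 \<in> sets lebesgue"
        proof -
          have "{x \<in> space lebesgue. ennreal (l\<^sup>2) < vec_square \<alpha> f0 x} \<in> sets lebesgue" by measurable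
          then show ?thesis by (simp add: E0_def)
        qed
        have E1m: "E1 \<in> sets lebesgue"
        proof -
          have "{x \<in> space lebesgue. x \<in> ball a r \<and> ennreal (l\<^sup>2) \<le> vec_square \<alpha> f1 x} \<in> sets lebesgue" by measurable
          then show ?thesis by (simp add: E1_def)
        qed
        \<comment> \<open>\<open>E\<close> is defined by \<open>S_fun\<close>; its weight is bounded
          through this inclusion in sets that are measurable because \<open>vec_square\<close>
          is.\<close>
        have sub: "E \<subseteq> E0 \<union> E1"
        proof
          fix x assume x: "x \<in> E"
          show "x \<in> E0 \<union> E1"
          proof (rule ccontr)
            assume "x \<notin> E0 \<union> E1"
            then have 0: "vec_square \<alpha> f0 x \<le> ennreal (l\<^sup>2)" and 1: "vec_square \<alpha> f1 x \<le> ennreal (l\<^sup>2)"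
              using x by (auto simp: E0_def E1_def E_def not_le not_less less_imp_le)
            have "vec_square \<alpha> f x = vec_square \<alpha> (\<lambda>j z. f0 j z + f1 j z) x" by (simp only: f01[symmetric])
            also have "\<dots> \<le> 2 * vec_square \<alpha> f0 x + 2 * vec_square \<alpha> f1 x"
              by (rule vec_square_add_le[OF a f0l f1l])
            also have "\<dots> \<le> 2 * ennreal (l\<^sup>2) + 2 * ennreal (l\<^sup>2)" by (intro add_mono mult_left_mono 0 1) auto
            also have "\<dots> = ennreal (4 * l\<^sup>2)"
            proof -
              have "2 * ennreal (l\<^sup>2) + 2 * ennreal (l\<^sup>2) = 4 * ennreal (l\<^sup>2)" by (simp flip: distrib_right)
              then show ?thesis by (simp add: ennreal_mult)
            qed
            finally have v: "vec_square \<alpha> f x \<le> ennreal (4 * l\<^sup>2)" .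
            have "(\<Sum>j. (S_fun \<alpha> (f j) x)\<^sup>2) \<le> (\<Sum>j. ennreal cS * csum (\<lambda>i. (gcoef \<alpha> (f j) i)\<^sup>2 * indicator (gball i) x))"
              by (intro suminf_le cS(2)) auto
            also have "\<dots> = ennreal cS * vec_square \<alpha> f x" by (simp only: ennreal_suminf_cmult vec_square_def)
            also have "\<dots> \<le> ennreal cS * ennreal (4 * l\<^sup>2)" by (intro mult_left_mono v) simp
            also have "\<dots> = (ennreal s)\<^sup>2" using cS(1) s by (simp add: ennreal_mult[symmetric] l2 ennreal_power)
            finally have "(ennreal_powr (\<Sum>j. (S_fun \<alpha> (f j) x)\<^sup>2) (1/2))\<^sup>2 \<le> (ennreal s)\<^sup>2"
              by (simp only: ennreal_powr_half_power2)
            then have "ennreal_powr (\<Sum>j. (S_fun \<alpha> (f j) x)\<^sup>2) (1/2) \<le> ennreal s"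
              by (simp only: ennreal_power2_mono_iff)
            then show False using x leD unfolding E_def by blast
          qed
        qed
        have b0: "ennreal l * wmeas w E0 \<le> ennreal (CW * D powr \<kappa> * \<omega> powr \<kappa>) * M"
        proof -
          have "ennreal l * wmeas w E0 \<le> ennreal CW * (\<integral>\<^sup>+x. F0 x * ennreal (w x) \<partial>lebesgue)"
            unfolding E0_def by (rule CW(2)[OF f0i F0 fF0 F0fin l])
          also have "(\<integral>\<^sup>+x. F0 x * ennreal (w x) \<partial>lebesgue) = (\<integral>\<^sup>+x\<in>ball a (2 * r). F x * ennreal (w x) \<partial>lebesgue)"
            unfolding F0_def B2_def by (rule nn_integral_cong) (simp only: mult_ac)
          also have "\<dots> \<le> ennreal (W a (2 * r) powr \<kappa>) * M"
            unfolding M_def by (rule integral_le_morrey[OF kap(1) r2 Wpos[OF r2]])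
          also have "\<dots> \<le> ennreal (D powr \<kappa> * \<omega> powr \<kappa>) * M"
          proof (intro mult_right_mono ennreal_leI)
            have "W a (2 * r) powr \<kappa> \<le> (D * \<omega>) powr \<kappa>"
              unfolding D_def \<omega>_def using kap by (intro powr_mono2 W_doubling r) auto
            also have "\<dots> = D powr \<kappa> * \<omega> powr \<kappa>" by (rule powr_mult)
            finally show "W a (2 * r) powr \<kappa> \<le> D powr \<kappa> * \<omega> powr \<kappa>" .
          qed simp
          finally have "ennreal l * wmeas w E0 \<le> ennreal CW * (ennreal (D powr \<kappa> * \<omega> powr \<kappa>) * M)"
            by (simp add: mult_left_mono)
          also have "\<dots> = ennreal (CW * D powr \<kappa> * \<omega> powr \<kappa>) * M"
            using CW(1) by (simp add: ennreal_mult mult.assoc)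
          finally show ?thesis .
        qed
        \<comment> \<open>The tail bound is uniform on \<open>ball a r\<close>: if \<open>E1\<close>
          has any point at all, then \<open>l\<close> is at most
          \<open>CT * \<omega> powr (\<kappa> - 1) * M\<close>, and the whole ball has weight
          \<omega>.\<close>
        have b1: "ennreal l * wmeas w E1 \<le> ennreal (CT * \<omega> powr \<kappa>) * M"
        proof (cases "E1 = {}")
          case True
          then show ?thesis by (simp add: wmeas_def)
        next
          case False
          then obtain x where x: "x \<in> ball a r" "ennreal (l\<^sup>2) \<le> vec_square \<alpha> f1 x" by (auto simp: E1_def)
          have "(ennreal l)\<^sup>2 \<le> vec_square \<alpha> f1 x" using x(2) l by (simp add: ennreal_power)
          also have "\<dots> \<le> (ennreal (CT * W a r powr (\<kappa> - 1)) * morrey_norm \<kappa> w F1)\<^sup>2"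
          proof (rule CT(2)[OF _ F1 fF1 r _ x(1)])
            show "f1 j \<in> borel_measurable lebesgue" for j by (rule locally_integrable_borel[OF f1l])
            show "f1 j z = 0" if "z \<in> ball a (2 * r)" for j z using that by (simp add: f1_def B2_def)
          qed
          finally have "ennreal l \<le> ennreal (CT * W a r powr (\<kappa> - 1)) * morrey_norm \<kappa> w F1"
            by (simp only: ennreal_power2_mono_iff)
          also have "\<dots> \<le> ennreal (CT * \<omega> powr (\<kappa> - 1)) * M" unfolding \<omega>_def by (intro mult_left_mono MF1) simp
          finally have le: "ennreal l \<le> ennreal (CT * \<omega> powr (\<kappa> - 1)) * M" .
          have "wmeas w E1 \<le> wmeas w (ball a r)" by (rule wmeas_mono) (auto simp: E1_def)
          also have "\<dots> = ennreal \<omega>" by (simp add: wmeas_W \<omega>_def)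
          finally have "ennreal l * wmeas w E1 \<le> ennreal (CT * \<omega> powr (\<kappa> - 1)) * M * ennreal \<omega>"
            by (intro mult_mono le) auto
          also have "\<dots> = ennreal (CT * \<omega> powr (\<kappa> - 1) * \<omega>) * M"
            using CT(1) om by (subst ennreal_mult) (auto simp: mult_ac)
          also have "CT * \<omega> powr (\<kappa> - 1) * \<omega> = CT * \<omega> powr \<kappa>" using om by (simp add: powr_diff)
          finally show ?thesis .
        qed
        have lE: "ennreal l * wmeas w E \<le> ennreal (C0 * \<omega> powr \<kappa>) * M"
        proof -
          have "ennreal l * wmeas w E \<le> ennreal l * (wmeas w E0 + wmeas w E1)"
            by (intro mult_left_mono order_trans[OF wmeas_mono[OF sub] wmeas_Un_le[OF E0m E1m]]) simp
          also have "\<dots> \<le> ennreal (CW * D powr \<kappa> * \<omega> powr \<kappa>) * M + ennreal (CT * \<omega> powr \<kappa>) * M"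
            unfolding distrib_left by (intro add_mono b0 b1)
          also have "\<dots> = ennreal (C0 * \<omega> powr \<kappa>) * M"
          proof -
            have "ennreal (C0 * \<omega> powr \<kappa>) = ennreal (CW * D powr \<kappa> * \<omega> powr \<kappa>) + ennreal (CT * \<omega> powr \<kappa>)"
              unfolding C0_def distrib_right by (rule ennreal_plus) (use CW(1) CT(1) in auto)
            then show ?thesis by (simp only: distrib_right)
          qed
          finally show ?thesis .
        qed
        have p0: "0 < \<omega> powr \<kappa>" using om by simp
        have "ennreal s * wmeas w E = ennreal (2 * sqrt cS) * (ennreal l * wmeas w E)"
        proof -
          have "s = 2 * sqrt cS * l" using cS(1) by (simp add: l_def)
          then have "ennreal s = ennreal (2 * sqrt cS) * ennreal l" using cS(1) l by (simp only: ennreal_mult[symmetric]) (simp add: ennreal_mult'')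
          then show ?thesis by (simp only: mult.assoc)
        qed
        also have "\<dots> \<le> ennreal (2 * sqrt cS) * (ennreal (C0 * \<omega> powr \<kappa>) * M)" by (intro mult_left_mono lE) simp
        also have "\<dots> = ennreal (\<omega> powr \<kappa>) * (ennreal C * M)"
        proof -
          have "ennreal (\<omega> powr \<kappa>) * ennreal C = ennreal (2 * sqrt cS) * ennreal (C0 * \<omega> powr \<kappa>)"
            using C C0 cS(1) p0 by (subst (1 2) ennreal_mult[symmetric]) (auto simp: C_def mult_ac)
          then show ?thesis by (simp only: mult.assoc[symmetric])
        qed
        finally have "1 / ennreal (\<omega> powr \<kappa>) * (ennreal s * wmeas w E) \<le> 1 / ennreal (\<omega> powr \<kappa>) * (ennreal (\<omega> powr \<kappa>) * (ennreal C * M))"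
          by (rule mult_left_mono) simp
        also have "\<dots> = ennreal C * M"
        proof -
          have "1 / ennreal (\<omega> powr \<kappa>) * ennreal (\<omega> powr \<kappa>) = 1"
            using ennreal_mult_divide_self[of "ennreal (\<omega> powr \<kappa>)" 1] p0 by (simp add: mult.commute)
          then show ?thesis by (simp only: mult.assoc[symmetric] mult_1_left)
        qed
        finally show ?thesis .
      qed
      moreover have "ennreal_powr (wmeas w (ball a r)) \<kappa> = ennreal (\<omega> powr \<kappa>)"
        by (simp add: ennreal_powr_def wmeas_W \<omega>_def)
      ultimately show ?thesis unfolding E_def M_def F_def by simp
    qed
    show ?thesis
    proof (intro exI[of _ C] conjI C allI impI)
      fix f :: "nat \<Rightarrow> real ^ 'n \<Rightarrow> complex" assume f: "\<forall>j. locally_integrable (f j)"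
      show "weak_morrey_norm \<kappa> w (\<lambda>x. ennreal_powr (\<Sum>j. (S_fun \<alpha> (f j) x)\<^sup>2) (1/2))
        \<le> ennreal C * morrey_norm \<kappa> w (\<lambda>x. ennreal_powr (\<Sum>j. (ennreal (cmod (f j x)))\<^sup>2) (1/2))"
        unfolding weak_morrey_norm_def
      proof (rule SUP_least, clarify, rule SUP_least)
        fix a :: "real ^ 'n" and r s :: real assume "0 < r" "s \<in> {0<..}"
        then show "1 / ennreal_powr (wmeas w (ball a r)) \<kappa> *
            (ennreal s * wmeas w {x \<in> ball a r. ennreal s < ennreal_powr (\<Sum>j. (S_fun \<alpha> (f j) x)\<^sup>2) (1/2)})
            \<le> ennreal C * morrey_norm \<kappa> w (\<lambda>x. ennreal_powr (\<Sum>j. (ennreal (cmod (f j x)))\<^sup>2) (1/2))"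
          using f by (intro main) auto
      qed
    qed
  qed
qed

end
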